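(* Let $D\subset\mathbb{R}^2$ be a closed subset homeomorphic to the closed unit disk, with frontier $\partial D$, and let $f,g:D\to\mathbb{R}$ be regular functions on $D$. Then every homeomorphism $\varphi_0:\partial D\to\partial D$ satisfying $g\circ\varphi_0=f$ on $\partial D$ can be extended to a homeomorphism $\varphi:D\to D$ satisfying $g\circ\varphi=f$.
   Context: $\mathbb{R}^2$ is identified with $\mathbb{C}$; $\operatorname{Int}$ and $\operatorname{Fr}$ denote interior and frontier. Regular points. Let $W\subset\mathbb{R}^2$ be a domain and $f:\overline W\to\mathbb{R}$ continuous. A point $z_0\in W$ is a regular point of $f$ if there are an open neighbourhood $U\subseteq W$ of $z_0$, a number $r>0$ and a homeomorphism $\varphi:U\to\{z:|z|<r\}$ with $\varphi(z_0)=0$ and $f\circ\varphi^{-1}(z)=\operatorname{Re}z+f(z_0)$ for all $|z|<r$. A point $z_0\in\operatorname{Fr}W$ is a regular boundary point of $f$ if there are an open neighbourhood $U$ of $z_0$ in the space $\overline W$ and a homeomorphism $\psi:U\to D^2_+=\{z:|z|<1,\ \operatorname{Im}z\ge0\}$ such that $\psi(z_0)=0$, $\psi(U\cap f^{-1}(f(z_0)))=\{0\}\times[0,1)$, $\psi(U\cap\operatorname{Fr}W)=(-1,1)\times\{0\}$ and $f\circ\psi^{-1}$ is strictly monotone on $(-1,1)\times\{0\}$. Weakly regular functions. Let $D\subset\mathbb{R}^2$ be closed and homeomorphic to the closed unit disk (so $W=\operatorname{Int}D$), and fix an orientation of the circle $\operatorname{Fr}D$. A continuous $f:D\to\mathbb{R}$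 is weakly regular on $D$ if there are $n\ge2$ and points $z_1,\dots,z_{2n}\in\operatorname{Fr}D$, passed through consecutively in this order when $\operatorname{Fr}D$ is traversed once in the positive direction (consecutive points may coincide), with the following properties. Let $z_{2n+1}=z_1$, let $\gamma_k$ be the closed arc of $\operatorname{Fr}D$ going in the positive direction from $z_k$ to $z_{k+1}$ (with $\gamma_k=\{z_k\}$ if $z_k=z_{k+1}$), and $\mathring\gamma_k=\gamma_k\setminus\{z_k,z_{k+1}\}$. Then: (1) every point of $\operatorname{Int}D=D\setminus\operatorname{Fr}D$ is a regular point of $f$; (2) for $k=1,\dots,n$, $\mathring\gamma_{2k-1}\ne\emptyset$ and every point of $\mathring\gamma_{2k-1}$ is a regular boundary point of $f$ (in particular $f|_{\gamma_{2k-1}}$ is strictly monotone); (3) for $k=1,\dots,n$, $\gamma_{2k}$ is a connected component of a level set of $f$. One always has $n=2$. Regular functions. A $U$-trajectory is a simple continuous curve $\gamma:[0,1]\to D$ such that $f\circ\gamma$ is strictly monotone on $[0,1]$; it passes through a point if the point lies in $\gamma([0,1])$. A weakly regular function $f$ on $D$ (with $n=2$ and arcs $\gamma_1,\dots,\gamma_4$) is regular on $D$ if there is a dense subset $\Gamma$ of $\mathring\gamma_2\cup\mathring\gamma_4$ such that through every point of $\Gamma$ passes a $U$-trajectory. *)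

theory Defs
  imports "HOL-Analysis.Analysis"
begin

text \<open>
  The plane is \<^typ>\<open>complex\<close>. A function on a closed set \<open>D\<close> (or on \<open>closure W\<close>) is a total
  function \<^typ>\<open>complex \<Rightarrow> real\<close> of which only the values on that set are used.
\<close>

definition regular_point :: "complex set \<Rightarrow> (complex \<Rightarrow> real) \<Rightarrow> complex \<Rightarrow> bool" where
  "regular_point W f z0 \<longleftrightarrow>
     z0 \<in> W \<and>
     (\<exists>U r \<phi> \<phi>'. open U \<and> z0 \<in> U \<and> U \<subseteq> W \<and> r > 0 \<and>
        homeomorphism U (ball 0 r :: complex set) \<phi> \<phi>' \<and> \<phi> z0 = 0 \<and>
        (\<forall>z\<in>ball 0 r. f (\<phi>' z) = Re z + f z0))"

definition upper_half_disk :: "complex set" where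
  "upper_half_disk = {z. norm z < 1 \<and> 0 \<le> Im z}"

definition regular_boundary_point ::
    "complex set \<Rightarrow> (complex \<Rightarrow> real) \<Rightarrow> complex \<Rightarrow> bool" where
  "regular_boundary_point W f z0 \<longleftrightarrow>
     z0 \<in> frontier W \<and>
     (\<exists>U \<psi> \<psi>'. openin (top_of_set (closure W)) U \<and> z0 \<in> U \<and>
        homeomorphism U upper_half_disk \<psi> \<psi>' \<and> \<psi> z0 = 0 \<and>
        \<psi> ` {z \<in> U. f z = f z0} = {z. Re z = 0 \<and> Im z \<in> {0..<1}} \<and>
        \<psi> ` (U \<inter> frontier W) = {z. Re z \<in> {-1<..<1} \<and> Im z = 0} \<and>
        (strict_mono_on {-1<..<1} (\<lambda>t. f (\<psi>' (complex_of_real t))) \<or>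
         strict_antimono_on {-1<..<1} (\<lambda>t. f (\<psi>' (complex_of_real t)))))"

text \<open>
  An orientation of the circle \<^term>\<open>frontier D\<close> is given by a homeomorphism \<open>\<omega>\<close> from the unit
  circle; the positive direction is that of \<open>\<omega> (cis t)\<close> for increasing \<open>t\<close>.
\<close>

definition boundary_orientation :: "(complex \<Rightarrow> complex) \<Rightarrow> complex set \<Rightarrow> bool" where
  "boundary_orientation \<omega> D \<longleftrightarrow> (\<exists>\<omega>'. homeomorphism (sphere 0 1) (frontier D) \<omega> \<omega>')"

text \<open>
  The bound \<open>t < s + 2 * pi\<close> makes the arc from \<open>a\<close> to \<open>a\<close> the single point \<open>a\<close>.
\<close>

definition positive_arc ::
    "(complex \<Rightarrow> complex) \<Rightarrow> complex \<Rightarrow> complex \<Rightarrow> complex set" where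
  "positive_arc \<omega> a b =
     {\<omega> (cis u) | u s t. \<omega> (cis s) = a \<and> \<omega> (cis t) = b \<and> s \<le> u \<and> u \<le> t \<and> t < s + 2 * pi}"

definition open_positive_arc ::
    "(complex \<Rightarrow> complex) \<Rightarrow> complex \<Rightarrow> complex \<Rightarrow> complex set" where
  "open_positive_arc \<omega> a b = positive_arc \<omega> a b - {a, b}"

text \<open>
  The points \<open>z 1, \<dots>, z m\<close> are met in this order during a single turn. The last bound is not
  strict because \<open>z m\<close> may coincide with \<open>z 1\<close> at the end of the turn.
\<close>

definition positively_ordered ::
    "(complex \<Rightarrow> complex) \<Rightarrow> nat \<Rightarrow> (nat \<Rightarrow> complex) \<Rightarrow> bool" where
  "positively_ordered \<omega> m z \<longleftrightarrow>
     (\<exists>\<theta> :: nat \<Rightarrow> real. (\<forall>k\<in>{1..m}. z k = \<omega> (cis (\<theta> k))) \<and>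
        (\<forall>k\<in>{1..<m}. \<theta> k \<le> \<theta> (k + 1)) \<and> \<theta> m \<le> \<theta> 1 + 2 * pi)"

text \<open>
  \<open>f\<close> satisfies the conditions of weak regularity with the points \<open>z 1, \<dots>, z (2 * n)\<close>; the
  value \<open>z (2 * n + 1)\<close> is the conventional repetition of \<open>z 1\<close>. Strict monotonicity of \<open>f\<close> on
  the odd arcs is a consequence and is not required separately.
\<close>

definition weakly_regular_with ::
    "(complex \<Rightarrow> complex) \<Rightarrow> complex set \<Rightarrow> (complex \<Rightarrow> real) \<Rightarrow> nat \<Rightarrow> (nat \<Rightarrow> complex) \<Rightarrow> bool"
  where
  "weakly_regular_with \<omega> D f n z \<longleftrightarrow>
     continuous_on D f \<and> n \<ge> 2 \<and>
     positively_ordered \<omega> (2 * n) z \<and> z (2 * n + 1) = z 1 \<and>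
     (\<forall>w\<in>interior D. regular_point (interior D) f w) \<and>
     (\<forall>k\<in>{1..n}.
        open_positive_arc \<omega> (z (2 * k - 1)) (z (2 * k)) \<noteq> {} \<and>
        (\<forall>w\<in>open_positive_arc \<omega> (z (2 * k - 1)) (z (2 * k)).
           regular_boundary_point (interior D) f w)) \<and>
     (\<forall>k\<in>{1..n}. \<exists>c. positive_arc \<omega> (z (2 * k)) (z (2 * k + 1)) \<in> components {w \<in> D. f w = c})"

definition weakly_regular_on ::
    "(complex \<Rightarrow> complex) \<Rightarrow> complex set \<Rightarrow> (complex \<Rightarrow> real) \<Rightarrow> bool" where
  "weakly_regular_on \<omega> D f \<longleftrightarrow> (\<exists>n z. weakly_regular_with \<omega> D f n z)"

definition U_trajectory ::
    "complex set \<Rightarrow> (complex \<Rightarrow> real) \<Rightarrow> (real \<Rightarrow> complex) \<Rightarrow> bool" where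
  "U_trajectory D f \<gamma> \<longleftrightarrow>
     arc \<gamma> \<and> path_image \<gamma> \<subseteq> D \<and>
     (strict_mono_on {0..1} (f \<circ> \<gamma>) \<or> strict_antimono_on {0..1} (f \<circ> \<gamma>))"

text \<open>
  Weak regularity is possible only with \<open>n = 2\<close>, so here the points are \<open>z 1, \<dots>, z 4\<close> and
  \<open>z 5 = z 1\<close>.
\<close>

definition regular_on ::
    "(complex \<Rightarrow> complex) \<Rightarrow> complex set \<Rightarrow> (complex \<Rightarrow> real) \<Rightarrow> bool" where
  "regular_on \<omega> D f \<longleftrightarrow>
     (\<exists>z. weakly_regular_with \<omega> D f 2 z \<and>
        (let A = open_positive_arc \<omega> (z 2) (z 3) \<union> open_positive_arc \<omega> (z 4) (z 5)
         in \<exists>\<Gamma>. \<Gamma> \<subseteq> A \<and> A \<subseteq> closure \<Gamma> \<and>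
              (\<forall>w\<in>\<Gamma>. \<exists>\<gamma>. U_trajectory D f \<gamma> \<and> w \<in> path_image \<gamma>)))"

lemma regular_on_imp_weakly_regular_on: "regular_on \<omega> D f \<Longrightarrow> weakly_regular_on \<omega> D f"
  unfolding regular_on_def weakly_regular_on_def by blast

end

theory Submission
  imports Defs
begin

text \<open>
  On the interior of \<open>D\<close> the function \<open>f\<close> lies strictly between its two values \<open>lo\<close> and \<open>hi\<close> on
  the even arcs, and by unicoherence of the disk every intermediate level set is connected, hence,
  being a compact 1-manifold, an arc which joins the two odd boundary arcs. So the level sets are
  linearly ordered. This order is closed in \<open>D \<times> D\<close>: over an intermediate level because a small
  box around a regular point meets each level set in a connected set, and over the two extreme
  levels because a \<open>U\<close>-trajectory ending on the extreme arc separates the nearby level sets into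
  two sides. A closed fibrewise order is represented by a continuous function \<open>\<mu>\<close> (a weighted sum
  of distances to the initial segments), and \<open>(\<mu>, f)\<close> embeds \<open>D\<close> into a strip. In these
  coordinates \<open>\<phi>\<close> is obtained by interpolating linearly between the two monotone maps that
  \<open>\<phi>0\<close> prescribes on the extreme levels.
\<close>

section \<open>Closedness of the fibrewise order\<close>

text \<open>Charts exist in the interior and along the open odd arcs, but none is given along the
  even arcs, so an extreme fibre has to be compared with its neighbours by other means. A trajectory
  through one of its points is a cut that can be followed into nearby levels, and density supplies
  such a cut between any two distinct points of the fibre. Continuity of the distance to an initial
  segment has two halves: closedness of the order shows that limits of points of nearby segments
  stay in the segment, connectedness of the fibres shows that every point of the segment is such a
  limit. A second obstacle is that an even arc may shrink to a point. There the coordinate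
  normalised to [0,1] need not converge, so \<open>\<phi>\<close> is proved continuous through its
  closed graph: over a one-point fibre only one limit is possible. Finally, the arcs of
  \<open>f\<close> and \<open>g\<close> are numbered independently and \<open>\<phi>0\<close> may
  reverse orientation, so only the unordered pair of fibre ends is preserved; reversing a strip
  absorbs this.\<close>

text \<open>
  The map \<open>pos\<close> only orders each fibre, from \<open>a c\<close> to \<open>b c\<close>; nothing is assumed about its behaviour
  across fibres. The fibres over \<open>lo\<close> and \<open>hi\<close> may be single points.
\<close>

locale strip =
  fixes D :: "complex set" and f :: "complex \<Rightarrow> real" and lo hi :: real
    and a b :: "real \<Rightarrow> complex" and pos :: "complex \<Rightarrow> real"
  assumes compact_D: "compact D"
    and cont_f: "continuous_on D f"
    and lo_hi: "lo < hi"
    and range_f: "x \<in> D \<Longrightarrow> f x \<in> {lo..hi}"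
    and cont_a: "continuous_on {lo..hi} a"
    and cont_b: "continuous_on {lo..hi} b"
    and a_fibre: "c \<in> {lo..hi} \<Longrightarrow> a c \<in> D \<and> f (a c) = c"
    and b_fibre: "c \<in> {lo..hi} \<Longrightarrow> b c \<in> D \<and> f (b c) = c"
    and a_neq_b: "c \<in> {lo<..<hi} \<Longrightarrow> a c \<noteq> b c"
    and connected_fibre: "c \<in> {lo..hi} \<Longrightarrow> connected {x \<in> D. f x = c}"
    and cont_pos: "c \<in> {lo..hi} \<Longrightarrow> continuous_on {x \<in> D. f x = c} pos"
    and inj_pos: "c \<in> {lo..hi} \<Longrightarrow> inj_on pos {x \<in> D. f x = c}"
    and pos_bounds: "x \<in> D \<Longrightarrow> pos (a (f x)) \<le> pos x \<and> pos x \<le> pos (b (f x))"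
    and box: "\<lbrakk>x \<in> D; f x \<in> {lo<..<hi}; x \<noteq> a (f x); x \<noteq> b (f x); open N; x \<in> N\<rbrakk>
       \<Longrightarrow> \<exists>U. open U \<and> x \<in> U \<and> U \<subseteq> N \<and> (\<forall>c. connected (U \<inter> {x \<in> D. f x = c}))"
    and end_trajectories: "\<lbrakk>x \<in> D; y \<in> D; f x \<in> {lo, hi}; f y = f x; pos x < pos y\<rbrakk>
       \<Longrightarrow> \<exists>c' \<tau>. c' \<in> {lo<..<hi} \<and> continuous_on (closed_segment (f x) c') \<tau> \<and>
             (\<forall>c\<in>closed_segment (f x) c'. \<tau> c \<in> D \<and> f (\<tau> c) = c) \<and>
             pos x < pos (\<tau> (f x)) \<and> pos (\<tau> (f x)) < pos y"
    and end_locally_connected: "\<lbrakk>x \<in> D; f x \<in> {lo, hi}; open N; x \<in> N\<rbrakk>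
       \<Longrightarrow> \<exists>V. open V \<and> x \<in> V \<and> V \<subseteq> N \<and> connected {y \<in> D \<inter> V. f y \<noteq> f x}"
begin

abbreviation fib :: "real \<Rightarrow> complex set" where "fib c \<equiv> {x \<in> D. f x = c}"

lemma closed_D: "closed D"
  using compact_D by (rule compact_imp_closed)

lemma compact_fibre: "compact (fib c)"
  using continuous_closed_preimage_constant[OF cont_f closed_D, of c] compact_D
  by (metis (mono_tags, lifting) compact_Int_closed inf.absorb_iff2 mem_Collect_eq subsetI)

text \<open>On a compact fibre \<open>pos\<close> is an embedding onto an interval; intersecting
  that interval with \<open>J\<close> and pulling back by the continuous inverse keeps
  connectedness.\<close>

lemma connected_fibre_part:
  assumes c: "c \<in> {lo..hi}" and J: "connected J"
  shows "connected {y \<in> fib c. pos y \<in> J}"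
proof -
  obtain g where g: "homeomorphism (fib c) (pos ` fib c) pos g"
    using homeomorphism_compact[OF compact_fibre cont_pos[OF c] refl inj_pos[OF c]] by blast
  have "connected (pos ` fib c)"
    using connected_continuous_image[OF cont_pos[OF c] connected_fibre[OF c]] .
  then have "connected (pos ` fib c \<inter> J)"
    using J by (simp add: is_interval_connected_1[symmetric] is_interval_Int)
  then have "connected (g ` (pos ` fib c \<inter> J))"
    using g by (meson connected_continuous_image continuous_on_subset homeomorphism_def inf_le1)
  moreover have "g ` (pos ` fib c \<inter> J) = {y \<in> fib c. pos y \<in> J}"
  proof -
    have "y \<in> g ` (pos ` fib c \<inter> J)" if "y \<in> fib c" "pos y \<in> J" for y
      using that homeomorphism_apply1[OF g] by (intro image_eqI[of _ _ "pos y"]) auto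
    then show ?thesis using homeomorphism_apply1[OF g] by auto
  qed
  ultimately show ?thesis by simp
qed

lemma pos_intermediate:
  assumes C: "connected C" "C \<subseteq> fib c" "c \<in> {lo..hi}" and "x \<in> C" "y \<in> C" "pos x \<le> s" "s \<le> pos y"
  shows "\<exists>z\<in>C. pos z = s"
proof -
  have "connected (pos ` C)"
    using C(1) continuous_on_subset[OF cont_pos[OF C(3)] C(2)] by (rule connected_continuous_image[rotated])
  then have "s \<in> pos ` C"
    using assms(4-) connectedD_interval by blast
  then show ?thesis by blast
qed

lemma pos_eq: "\<lbrakk>x \<in> D; y \<in> D; f x = f y; pos x = pos y\<rbrakk> \<Longrightarrow> x = y"
  using inj_pos[of "f x"] range_f[of x] by (auto simp: inj_on_def)

lemma fibre_limit:
  assumes "\<And>n. X n \<in> D" "X \<longlonglongrightarrow> x"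
  shows "x \<in> D" "(\<lambda>n. f (X n)) \<longlonglongrightarrow> f x"
proof -
  show *: "x \<in> D" using closed_D assms closed_sequentially by blast
  show "(\<lambda>n. f (X n)) \<longlonglongrightarrow> f x"
    using cont_f * assms by (simp add: continuous_on_tendsto_compose)
qed

text \<open>A connected piece of a nearby fibre that runs from near \<open>x\<close> to near
  \<open>y\<close> cannot jump over \<open>q\<close>. Without a small ball around \<open>q\<close>
  the limit fibre falls into two disjoint closed parts, which have disjoint open neighbourhoods; by
  compactness nearby fibres stay in these neighbourhoods and the ball, so a connected set meeting
  both neighbourhoods must enter the ball.\<close>

lemma fibre_connected_limit:
  assumes K: "\<And>n. connected (K n)" "\<And>n. K n \<subseteq> fib (c' n)"
    and X: "\<And>n. X n \<in> K n" "X \<longlonglongrightarrow> x" and Y: "\<And>n. Y n \<in> K n" "Y \<longlonglongrightarrow> y"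
    and q: "q \<in> D" "f q = f x" "pos x < pos q" "pos q < pos y" and e: "0 < e"
  shows "\<forall>\<^sub>F n in sequentially. K n \<inter> ball q e \<noteq> {}"
proof -
  have XD: "X n \<in> D" "Y n \<in> D" and fX: "f (X n) = c' n" "f (Y n) = c' n" for n
    using K(2) X(1) Y(1) by blast+
  have x: "x \<in> D" "c' \<longlonglongrightarrow> f x" and y: "y \<in> D" "c' \<longlonglongrightarrow> f y"
    using fibre_limit[OF _ X(2)] fibre_limit[OF _ Y(2)] XD fX by auto
  then have fy: "f y = f x" using LIMSEQ_unique by blast
  define c where "c = f x"
  have c: "c \<in> {lo..hi}" unfolding c_def using range_f x(1) by blast
  \<comment> \<open>The radius is cut down so that \<open>x\<close> and \<open>y\<close> stay
    outside the ball and therefore belong to the two parts \<open>P\<close> and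
    \<open>Q\<close>.\<close>
  define d where "d = min e (min (dist q x) (dist q y))"
  have d: "d > 0" "d \<le> e" "x \<notin> ball q d" "y \<notin> ball q d"
    using e q(3,4) unfolding d_def by auto
  define P where "P = {z \<in> fib c. pos z \<in> {..pos q}} - ball q d"
  define Q where "Q = {z \<in> fib c. pos z \<in> {pos q..}} - ball q d"
  have clo: "closed {z \<in> fib c. pos z \<in> J}" if "closed J" for J
    using continuous_closed_preimage[OF cont_pos[OF c] compact_imp_closed[OF compact_fibre] that]
    by (simp add: vimage_def Int_def conj_assoc)
  have cl: "closed P" "closed Q"
    unfolding P_def Q_def by (intro closed_Diff clo open_ball; simp)+
  have cP: "compact P"
    by (metis (no_types, lifting) DiffD1 P_def cl(1) compact_D compact_Int_closed inf.absorb_iff2 mem_Collect_eq subsetI)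
  have PQ: "P \<inter> Q = {}"
  proof (rule ccontr)
    assume "P \<inter> Q \<noteq> {}"
    then obtain z where "z \<in> P" "z \<in> Q" by blast
    then have z: "z \<in> D" "f z = c" "pos z = pos q" "z \<notin> ball q d" by (auto simp: P_def Q_def)
    then have "z = q" using q by (intro pos_eq) (auto simp: c_def)
    then show False using z d(1) by simp
  qed
  obtain G H where GH: "open G" "open H" "P \<subseteq> G" "Q \<subseteq> H" "G \<inter> H = {}"
    using separation_normal_compact[OF cP cl(2) PQ] by metis
  \<comment> \<open>\<open>f\<close> maps the compact set \<open>Z\<close> to a compact set that
    misses \<open>c\<close>, so it also misses every level close to \<open>c\<close>.\<close>
  define Z where "Z = D - (G \<union> H \<union> ball q d)"
  have "compact Z" unfolding Z_def using GH compact_D by (simp add: compact_diff open_Un)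
  then have "closed (f ` Z)"
    by (metis (no_types, lifting) DiffD1 Z_def compact_continuous_image compact_imp_closed cont_f continuous_on_subset subsetI)
  moreover have "c \<notin> f ` Z"
  proof
    assume "c \<in> f ` Z"
    then obtain z where "z \<in> Z" "f z = c" by blast
    then have "z \<in> D" "f z = c" "z \<notin> G" "z \<notin> H" "z \<notin> ball q d" by (auto simp: Z_def)
    then show False using GH(3,4) unfolding P_def Q_def by (cases "pos z \<le> pos q") auto
  qed
  ultimately have evc: "\<forall>\<^sub>F n in sequentially. c' n \<in> - f ` Z"
    using x(2) unfolding c_def by (intro topological_tendstoD) auto
  have "x \<in> P" "y \<in> Q" using d x y q fy by (auto simp: P_def Q_def c_def)
  then have "\<forall>\<^sub>F n in sequentially. X n \<in> G" "\<forall>\<^sub>F n in sequentially. Y n \<in> H"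
    using GH X(2) Y(2) by (auto intro!: topological_tendstoD)
  with evc show ?thesis
  proof eventually_elim
    case (elim n)
    show ?case
    proof
      assume "K n \<inter> ball q e = {}"
      then have "K n \<inter> ball q d = {}" using d(2) by auto
      have "K n \<subseteq> G \<union> H"
      proof
        fix u assume u: "u \<in> K n"
        then have "u \<in> D" "f u = c' n" "u \<notin> ball q d"
          using K(2)[of n] \<open>K n \<inter> ball q d = {}\<close> by auto
        moreover have "u \<notin> Z"
        proof
          assume "u \<in> Z"
          then have "f u \<in> f ` Z" by (rule imageI)
          then show False using elim(1) \<open>f u = c' n\<close> by simp
        qed
        ultimately show "u \<in> G \<union> H" unfolding Z_def by blast
      qed
      then show False
        using connectedD[OF K(1)[of n] GH(1,2) _ \<open>K n \<subseteq> G \<union> H\<close>] GH(5) elim(2,3) X(1)[of n] Y(1)[of n]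
        by auto
    qed
  qed
qed

text \<open>
  If \<open>x\<close> came strictly before \<open>y\<close> in the limit, then for a point \<open>q\<close> between them both the part
  of the fibre before \<open>X n\<close> and the part after \<open>X n\<close> would come close to \<open>q\<close>, although the fibre
  is connected inside a box around \<open>q\<close> that does not contain \<open>X n\<close>.
\<close>

lemma order_closed_interior:
  assumes X: "\<And>n. X n \<in> D" "X \<longlonglongrightarrow> x" and Y: "\<And>n. Y n \<in> D" "Y \<longlonglongrightarrow> y"
    and XY: "\<And>n. f (Y n) = f (X n)" "\<And>n. pos (Y n) \<le> pos (X n)"
    and c: "f x \<in> {lo<..<hi}"
  shows "pos y \<le> pos x"
proof (rule ccontr)
  assume "\<not> pos y \<le> pos x"
  then have less: "pos x < pos y" by simp
  have x: "x \<in> D" "(\<lambda>n. f (X n)) \<longlonglongrightarrow> f x" and y: "y \<in> D" "(\<lambda>n. f (X n)) \<longlonglongrightarrow> f y"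
    using fibre_limit[OF _ X(2)] fibre_limit[OF _ Y(2)] X Y XY by auto
  then have fy: "f y = f x" using LIMSEQ_unique by blast
  have cc: "f x \<in> {lo..hi}" using c by auto
  obtain q where q: "q \<in> fib (f x)" "pos q = (pos x + pos y) / 2"
    using pos_intermediate[OF connected_fibre[OF cc] subset_refl cc, of x y "(pos x + pos y) / 2"]
      x y fy less by auto
  then have ql: "pos x < pos q" "pos q < pos y" using less by auto
  \<comment> \<open>Being strictly between two points of its fibre, \<open>q\<close> is neither end,
    as \<open>box\<close> requires.\<close>
  have qab: "q \<noteq> a (f q)" "q \<noteq> b (f q)"
    using pos_bounds[OF x(1)] pos_bounds[OF y(1)] q ql fy by auto
  have "q \<noteq> x" using ql by auto
  \<comment> \<open>Half the distance to \<open>x\<close> leaves room for \<open>X n\<close> to lie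
    outside \<open>N\<close> eventually.\<close>
  define N where "N = ball q (dist q x / 2)"
  have N: "open N" "q \<in> N" using \<open>q \<noteq> x\<close> by (auto simp: N_def)
  obtain U where U: "open U" "q \<in> U" "U \<subseteq> N" "\<And>c. connected (U \<inter> fib c)"
    using box[of q N] q c qab N by auto
  obtain e where e: "e > 0" "ball q e \<subseteq> U" using U openE by blast
  have r: "f (X n) \<in> {lo..hi}" for n using range_f X by blast
  \<comment> \<open>\<open>K n\<close> joins \<open>Y n\<close> to \<open>X n\<close> and
    \<open>K' n\<close> joins \<open>X n\<close> to the end \<open>b (f (X n))\<close>. In both
    cases \<open>q\<close> lies strictly between the limits of the two endpoints, so both sets
    approach \<open>q\<close>.\<close>
  define K where "K n = {z \<in> fib (f (X n)). pos z \<in> {pos (Y n)..pos (X n)}}" for n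
  define K' where "K' n = {z \<in> fib (f (X n)). pos z \<in> {pos (X n)..}}" for n
  have con: "connected (K n)" "connected (K' n)" for n
    unfolding K_def K'_def by (intro connected_fibre_part[OF r]; simp)+
  have bn: "(\<lambda>n. b (f (X n))) \<longlonglongrightarrow> b (f x)"
    using continuous_on_tendsto_compose[OF cont_b x(2)] r cc by auto
  have fK: "K n \<subseteq> fib (f (X n))" "K' n \<subseteq> fib (f (X n))" for n by (auto simp: K_def K'_def)
  have XK: "X n \<in> K n" "Y n \<in> K n" "X n \<in> K' n" "b (f (X n)) \<in> K' n" for n
    using X Y XY b_fibre[OF r] pos_bounds[of "X n"] by (auto simp: K_def K'_def)
  have e1: "\<forall>\<^sub>F n in sequentially. K n \<inter> ball q e \<noteq> {}"
    using fibre_connected_limit[of K "\<lambda>n. f (X n)" X x Y y q e, OF con(1) fK(1) XK(1) X(2) XK(2) Y(2)]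
      q ql e by auto
  have "pos y \<le> pos (b (f x))" using pos_bounds[OF y(1)] fy by auto
  then have e2: "\<forall>\<^sub>F n in sequentially. K' n \<inter> ball q e \<noteq> {}"
    using fibre_connected_limit[of K' "\<lambda>n. f (X n)" X x "\<lambda>n. b (f (X n))" "b (f x)" q e,
        OF con(2) fK(2) XK(3) X(2) XK(4) bn] q ql e by auto
  have "x \<in> - cball q (dist q x / 2)" using \<open>q \<noteq> x\<close> by auto
  then have e3: "\<forall>\<^sub>F n in sequentially. X n \<in> - cball q (dist q x / 2)"
    using X(2) by (intro topological_tendstoD) auto
  have "\<forall>\<^sub>F n in sequentially. False"
    using e1 e2 e3
  proof eventually_elim
    case (elim n)
    then obtain u v where uv: "u \<in> K n" "v \<in> K' n" "u \<in> U" "v \<in> U" using e by blast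
    \<comment> \<open>The connected trace of the fibre on \<open>U\<close> contains points on both
      sides of \<open>X n\<close>, so it contains a point with the position of \<open>X n\<close>,
      which is \<open>X n\<close> itself.\<close>
    obtain z where "z \<in> U \<inter> fib (f (X n))" "pos z = pos (X n)"
      using pos_intermediate[OF U(4)[of "f (X n)"] _ r, where x=u and y=v and s="pos (X n)"] uv 
      by (auto simp: K_def K'_def)
    then have "X n \<in> U" using pos_eq[of z "X n"] X by auto
    then show False using elim(3) U(3) by (auto simp: N_def)
  qed
  then show False by simp
qed

abbreviation down :: "complex \<Rightarrow> complex set" where
  "down x \<equiv> {y \<in> D. f y = f x \<and> pos y \<le> pos x}"

lemma tendsto_a: "\<lbrakk>c' \<longlonglongrightarrow> c; c \<in> {lo..hi}; \<And>n. c' n \<in> {lo..hi}\<rbrakk> \<Longrightarrow> (\<lambda>n. a (c' n)) \<longlonglongrightarrow> a c"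
  using continuous_on_tendsto_compose[OF cont_a, of c' c sequentially] by auto

lemma tendsto_b: "\<lbrakk>c' \<longlonglongrightarrow> c; c \<in> {lo..hi}; \<And>n. c' n \<in> {lo..hi}\<rbrakk> \<Longrightarrow> (\<lambda>n. b (c' n)) \<longlonglongrightarrow> b c"
  using continuous_on_tendsto_compose[OF cont_b, of c' c sequentially] by auto

text \<open>The lower half of the continuity of \<open>down\<close>: none of its points is lost
  under small perturbation. The two ends of the segment are followed by \<open>X n\<close> and by
  \<open>a (f (X n))\<close>; a point strictly between them is approached because the segments
  \<open>down (X n)\<close> are connected.\<close>

lemma down_lower_limit:
  assumes X: "\<And>n. X n \<in> D" "X \<longlonglongrightarrow> x" and y: "y \<in> down x" and e: "e > 0"
  shows "\<forall>\<^sub>F n in sequentially. down (X n) \<inter> ball y e \<noteq> {}"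
proof -
  have x: "x \<in> D" "(\<lambda>n. f (X n)) \<longlonglongrightarrow> f x"
    using fibre_limit[OF X] by auto
  have r: "f (X n) \<in> {lo..hi}" for n using range_f X by blast
  have rx: "f x \<in> {lo..hi}" using range_f x by blast
  have an: "(\<lambda>n. a (f (X n))) \<longlonglongrightarrow> a (f x)"
    by (rule tendsto_a[OF x(2) rx r])
  have ad: "a (f (X n)) \<in> down (X n)" for n
    using a_fibre[OF r] pos_bounds[OF X(1)] by auto
  have ay: "pos (a (f x)) \<le> pos y" using pos_bounds[of y] y by auto
  consider "y = x" | "y = a (f x)" | "pos (a (f x)) < pos y" "pos y < pos x"
  proof (cases "y = x \<or> y = a (f x)")
    case True
    then show ?thesis using that by blast
  next
    case False
    then have "pos y \<noteq> pos x" "pos y \<noteq> pos (a (f x))"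
      using pos_eq[of y x] pos_eq[of y "a (f x)"] y x a_fibre[OF rx] by auto
    then show ?thesis using that(3) ay y by simp
  qed
  then show ?thesis
  proof cases
    case 1
    have "\<forall>\<^sub>F n in sequentially. X n \<in> ball y e"
      using X e 1 by (intro topological_tendstoD) auto
    then show ?thesis by eventually_elim (use X(1) in blast)
  next
    case 2
    have "\<forall>\<^sub>F n in sequentially. a (f (X n)) \<in> ball y e"
      using an e 2 by (intro topological_tendstoD) auto
    then show ?thesis by eventually_elim (use ad in blast)
  next
    case 3
    have "connected (down (X n))" for n
      using connected_fibre_part[OF r[of n], of "{..pos (X n)}"] by (simp add: conj_assoc)
    moreover have "down (X n) \<subseteq> fib (f (X n))" for n by blast
    moreover have "X n \<in> down (X n)" for n using X by auto
    ultimately show ?thesis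
      using y a_fibre[OF rx]
      by (intro fibre_connected_limit[of "\<lambda>n. down (X n)" "\<lambda>n. f (X n)" "\<lambda>n. a (f (X n))" "a (f x)" X x y e,
            OF _ _ ad an _ X(2) _ _ 3 e]) auto
  qed
qed

text \<open>A whole fibre is the initial segment that ends at its point \<open>b\<close>, so this is
  an instance of \<open>down_lower_limit\<close>.\<close>

lemma fibre_lower_limit:
  assumes c: "\<And>n. c' n \<in> {lo..hi}" "c' \<longlonglongrightarrow> f z" and z: "z \<in> D" and e: "e > 0"
  shows "\<forall>\<^sub>F n in sequentially. fib (c' n) \<inter> ball z e \<noteq> {}"
proof -
  have bn: "(\<lambda>n. b (c' n)) \<longlonglongrightarrow> b (f z)"
    by (rule tendsto_b[OF c(2) range_f[OF z] c(1)])
  have "\<forall>\<^sub>F n in sequentially. down (b (c' n)) \<inter> ball z e \<noteq> {}"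
  proof (rule down_lower_limit[OF _ bn _ e])
    show "b (c' n) \<in> D" for n using b_fibre[OF c(1)[of n]] by blast
    have "f (b (f z)) = f z" using b_fibre[OF range_f[OF z]] by blast
    then show "z \<in> down (b (f z))" using z pos_bounds[OF z] by simp
  qed
  then show ?thesis
  proof eventually_elim
    case (elim n)
    then obtain y where "y \<in> D" "f y = f (b (c' n))" "y \<in> ball z e" by blast
    moreover have "f (b (c' n)) = c' n" using b_fibre[OF c(1)] by blast
    ultimately show ?case by auto
  qed
qed

text \<open>Serves twice: statements about one side of a trajectory yield the other side, and a
  boundary map that exchanges the fibre ends is reduced to one that keeps them.\<close>

lemma strip_reverse: "strip D f lo hi b a (\<lambda>x. - pos x)"
proof
  fix c assume c: "c \<in> {lo..hi}"
  show "continuous_on (fib c) (\<lambda>x. - pos x)"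
    using cont_pos[OF c] by (rule continuous_on_minus)
  show "inj_on (\<lambda>x. - pos x) (fib c)"
    using inj_pos[OF c] by (simp add: inj_on_def)
  show "b c \<in> D \<and> f (b c) = c" "a c \<in> D \<and> f (a c) = c" "connected (fib c)"
    by (fact b_fibre[OF c] a_fibre[OF c] connected_fibre[OF c])+
next
  fix x y assume x: "x \<in> D" "y \<in> D" "f x \<in> {lo, hi}" "f y = f x" "- pos x < - pos y"
  obtain c' \<tau> where "c' \<in> {lo<..<hi}" "continuous_on (closed_segment (f y) c') \<tau>"
    "\<forall>c\<in>closed_segment (f y) c'. \<tau> c \<in> D \<and> f (\<tau> c) = c"
    "pos y < pos (\<tau> (f y))" "pos (\<tau> (f y)) < pos x"
    using end_trajectories[OF x(2,1)] x(3-5) unfolding x(4) neg_less_iff_less by blast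
  then show "\<exists>c' \<tau>. c' \<in> {lo<..<hi} \<and> continuous_on (closed_segment (f x) c') \<tau> \<and>
             (\<forall>c\<in>closed_segment (f x) c'. \<tau> c \<in> D \<and> f (\<tau> c) = c) \<and>
             - pos x < - pos (\<tau> (f x)) \<and> - pos (\<tau> (f x)) < - pos y"
    unfolding x(4) neg_less_iff_less by blast
next
  show "b c \<noteq> a c" if "c \<in> {lo<..<hi}" for c
    using a_neq_b[OF that] by simp
next
  show "- pos (b (f x)) \<le> - pos x \<and> - pos x \<le> - pos (a (f x))" if "x \<in> D" for x
    using pos_bounds[OF that] by simp
next
  show "\<exists>U. open U \<and> x \<in> U \<and> U \<subseteq> N \<and> (\<forall>c. connected (U \<inter> fib c))"
    if "x \<in> D" "f x \<in> {lo<..<hi}" "x \<noteq> b (f x)" "x \<noteq> a (f x)" "open N" "x \<in> N" for x N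
    using box[OF that(1,2,4,3,5,6)] .
next
  show "\<exists>V. open V \<and> x \<in> V \<and> V \<subseteq> N \<and> connected {y \<in> D \<inter> V. f y \<noteq> f x}"
    if "x \<in> D" "f x \<in> {lo, hi}" "open N" "x \<in> N" for x N
    using end_locally_connected[OF that] .
next
  show "f x \<in> {lo..hi}" if "x \<in> D" for x using range_f[OF that] .
qed (fact compact_D cont_f lo_hi cont_a cont_b)+

text \<open>
  Near a point of the extreme fibre the complement of that fibre is connected, so points to the left
  and to the right of the trajectory cannot both accumulate there; connectedness of the part of
  the extreme fibre beyond \<open>\<tau> e\<close> then propagates the side from its endpoint \<open>b e\<close>.
\<close>

lemma trajectory_side:
  assumes e: "e \<in> {lo, hi}" and c': "c' \<in> {lo<..<hi}"
    and cont: "continuous_on (closed_segment e c') \<tau>"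
    and \<tau>: "\<And>c. c \<in> closed_segment e c' \<Longrightarrow> \<tau> c \<in> D \<and> f (\<tau> c) = c"
    and z: "z \<in> D" "f z = e" "pos (\<tau> e) < pos z"
  shows "z \<notin> closure {y \<in> D. f y \<in> open_segment e c' \<and> pos y < pos (\<tau> (f y))}" (is "_ \<notin> closure ?L")
proof
  assume zL: "z \<in> closure ?L"
  define R where "R = {y \<in> D. f y \<in> open_segment e c' \<and> pos (\<tau> (f y)) < pos y}"
  define T where "T = {y \<in> fib e. pos y \<in> {pos (\<tau> e)<..}}"
  have ee: "e \<in> {lo..hi}" using e lo_hi by auto
  have os: "c \<in> {lo<..<hi}" if "c \<in> open_segment e c'" for c
    using that e c' lo_hi by (auto simp: open_segment_eq_real_ivl split: if_splits)
  have nos: "e \<notin> open_segment e c'" by (simp add: open_segment_def)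
  have cs: "c \<in> closed_segment e c'" if "c \<in> open_segment e c'" for c
    using that open_segment_def by auto
  \<comment> \<open>Over an interior level the order is already known to be closed. Comparing with
    the trajectory from either side shows that only its own points can be limits of both
    sides.\<close>
  have both: "x = \<tau> (f x)" if x: "x \<in> D" "f x \<in> open_segment e c'" "x \<in> closure ?L" "x \<in> closure R" for x
  proof -
    obtain X where X: "\<And>n. X n \<in> ?L" "X \<longlonglongrightarrow> x" using x(3) by (meson closure_sequential)
    obtain Y where Y: "\<And>n. Y n \<in> R" "Y \<longlonglongrightarrow> x" using x(4) by (meson closure_sequential)
    have *: "(\<lambda>n. \<tau> (f (X n))) \<longlonglongrightarrow> \<tau> (f x)" if "\<And>n. X n \<in> D \<and> f (X n) \<in> open_segment e c'" "X \<longlonglongrightarrow> x" for X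
      using fibre_limit[OF _ that(2)] that(1) x(2) cs
      by (intro continuous_on_tendsto_compose[OF cont]) auto
    have tx: "\<tau> (f x) \<in> D" "f (\<tau> (f x)) = f x" using \<tau>[OF cs[OF x(2)]] by auto
    have "pos x \<le> pos (\<tau> (f x))"
      by (rule order_closed_interior[of "\<lambda>n. \<tau> (f (X n))" "\<tau> (f x)" X x])
         (use X * \<tau> cs os tx x in \<open>auto simp: less_imp_le\<close>)
    moreover have "pos (\<tau> (f x)) \<le> pos x"
      by (rule order_closed_interior[of Y x "\<lambda>n. \<tau> (f (Y n))" "\<tau> (f x)"])
         (use Y * \<tau> cs os tx x in \<open>auto simp: less_imp_le R_def\<close>)
    ultimately show ?thesis using tx x by (intro pos_eq) auto
  qed
  \<comment> \<open>Levels tending to \<open>e\<close>; the denominator \<open>n + 2\<close> keeps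
    them strictly between \<open>e\<close> and \<open>c'\<close>.\<close>
  define d where "d n = e + (c' - e) / real (n + 2)" for n
  have dos: "d n \<in> open_segment e c'" for n
  proof -
    define u where "u = 1 / real (n + 2)"
    have "d n = (1 - u) *\<^sub>R e + u *\<^sub>R c'" unfolding d_def u_def divide_inverse
      by (simp add: algebra_simps)
    moreover have "0 < u" "u < 1" by (auto simp: u_def)
    moreover have "e \<noteq> c'" using e c' by auto
    ultimately show ?thesis unfolding in_segment by blast
  qed
  have dlim: "d \<longlonglongrightarrow> e" 
    using tendsto_add[OF tendsto_const[of e] LIMSEQ_ignore_initial_segment[OF lim_const_over_n[of "c' - e"], of 2]]
    by (simp add: d_def[abs_def] add.commute)
  have dr: "d n \<in> {lo..hi}" for n using os[OF dos[of n]] by auto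
  have tlim: "(\<lambda>n. \<tau> (d n)) \<longlonglongrightarrow> \<tau> e"
    by (rule continuous_on_tendsto_compose[OF cont dlim]) (use dos cs in auto)
  \<comment> \<open>The fibres over \<open>d n\<close> come close to \<open>y\<close>, while
    \<open>\<tau> (d n)\<close> tends to a different point; hence there are points near
    \<open>y\<close> that lie off the trajectory, on one of its sides.\<close>
  have near: "y \<in> closure ?L \<union> closure R" if y: "y \<in> T" for y
  proof -
    have yD: "y \<in> D" "f y = e" "y \<noteq> \<tau> e" using y by (auto simp: T_def)
    have "\<exists>v\<in>?L \<union> R. dist v y < r" if r: "r > 0" for r
    proof -
      define s where "s = min r (dist y (\<tau> e) / 2)"
      have s: "s > 0" "s \<le> r" "\<tau> e \<in> - cball y s" using r yD(3) by (auto simp: s_def min_def)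
      have e1: "\<forall>\<^sub>F n in sequentially. \<tau> (d n) \<in> - cball y s"
        using tlim s by (intro topological_tendstoD) auto
      have e2: "\<forall>\<^sub>F n in sequentially. fib (d n) \<inter> ball y s \<noteq> {}"
        using fibre_lower_limit[OF dr _ yD(1) s(1)] dlim yD by auto
      obtain n where n: "\<tau> (d n) \<in> - cball y s" "fib (d n) \<inter> ball y s \<noteq> {}"
        using eventually_happens'[OF sequentially_bot eventually_conj[OF e1 e2]] by blast
      then obtain v where v: "v \<in> D" "f v = d n" "dist y v < s" by auto
      then have "v \<noteq> \<tau> (f v)" using n by auto
      then have "pos v \<noteq> pos (\<tau> (f v))"
        using v pos_eq[of v "\<tau> (f v)"] \<tau>[OF cs[OF dos[of n]]] by auto
      then have "v \<in> ?L \<union> R" using v dos[of n] by (auto simp: R_def neq_iff)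
      then show ?thesis using v s by (intro bexI[of _ v]) (auto simp: dist_commute)
    qed
    then have "y \<in> closure (?L \<union> R)" unfolding closure_approachable by blast
    then show ?thesis by simp
  qed
  have bT: "b e \<in> T" using b_fibre[OF ee] pos_bounds[OF z(1)] z by (auto simp: T_def)
  have blim: "(\<lambda>n. b (d n)) \<longlonglongrightarrow> b e" by (rule tendsto_b[OF dlim ee dr])
  \<comment> \<open>The ends \<open>b (d n)\<close> keep a positive distance from
    \<open>\<tau> (d n)\<close> eventually, and no point of a fibre comes after its end, so they lie
    on the right.\<close>
  have bR: "b e \<in> closure R"
  proof -
    have "b e \<noteq> \<tau> e" using bT by (auto simp: T_def)
    then have "\<forall>\<^sub>F n in sequentially. dist (b (d n)) (\<tau> (d n)) > 0"
      using tendsto_dist[OF blim tlim] by (intro order_tendstoD(1)) auto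
    then have "\<forall>\<^sub>F n in sequentially. b (d n) \<in> R"
    proof eventually_elim
      case (elim n)
      have t: "\<tau> (d n) \<in> D" "f (\<tau> (d n)) = d n" using \<tau>[OF cs[OF dos]] by auto
      have "pos (\<tau> (d n)) \<le> pos (b (d n))" using pos_bounds[OF t(1)] t by simp
      moreover have "pos (\<tau> (d n)) \<noteq> pos (b (d n))"
        using elim pos_eq[of "\<tau> (d n)" "b (d n)"] t b_fibre[OF dr[of n]] by auto
      ultimately show ?case using b_fibre[OF dr[of n]] dos by (auto simp: R_def)
    qed
    then have "\<forall>\<^sub>F n in sequentially. b (d n) \<in> closure R"
      by (rule eventually_mono) (use closure_subset in blast)
    then show ?thesis by (rule Lim_in_closed_set[OF closed_closure _ sequentially_bot blim])
  qed
  have disj: "closure ?L \<inter> closure R \<inter> T = {}"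
  proof (rule ccontr)
    assume "\<not> ?thesis"
    then obtain y where y: "y \<in> closure ?L" "y \<in> closure R" "y \<in> D" "f y = e" "pos (\<tau> e) < pos y"
      by (auto simp: T_def)
    have "compact (\<tau> ` closed_segment e c')" using cont by (rule compact_continuous_image) simp
    then have cl: "closed (\<tau> ` closed_segment e c')" by (rule compact_imp_closed)
    have yn: "y \<notin> \<tau> ` closed_segment e c'" using y \<tau> by auto
    \<comment> \<open>Values within \<open>\<bar>c' - e\<bar>\<close> of \<open>e\<close> and
      different from \<open>e\<close> lie in the open segment: \<open>e\<close> is an extreme value,
      so they can only be on the side of \<open>c'\<close>.\<close>
    have "openin (top_of_set D) (D \<inter> f -` ball e \<bar>c' - e\<bar>)"
      using continuous_openin_preimage_gen[OF cont_f] by blast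
    then obtain N where N: "open N" "D \<inter> f -` ball e \<bar>c' - e\<bar> = D \<inter> N"
      by (meson openin_open)
    have "y \<in> N" using N(2) y e c' by auto
    then obtain V where V: "open V" "y \<in> V" "V \<subseteq> N - \<tau> ` closed_segment e c'"
        "connected {x \<in> D \<inter> V. f x \<noteq> f y}"
      using end_locally_connected[of y "N - \<tau> ` closed_segment e c'"] y e N(1) cl yn by auto
    \<comment> \<open>\<open>W\<close> is connected and avoids the trajectory, hence splits into its
      left and right points. If \<open>y\<close> were a limit of both sides, both parts would be
      nonempty and relatively closed.\<close>
    define W where "W = {x \<in> D \<inter> V. f x \<noteq> e}"
    have W: "connected W" using V(4) y(4) by (simp add: W_def)
    have Wos: "f x \<in> open_segment e c'" if "x \<in> W" for x
    proof -
      have x: "x \<in> D" "x \<in> N" "f x \<noteq> e" using that V(3) by (auto simp: W_def)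
      then have "x \<in> D \<inter> f -` ball e \<bar>c' - e\<bar>" using N(2) by blast
      then have "\<bar>f x - e\<bar> < \<bar>c' - e\<bar>" "f x \<in> {lo..hi}" "f x \<noteq> e"
        using range_f[OF x(1)] x(3) by (auto simp: dist_real_def abs_minus_commute)
      then show ?thesis using e c' by (auto simp: open_segment_eq_real_ivl)
    qed
    have Wt: "x \<noteq> \<tau> (f x)" if "x \<in> W" for x
      using that V(3) cs[OF Wos[OF that]] by (auto simp: W_def)
    have "W \<subseteq> ?L \<union> R"
    proof
      fix x assume x: "x \<in> W"
      then have "x \<in> D" by (simp add: W_def)
      then have "pos x \<noteq> pos (\<tau> (f x))" using pos_eq[of x "\<tau> (f x)"] Wt[OF x] \<tau>[OF cs[OF Wos[OF x]]] by auto
      then show "x \<in> ?L \<union> R" using Wos[OF x] \<open>x \<in> D\<close> by (auto simp: R_def neq_iff)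
    qed
    then have "W \<subseteq> closure ?L \<union> closure R" using closure_subset[of ?L] closure_subset[of R] by blast
    moreover have "closure ?L \<inter> closure R \<inter> W = {}" using both Wos Wt by (auto simp: W_def)
    moreover have "closure ?L \<inter> W \<noteq> {}"
    proof -
      have "V \<inter> ?L \<noteq> {}" using V(1,2) y(1) open_Int_closure_eq_empty by blast
      then show ?thesis using nos closure_subset[of ?L] unfolding W_def by blast
    qed
    moreover have "closure R \<inter> W \<noteq> {}"
    proof -
      have "V \<inter> R \<noteq> {}" using V(1,2) y(2) open_Int_closure_eq_empty by blast
      then show ?thesis using nos closure_subset[of R] unfolding W_def R_def by blast
    qed
    ultimately show False
      using connected_closedD[OF W, of "closure ?L" "closure R"] closed_closure by blast
  qed
  have "connected T" unfolding T_def by (rule connected_fibre_part[OF ee]) simp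
  moreover have "z \<in> T" using z by (auto simp: T_def)
  moreover have "T \<subseteq> closure ?L \<union> closure R" using near by blast
  ultimately show False
    using disj zL bT bR connected_closedD[of T "closure ?L" "closure R"] closed_closure by blast
qed

text \<open>On an extreme level, a trajectory is placed strictly between \<open>x\<close> and
  \<open>y\<close>. By \<open>trajectory_side\<close> and its mirror image, \<open>y\<close> is not
  a limit of left points and \<open>x\<close> is not a limit of right points. This rules out that
  \<open>X n\<close> lies off the extreme level for large \<open>n\<close>, and on that level
  \<open>pos\<close> is continuous.\<close>

lemma order_closed:
  assumes X: "\<And>n. X n \<in> D" "X \<longlonglongrightarrow> x" and Y: "\<And>n. Y n \<in> D" "Y \<longlonglongrightarrow> y"
    and XY: "\<And>n. f (Y n) = f (X n)" "\<And>n. pos (Y n) \<le> pos (X n)"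
  shows "pos y \<le> pos x"
proof (cases "f x \<in> {lo<..<hi}")
  case True
  then show ?thesis using order_closed_interior[OF X Y XY] by blast
next
  case False
  have x: "x \<in> D" "(\<lambda>n. f (X n)) \<longlonglongrightarrow> f x" and y: "y \<in> D" "(\<lambda>n. f (X n)) \<longlonglongrightarrow> f y"
    using fibre_limit[OF _ X(2)] fibre_limit[OF _ Y(2)] X Y XY by auto
  then have fy: "f y = f x" using LIMSEQ_unique by blast
  define e where "e = f x"
  have e: "e \<in> {lo, hi}" "e \<in> {lo..hi}" using range_f[OF x(1)] False by (auto simp: e_def)
  show ?thesis
  proof (rule ccontr)
    assume "\<not> pos y \<le> pos x"
    then obtain c' \<tau> where c': "c' \<in> {lo<..<hi}" and cont: "continuous_on (closed_segment e c') \<tau>"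
      and \<tau>: "\<forall>c\<in>closed_segment e c'. \<tau> c \<in> D \<and> f (\<tau> c) = c"
      and less: "pos x < pos (\<tau> e)" "pos (\<tau> e) < pos y"
      using end_trajectories[OF x(1) y(1) _ fy] e unfolding e_def by (metis not_le)
    define L where "L = {y \<in> D. f y \<in> open_segment e c' \<and> pos y < pos (\<tau> (f y))}"
    define R where "R = {y \<in> D. f y \<in> open_segment e c' \<and> pos (\<tau> (f y)) < pos y}"
    interpret rev: strip D f lo hi b a "\<lambda>x. - pos x" by (rule strip_reverse)
    have "y \<notin> closure L"
      unfolding L_def by (rule trajectory_side[OF e(1) c' cont bspec[OF \<tau>] y(1) fy[folded e_def] less(2)])
    then have ev1: "\<forall>\<^sub>F n in sequentially. Y n \<in> - closure L"
      using Y(2) by (intro topological_tendstoD) auto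
    have "x \<notin> closure R"
      using rev.trajectory_side[OF e(1) c' cont bspec[OF \<tau>] x(1) e_def[symmetric]] less(1)
      unfolding R_def neg_less_iff_less by blast
    then have ev2: "\<forall>\<^sub>F n in sequentially. X n \<in> - closure R"
      using X(2) by (intro topological_tendstoD) auto
    have "compact (\<tau> ` closed_segment e c')" using cont by (rule compact_continuous_image) simp
    moreover have "x \<notin> \<tau> ` closed_segment e c'"
    proof
      assume "x \<in> \<tau> ` closed_segment e c'"
      then obtain c where "c \<in> closed_segment e c'" "x = \<tau> c" by blast
      then have "x = \<tau> e" using bspec[OF \<tau>] e_def by metis
      then show False using less(1) by simp
    qed
    ultimately have ev3: "\<forall>\<^sub>F n in sequentially. X n \<in> - (\<tau> ` closed_segment e c')"
      using X(2) by (intro topological_tendstoD) (auto intro: compact_imp_closed)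
    have ev4: "\<forall>\<^sub>F n in sequentially. f (X n) \<in> ball e \<bar>c' - e\<bar>"
      using x(2) c' e by (intro topological_tendstoD) (auto simp: e_def)
    \<comment> \<open>Off the extreme level \<open>X n\<close> would lie strictly to the left of the
      trajectory, and with it \<open>Y n\<close>, which does not come after \<open>X n\<close>; but
      left points do not accumulate at \<open>y\<close>.\<close>
    have ev: "\<forall>\<^sub>F n in sequentially. f (X n) = e"
      using ev1 ev2 ev3 ev4
    proof eventually_elim
      case (elim n)
      show ?case
      proof (rule ccontr)
        assume ne: "f (X n) \<noteq> e"
        have os: "f (X n) \<in> open_segment e c'"
          using elim(4) range_f[OF X(1)[of n]] e c' ne
          by (auto simp: open_segment_eq_real_ivl dist_real_def)
        then have cs: "f (X n) \<in> closed_segment e c'" by (simp add: open_segment_def)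
        have "X n \<notin> R" using elim(2) closure_subset by blast
        then have "pos (X n) \<le> pos (\<tau> (f (X n)))" using os X(1)[of n] by (auto simp: R_def)
        moreover have "pos (X n) \<noteq> pos (\<tau> (f (X n)))"
        proof
          assume "pos (X n) = pos (\<tau> (f (X n)))"
          then have "X n = \<tau> (f (X n))" using pos_eq[OF X(1)] \<tau> cs by metis
          then show False using elim(3) cs by blast
        qed
        ultimately have "Y n \<in> L" using XY[of n] Y(1)[of n] os by (auto simp: L_def)
        then show False using elim(1) closure_subset by blast
      qed
    qed
    have "(\<lambda>n. pos (X n)) \<longlonglongrightarrow> pos x"
      by (rule continuous_on_tendsto_compose[OF cont_pos[OF e(2)] X(2)])
        (use x(1) X(1) eventually_mono[OF ev] in \<open>auto simp: e_def\<close>)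
    moreover have "(\<lambda>n. pos (Y n)) \<longlonglongrightarrow> pos y"
      by (rule continuous_on_tendsto_compose[OF cont_pos[OF e(2)] Y(2)])
        (use y(1) Y(1) fy XY(1) eventually_mono[OF ev] in \<open>auto simp: e_def\<close>)
    ultimately have "pos y \<le> pos x" using XY(2) by (intro LIMSEQ_le) auto
    then show False using less by simp
  qed
qed

section \<open>A continuous function that increases along every fibre\<close>

lemma closed_down:
  assumes "x \<in> D" shows "closed (down x)"
proof -
  have "closed {y \<in> fib (f x). pos y \<in> {..pos x}}"
    using continuous_closed_preimage[OF cont_pos[OF range_f[OF assms]] compact_imp_closed[OF compact_fibre], of "{..pos x}"]
    by (simp add: vimage_def Int_def)
  then show ?thesis by (simp add: conj_assoc)
qed

lemma infdist_down_attained: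
  assumes "x \<in> D"
  obtains y where "y \<in> down x" "infdist p (down x) = dist p y"
proof -
  have "x \<in> down x" using assms by simp
  then have "down x \<noteq> {}" by blast
  with closed_down[OF assms] show thesis by (rule infdist_attains_inf) (rule that)
qed

text \<open>Both semicontinuities are checked on sequences. For the closed condition
  \<open>\<le> r\<close>, nearest points have a convergent subsequence, and
  \<open>order_closed\<close> puts its limit into \<open>down x\<close>. For \<open>r \<le>\<close>,
  a nearest point of \<open>down x\<close> is approximated by points of \<open>down (X n)\<close>
  through \<open>down_lower_limit\<close>.\<close>

lemma continuous_infdist_down: "continuous_on D (\<lambda>x. infdist p (down x))"
proof -
  have "closed {x \<in> D. infdist p (down x) \<le> r}" for r
    unfolding closed_sequential_limits
  proof (intro allI impI, elim conjE)
    fix X x assume X: "\<forall>n. X n \<in> {x \<in> D. infdist p (down x) \<le> r}" "X \<longlonglongrightarrow> x"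
    then have XD: "X n \<in> D" "infdist p (down (X n)) \<le> r" for n by auto
    have x: "x \<in> D" using fibre_limit[OF XD(1) X(2)] by auto
    have "\<exists>y\<in>down (X n). dist p y \<le> r" for n
    proof -
      obtain y where "y \<in> down (X n)" "infdist p (down (X n)) = dist p y"
        using infdist_down_attained[OF XD(1)] .
      then show ?thesis using XD(2)[of n] by (intro bexI[of _ y]) auto
    qed
    then obtain Y where Y: "\<And>n. Y n \<in> down (X n)" "\<And>n. dist p (Y n) \<le> r" by metis
    obtain s y where s: "strict_mono s" "(Y \<circ> s) \<longlonglongrightarrow> y"
      using compact_D[unfolded compact_def, rule_format, of Y] Y(1) by blast
    have Xs: "(X \<circ> s) \<longlonglongrightarrow> x" using X(2) s(1) by (rule LIMSEQ_subseq_LIMSEQ)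
    have "pos y \<le> pos x"
      by (rule order_closed[OF _ Xs _ s(2)]) (use XD Y in auto)
    moreover have "y \<in> D" "f y = f x"
    proof -
      have l: "(\<lambda>n. f ((X \<circ> s) n)) \<longlonglongrightarrow> f x" "(\<lambda>n. f ((Y \<circ> s) n)) \<longlonglongrightarrow> f y" and "y \<in> D"
        using fibre_limit[OF _ Xs] fibre_limit[OF _ s(2)] XD Y by auto
      moreover have "f ((Y \<circ> s) n) = f ((X \<circ> s) n)" for n using Y(1)[of "s n"] by simp
      ultimately show "y \<in> D" "f y = f x" using LIMSEQ_unique by auto
    qed
    moreover have "dist p y \<le> r"
      by (rule LIMSEQ_le_const2[OF tendsto_dist[OF tendsto_const s(2)]]) (use Y(2) in auto)
    ultimately show "x \<in> {x \<in> D. infdist p (down x) \<le> r}"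
      using x infdist_le2[of y "down x" p r] by auto
  qed
  moreover have "closed {x \<in> D. r \<le> infdist p (down x)}" for r
    unfolding closed_sequential_limits
  proof (intro allI impI, elim conjE)
    fix X x assume X: "\<forall>n. X n \<in> {x \<in> D. r \<le> infdist p (down x)}" "X \<longlonglongrightarrow> x"
    then have XD: "X n \<in> D" "r \<le> infdist p (down (X n))" for n by auto
    have x: "x \<in> D" using fibre_limit[OF XD(1) X(2)] by auto
    obtain y where y: "y \<in> down x" "infdist p (down x) = dist p y"
      using infdist_down_attained[OF x] .
    have "r \<le> dist p y + e" if e: "e > 0" for e
    proof -
      obtain n where "down (X n) \<inter> ball y e \<noteq> {}"
        using eventually_happens'[OF sequentially_bot down_lower_limit[OF XD(1) X(2) y(1) e]] by blast
      then obtain v where v: "v \<in> down (X n)" "dist y v < e" unfolding mem_ball[symmetric] by blast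
      have "r \<le> dist p v" using XD(2)[of n] infdist_le[OF v(1), of p] by linarith
      then show ?thesis using v(2) dist_triangle[of p v y] by linarith
    qed
    then have "r \<le> infdist p (down x)" using field_le_epsilon y(2) by metis
    then show "x \<in> {x \<in> D. r \<le> infdist p (down x)}" using x by blast
  qed
  ultimately have "continuous_map (top_of_set D) euclideanreal (\<lambda>x. infdist p (down x))"
    unfolding continuous_map_upper_lower_semicontinuous_le
    by (auto intro: closed_subset)
  then show ?thesis by simp
qed

text \<open>Segments grow along a fibre, so distances to them shrink; the minus sign turns this into
  growth. One reference point gives only weak monotonicity, so distances from a dense sequence are
  summed, truncated at 1 and weighted geometrically to make the series converge uniformly.\<close>

lemma fibrewise_increasing_function:
  "\<exists>\<mu> :: complex \<Rightarrow> real. continuous_on D \<mu> \<and>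
     (\<forall>x\<in>D. \<forall>y\<in>D. f x = f y \<longrightarrow> pos x < pos y \<longrightarrow> \<mu> x < \<mu> y)"
proof -
  obtain C :: "complex set" where C: "countable C" "\<And>X. open X \<Longrightarrow> X \<noteq> {} \<Longrightarrow> \<exists>d\<in>C. d \<in> X"
    by (rule countable_dense_setE) blast
  have "C \<noteq> {}" using C(2)[of UNIV] by auto
  define d where "d = from_nat_into C"
  have dense: "\<exists>n. dist (d n) y < r" if "r > 0" for y r
  proof -
    have "ball y r \<noteq> {}" using that by simp
    then obtain z where "z \<in> C" "z \<in> ball y r" using C(2)[OF open_ball] by blast
    then show ?thesis using from_nat_into_surj[OF C(1)] by (metis d_def dist_commute mem_ball)
  qed
  define g where "g n x = (1/2)^n * min 1 (infdist (d n) (down x))" for n x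
  have g: "0 \<le> g n x" "g n x \<le> (1/2)^n" for n x
    by (auto simp: g_def infdist_nonneg intro!: mult_left_le)
  have sg: "summable (\<lambda>n. g n x)" for x
    by (rule summable_comparison_test'[of "\<lambda>n. (1/2)^n" 0]) (use g in auto)
  define \<mu> where "\<mu> x = - (\<Sum>n. g n x)" for x
  have "continuous_on D (\<lambda>x. \<Sum>n. g n x)"
  proof (rule uniform_limit_theorem[OF _ Weierstrass_m_test[of _ g "\<lambda>n. (1/2)^n"]])
    show "\<forall>\<^sub>F n in sequentially. continuous_on D (\<lambda>x. \<Sum>i<n. g i x)"
      unfolding g_def by (intro always_eventually allI continuous_intros continuous_infdist_down)
  qed (use g in auto)
  then have "continuous_on D \<mu>" unfolding \<mu>_def by (rule continuous_on_minus)
  moreover have "\<mu> x < \<mu> y" if xy: "x \<in> D" "y \<in> D" "f x = f y" "pos x < pos y" for x y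
  proof -
    have sub: "down x \<subseteq> down y" "x \<in> down x" "y \<in> down y" "y \<notin> down x" using xy by auto
    have mono: "infdist p (down y) \<le> infdist p (down x)" for p
      using sub by (intro infdist_mono) auto
    have le: "g n y \<le> g n x" for n
      using mono[of "d n"] by (auto simp: g_def intro!: mult_left_mono)
    define r where "r = infdist y (down x)"
    have r: "r > 0" unfolding r_def
      using in_closed_iff_infdist_zero[OF closed_down[OF xy(1)], of y] sub(2,4) infdist_nonneg[of y "down x"]
      by force
    \<comment> \<open>A reference point this close to \<open>y\<close> has distance below
      \<open>min r 1 / 2\<close> from \<open>down y\<close> and above it from \<open>down x\<close>.
      The bound is at most 1/2, so the truncation at 1 does not destroy the strict
      inequality.\<close>
    obtain n where n: "dist (d n) y < min r 1 / 2" using dense[of "min r 1 / 2" y] r by auto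
    have "infdist (d n) (down y) < min r 1 / 2" using infdist_le[OF sub(3), of "d n"] n by linarith
    moreover have "r \<le> dist (d n) y + infdist (d n) (down x)"
      unfolding r_def using infdist_triangle[of y "down x" "d n"] by (simp add: dist_commute)
    ultimately have "min 1 (infdist (d n) (down y)) < min 1 (infdist (d n) (down x))"
      using n by (auto simp: min_def split: if_splits)
    then have "g n y < g n x" by (simp add: g_def)
    then have "0 < (\<Sum>n. g n x - g n y)"
      using le by (intro suminf_pos2[of _ n] summable_diff sg) auto
    then show ?thesis using suminf_diff[OF sg sg, of x y] by (simp add: \<mu>_def)
  qed
  ultimately show ?thesis by blast
qed

end

section \<open>Extension of boundary maps in strip coordinates\<close>

context strip begin

text \<open>By \<open>a_neq_b\<close> this can only happen at \<open>lo\<close> or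
  \<open>hi\<close>; the fibre is then a single point.\<close>

definition degenerate :: "real \<Rightarrow> bool" where "degenerate c \<longleftrightarrow> a c = b c"

lemma degenerate_fibre:
  assumes "x \<in> D" "degenerate (f x)" shows "x = a (f x)"
proof -
  have "pos x = pos (a (f x))" using pos_bounds[OF assms(1)] assms(2) by (simp add: degenerate_def)
  moreover have "a (f x) \<in> D" "f (a (f x)) = f x" using a_fibre[OF range_f[OF assms(1)]] by blast+
  ultimately show ?thesis using pos_eq[of x "a (f x)"] assms(1) by simp
qed

text \<open>Continuity is demanded only at points of nondegenerate fibres: near a one-point fibre a
  coordinate that runs from 0 to 1 on every neighbouring fibre has no limit. The value at such a
  point is fixed to 0 by the clause on \<open>a\<close>.\<close>

definition fibre_coordinate :: "(complex \<Rightarrow> real) \<Rightarrow> bool" where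
  "fibre_coordinate \<nu> \<longleftrightarrow>
    (\<forall>X x. (\<forall>n. X n \<in> D) \<longrightarrow> X \<longlonglongrightarrow> x \<longrightarrow> \<not> degenerate (f x) \<longrightarrow> (\<lambda>n. \<nu> (X n)) \<longlonglongrightarrow> \<nu> x) \<and>
    (\<forall>c\<in>{lo..hi}. \<nu> (a c) = 0) \<and>
    (\<forall>c\<in>{lo..hi}. \<not> degenerate c \<longrightarrow> \<nu> (b c) = 1) \<and>
    (\<forall>x\<in>D. \<nu> x \<in> {0..1}) \<and>
    (\<forall>x\<in>D. \<forall>y\<in>D. f x = f y \<longrightarrow> \<nu> x = \<nu> y \<longrightarrow> x = y) \<and>
    (\<forall>c\<in>{lo..hi}. \<not> degenerate c \<longrightarrow> (\<forall>s\<in>{0..1}. \<exists>x\<in>D. f x = c \<and> \<nu> x = s))"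

lemma fibre_coordinateD:
  assumes "fibre_coordinate \<nu>"
  shows "\<And>X x. \<lbrakk>\<And>n. X n \<in> D; X \<longlonglongrightarrow> x; \<not> degenerate (f x)\<rbrakk> \<Longrightarrow> (\<lambda>n. \<nu> (X n)) \<longlonglongrightarrow> \<nu> x"
    "\<And>c. c \<in> {lo..hi} \<Longrightarrow> \<nu> (a c) = 0"
    "\<And>c. \<lbrakk>c \<in> {lo..hi}; \<not> degenerate c\<rbrakk> \<Longrightarrow> \<nu> (b c) = 1"
    "\<And>x. x \<in> D \<Longrightarrow> \<nu> x \<in> {0..1}"
    "\<And>x y. \<lbrakk>x \<in> D; y \<in> D; f x = f y; \<nu> x = \<nu> y\<rbrakk> \<Longrightarrow> x = y"
    "\<And>c s. \<lbrakk>c \<in> {lo..hi}; \<not> degenerate c; s \<in> {0..1}\<rbrakk> \<Longrightarrow> \<exists>x\<in>D. f x = c \<and> \<nu> x = s"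
proof -
  note u = assms[unfolded fibre_coordinate_def]
  show "\<And>X x. \<lbrakk>\<And>n. X n \<in> D; X \<longlonglongrightarrow> x; \<not> degenerate (f x)\<rbrakk> \<Longrightarrow> (\<lambda>n. \<nu> (X n)) \<longlonglongrightarrow> \<nu> x"
    by (rule u[THEN conjunct1, rule_format])
  note u = u[THEN conjunct2]
  show "\<And>c. c \<in> {lo..hi} \<Longrightarrow> \<nu> (a c) = 0" by (rule u[THEN conjunct1, rule_format])
  note u = u[THEN conjunct2]
  show "\<And>c. \<lbrakk>c \<in> {lo..hi}; \<not> degenerate c\<rbrakk> \<Longrightarrow> \<nu> (b c) = 1" by (rule u[THEN conjunct1, rule_format])
  note u = u[THEN conjunct2]
  show "\<And>x. x \<in> D \<Longrightarrow> \<nu> x \<in> {0..1}" by (rule u[THEN conjunct1, THEN bspec])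
  note u = u[THEN conjunct2]
  show "\<And>x y. \<lbrakk>x \<in> D; y \<in> D; f x = f y; \<nu> x = \<nu> y\<rbrakk> \<Longrightarrow> x = y"
    by (rule u[THEN conjunct1, rule_format])
  note u = u[THEN conjunct2]
  show "\<And>c s. \<lbrakk>c \<in> {lo..hi}; \<not> degenerate c; s \<in> {0..1}\<rbrakk> \<Longrightarrow> \<exists>x\<in>D. f x = c \<and> \<nu> x = s"
    by (rule u[rule_format])
qed

lemma fibre_coordinate_exists: "\<exists>\<nu>. fibre_coordinate \<nu>"
proof -
  obtain \<mu> :: "complex \<Rightarrow> real" where cont: "continuous_on D \<mu>"
    and less: "\<And>x y. \<lbrakk>x \<in> D; y \<in> D; f x = f y; pos x < pos y\<rbrakk> \<Longrightarrow> \<mu> x < \<mu> y"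
    using fibrewise_increasing_function by blast
  define A where "A c = \<mu> (a c)" for c
  define B where "B c = \<mu> (b c)" for c
  \<comment> \<open>\<open>\<mu>\<close> is rescaled to run from 0 to 1 on each fibre. On a
    degenerate fibre this is 0 divided by 0, which evaluates to 0, the value required at
    \<open>a c\<close>.\<close>
  define \<nu> where "\<nu> x = (\<mu> x - A (f x)) / (B (f x) - A (f x))" for x
  have aD: "a c \<in> D" "b c \<in> D" if "c \<in> {lo..hi}" for c using a_fibre[OF that] b_fibre[OF that] by auto
  have fa: "f (a c) = c" "f (b c) = c" if "c \<in> {lo..hi}" for c using a_fibre[OF that] b_fibre[OF that] by auto
  have le: "\<mu> x \<le> \<mu> y" if "x \<in> D" "y \<in> D" "f x = f y" "pos x \<le> pos y" for x y
    using less[OF that(1-3)] pos_eq[OF that(1-3)] that(4) by fastforce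
  have AB: "A (f x) \<le> \<mu> x" "\<mu> x \<le> B (f x)" if "x \<in> D" for x
    unfolding A_def B_def using pos_bounds[OF that] range_f[OF that] aD fa that
    by (auto intro!: le)
  have nd: "A c < B c" if c: "c \<in> {lo..hi}" "\<not> degenerate c" for c
  proof -
    have "pos (a c) \<le> pos (b c)" using pos_bounds[OF aD(1)[OF c(1)]] fa[OF c(1)] by simp
    moreover have "pos (a c) \<noteq> pos (b c)"
      using pos_eq[OF aD[OF c(1)]] fa[OF c(1)] c(2) by (auto simp: degenerate_def)
    ultimately show ?thesis unfolding A_def B_def using aD[OF c(1)] fa[OF c(1)] by (intro less) auto
  qed
  show ?thesis
    unfolding fibre_coordinate_def
  proof (intro exI[of _ \<nu>] conjI allI ballI impI)
    fix X x assume X0: "\<forall>n. X n \<in> D" and X': "X \<longlonglongrightarrow> x" "\<not> degenerate (f x)"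
    note X = X0[rule_format] X'
    have x: "x \<in> D" "(\<lambda>n. f (X n)) \<longlonglongrightarrow> f x" using fibre_limit[OF X(1,2)] by auto
    have r: "f x \<in> {lo..hi}" "\<And>n. f (X n) \<in> {lo..hi}" using range_f x X(1) by blast+
    have "(\<lambda>n. \<mu> (X n)) \<longlonglongrightarrow> \<mu> x"
      by (rule continuous_on_tendsto_compose[OF cont X(2) x(1)]) (use X in auto)
    moreover have "(\<lambda>n. A (f (X n))) \<longlonglongrightarrow> A (f x)" unfolding A_def
      by (rule continuous_on_tendsto_compose[OF cont tendsto_a[OF x(2) r] aD(1)[OF r(1)]])
        (rule always_eventually, rule allI, rule aD(1)[OF r(2)])
    moreover have "(\<lambda>n. B (f (X n))) \<longlonglongrightarrow> B (f x)" unfolding B_def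
      by (rule continuous_on_tendsto_compose[OF cont tendsto_b[OF x(2) r] aD(2)[OF r(1)]])
        (rule always_eventually, rule allI, rule aD(2)[OF r(2)])
    ultimately show "(\<lambda>n. \<nu> (X n)) \<longlonglongrightarrow> \<nu> x"
      unfolding \<nu>_def using nd[OF r(1) X(3)] by (intro tendsto_intros) auto
  next
    fix c assume c: "c \<in> {lo..hi}"
    show "\<nu> (a c) = 0" using fa[OF c] by (simp add: \<nu>_def A_def)
  next
    fix c assume c: "c \<in> {lo..hi}" "\<not> degenerate c"
    then show "\<nu> (b c) = 1" using fa[OF c(1)] nd[OF c] by (simp add: \<nu>_def B_def)
  next
    fix x assume x: "x \<in> D"
    show "\<nu> x \<in> {0..1}" using AB[OF x] by (auto simp: \<nu>_def divide_le_eq_1)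
  next
    fix x y assume xy: "x \<in> D" "y \<in> D" "f x = f y" "\<nu> x = \<nu> y"
    show "x = y"
    proof (cases "degenerate (f x)")
      case True
      then show ?thesis using degenerate_fibre xy by metis
    next
      case False
      then have "\<mu> x = \<mu> y" using nd[OF range_f[OF xy(1)] False] xy(3,4) by (simp add: \<nu>_def)
      then show ?thesis using less[of x y] less[of y x] xy pos_eq[of x y] by fastforce
    qed
  next
    fix c s :: real assume c: "c \<in> {lo..hi}" "\<not> degenerate c" and s: "s \<in> {0..1}"
    define d where "d = B c - A c"
    define m where "m = A c + s * d"
    have d: "d > 0" using nd[OF c] by (simp add: d_def)
    have sm: "s * d \<le> d" using s d by (intro mult_left_le_one_le) auto
    have "connected (\<mu> ` fib c)"
      by (rule connected_continuous_image[OF continuous_on_subset[OF cont] connected_fibre[OF c(1)]]) auto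
    moreover have "A c \<in> \<mu> ` fib c" "B c \<in> \<mu> ` fib c"
      unfolding A_def B_def using aD[OF c(1)] fa[OF c(1)] by auto
    moreover have "A c \<le> m" unfolding m_def using s d by simp
    moreover have "m \<le> B c" unfolding m_def using sm d_def by linarith
    ultimately have "m \<in> \<mu> ` fib c" using connectedD_interval by blast
    then obtain x where "x \<in> D" "f x = c" "\<mu> x = m" by blast
    then show "\<exists>x\<in>D. f x = c \<and> \<nu> x = s" using d
      by (intro bexI[of _ x]) (auto simp: \<nu>_def m_def d_def[symmetric])
  qed
qed

end

text \<open>In coordinates \<open>\<phi>0\<close> induces increasing self-bijections
  \<open>h0\<close> and \<open>h1\<close> of [0,1] on the two extreme fibres. Their convex
  combinations \<open>H c\<close> are again such bijections, which determines \<open>\<phi>\<close>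
  on every fibre. Matching the ends \<open>a\<close> with \<open>a'\<close> and \<open>b\<close>
  with \<open>b'\<close> makes both bijections increasing, so that the combinations stay
  injective.\<close>

lemma strip_extension:
  assumes sf: "strip D f lo hi a b pos" and sg: "strip D g lo hi a' b' pos'"
    and S: "S = {x \<in> D. f x \<in> {lo, hi}} \<union> a ` {lo..hi} \<union> b ` {lo..hi}"
    and cont: "continuous_on S \<phi>0" and inj: "inj_on \<phi>0 S"
    and im: "\<And>x. x \<in> S \<Longrightarrow> \<phi>0 x \<in> D" and gf: "\<And>x. x \<in> S \<Longrightarrow> g (\<phi>0 x) = f x"
    and a': "\<And>c. c \<in> {lo..hi} \<Longrightarrow> \<phi>0 (a c) = a' c" and b': "\<And>c. c \<in> {lo..hi} \<Longrightarrow> \<phi>0 (b c) = b' c"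
  shows "\<exists>\<phi> \<phi>'. homeomorphism D D \<phi> \<phi>' \<and> (\<forall>x\<in>S. \<phi> x = \<phi>0 x) \<and> (\<forall>x\<in>D. g (\<phi> x) = f x)"
proof -
  interpret F: strip D f lo hi a b pos by (rule sf)
  interpret G: strip D g lo hi a' b' pos' by (rule sg)
  obtain \<nu> \<nu>' where "F.fibre_coordinate \<nu>" "G.fibre_coordinate \<nu>'"
    using F.fibre_coordinate_exists G.fibre_coordinate_exists by blast
  note \<nu> = F.fibre_coordinateD[OF this(1)] and \<nu>' = G.fibre_coordinateD[OF this(2)]
  have aS: "a c \<in> S" "b c \<in> S" if "c \<in> {lo..hi}" for c using that S by auto
  have fa: "f (a c) = c" "f (b c) = c" "a c \<in> D" "b c \<in> D" if "c \<in> {lo..hi}" for c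
    using F.a_fibre[OF that] F.b_fibre[OF that] by auto
  have ga: "g (a' c) = c" "g (b' c) = c" "a' c \<in> D" "b' c \<in> D" if "c \<in> {lo..hi}" for c
    using G.a_fibre[OF that] G.b_fibre[OF that] by auto
  have SD: "x \<in> D" if "x \<in> S" for x using that S fa by auto
  have deg: "G.degenerate c \<longleftrightarrow> F.degenerate c" if c: "c \<in> {lo..hi}" for c
    unfolding G.degenerate_def F.degenerate_def
    using a'[OF c] b'[OF c] inj_onD[OF inj _ aS[OF c]] by metis
  have "\<exists>h. continuous_on {0..1} h \<and> h 0 = 0 \<and> h 1 = 1 \<and> strict_mono_on {0..1} h \<and>
      (\<forall>x\<in>D. f x = e \<longrightarrow> h (\<nu> x) = \<nu>' (\<phi>0 x))" if e: "e \<in> {lo, hi}" for e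
  proof -
    have ee: "e \<in> {lo..hi}" using e F.lo_hi by auto
    have eS: "x \<in> S" if "x \<in> D" "f x = e" for x using that S e by auto
    show ?thesis
    proof (cases "F.degenerate e")
      case True
      have "x = a e" if "x \<in> D" "f x = e" for x using F.degenerate_fibre that True by metis
      then have "\<nu> x = \<nu>' (\<phi>0 x)" if "x \<in> D" "f x = e" for x
        using that \<nu>(2)[OF ee] \<nu>'(2)[OF ee] a'[OF ee] by metis
      \<comment> \<open>On a one-point fibre only the coordinate 0 occurs, so the identity is a
        valid choice; it keeps the interpolation strictly increasing on the other levels.\<close>
      then show ?thesis by (intro exI[of _ id]) (auto intro: strict_mono_onI simp: id_def)
    next
      case False
      have cn: "continuous_on (F.fib e) \<nu>"
      proof (rule continuous_on_sequentiallyI)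
        fix X x assume "\<forall>n. X n \<in> F.fib e" "x \<in> F.fib e" "X \<longlonglongrightarrow> x"
        then show "(\<lambda>n. \<nu> (X n)) \<longlonglongrightarrow> \<nu> x" using \<nu>(1)[of X x] False by auto
      qed
      have cn': "continuous_on (G.fib e) \<nu>'"
      proof (rule continuous_on_sequentiallyI)
        fix X x assume "\<forall>n. X n \<in> G.fib e" "x \<in> G.fib e" "X \<longlonglongrightarrow> x"
        then show "(\<lambda>n. \<nu>' (X n)) \<longlonglongrightarrow> \<nu>' x" using \<nu>'(1)[of X x] False deg[OF ee] by auto
      qed
      have "inj_on \<nu> (F.fib e)" unfolding inj_on_def by (metis (mono_tags, lifting) \<nu>(5) mem_Collect_eq)
      moreover have "\<nu> ` F.fib e = {0..1}"
      proof
        show "\<nu> ` F.fib e \<subseteq> {0..1}" using \<nu>(4) by blast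
        show "{0..1} \<subseteq> \<nu> ` F.fib e"
        proof
          fix s :: real assume "s \<in> {0..1}"
          then obtain x where "x \<in> D" "f x = e" "\<nu> x = s" using \<nu>(6)[OF ee False] by blast
          then show "s \<in> \<nu> ` F.fib e" by blast
        qed
      qed
      ultimately obtain k where k: "homeomorphism (F.fib e) {0..1} \<nu> k"
        using homeomorphism_compact[OF F.compact_fibre cn] by blast
      define h where "h = \<nu>' \<circ> \<phi>0 \<circ> k"
      have kim: "k s \<in> D" "f (k s) = e" if "s \<in> {0..1}" for s
        using homeomorphism_image2[OF k] that by blast+
      have k\<nu>: "\<nu> (k s) = s" if "s \<in> {0..1}" for s
        using homeomorphism_apply2[OF k that] .
      have h: "h (\<nu> x) = \<nu>' (\<phi>0 x)" if "x \<in> D" "f x = e" for x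
        using homeomorphism_apply1[OF k] that by (simp add: h_def)
      have ch: "continuous_on {0..1} h" unfolding h_def
      proof (intro continuous_on_compose)
        show "continuous_on {0..1} k" using k by (simp add: homeomorphism_def)
        have ki: "k ` {0..1} = F.fib e" using homeomorphism_image2[OF k] .
        show "continuous_on (k ` {0..1}) \<phi>0" 
          unfolding ki by (rule continuous_on_subset[OF cont]) (use eS in blast)
        have "\<phi>0 ` k ` {0..1} \<subseteq> G.fib e"
        proof (unfold ki, rule image_subsetI)
          fix x assume "x \<in> F.fib e"
          then have "x \<in> S" "f x = e" using eS by blast+
          then show "\<phi>0 x \<in> G.fib e" using gf[of x] im[of x] by simp
        qed
        then show "continuous_on (\<phi>0 ` k ` {0..1}) \<nu>'" using cn' continuous_on_subset by blast
      qed
      have "inj_on h {0..1}"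
      proof (rule inj_onI)
        fix s t :: real assume st: "s \<in> {0..1}" "t \<in> {0..1}" "h s = h t"
        have S2: "k s \<in> S" "k t \<in> S"
          using eS[OF kim[OF st(1)]] eS[OF kim[OF st(2)]] .
        have "g (\<phi>0 (k s)) = g (\<phi>0 (k t))"
          using gf[OF S2(1)] gf[OF S2(2)] kim(2)[OF st(1)] kim(2)[OF st(2)] by simp
        moreover have "\<nu>' (\<phi>0 (k s)) = \<nu>' (\<phi>0 (k t))" using st(3) by (simp add: h_def)
        ultimately have "\<phi>0 (k s) = \<phi>0 (k t)" by (rule \<nu>'(5)[OF im[OF S2(1)] im[OF S2(2)]])
        then have "k s = k t" by (rule inj_onD[OF inj _ S2])
        then have "\<nu> (k s) = \<nu> (k t)" by (rule arg_cong)
        then show "s = t" unfolding k\<nu>[OF st(1)] k\<nu>[OF st(2)] .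
      qed
      \<comment> \<open>A continuous injective function on an interval is strictly monotone; the
        values 0 at 0 and 1 at 1 then exclude the decreasing case.\<close>
      then have "strict_mono_on {0..1} h \<or> strict_antimono_on {0..1} h"
        using injective_eq_monotone_map[OF is_interval_cc ch] by blast
      moreover have h01: "h 0 = 0" "h 1 = 1"
      proof -
        have "h (\<nu> (a e)) = \<nu>' (a' e)" "h (\<nu> (b e)) = \<nu>' (b' e)"
          using h[OF fa(3)[OF ee] fa(1)[OF ee]] h[OF fa(4)[OF ee] fa(2)[OF ee]] a'[OF ee] b'[OF ee] by simp_all
        then show "h 0 = 0" "h 1 = 1"
          using False \<nu>(2,3)[OF ee] \<nu>'(2,3)[OF ee] deg[OF ee] by simp_all
      qed
      moreover have "\<not> strict_antimono_on {0..1} h"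
      proof
        assume "strict_antimono_on {0..1} h"
        then have "h 0 > h 1" by (rule monotone_onD) auto
        then show False using h01 by simp
      qed
      ultimately have "strict_mono_on {0..1} h" by blast
      then show ?thesis by (intro exI[of _ h] conjI ballI impI ch h01 h)
    qed
  qed
  from this[of lo] this[of hi] obtain h0 h1 where
    h0: "continuous_on {0..1} h0" "h0 0 = 0" "h0 1 = 1" "strict_mono_on {0..1} h0" 
        "\<And>x. x \<in> D \<Longrightarrow> f x = lo \<Longrightarrow> h0 (\<nu> x) = \<nu>' (\<phi>0 x)" and
    h1: "continuous_on {0..1} h1" "h1 0 = 0" "h1 1 = 1" "strict_mono_on {0..1} h1" 
        "\<And>x. x \<in> D \<Longrightarrow> f x = hi \<Longrightarrow> h1 (\<nu> x) = \<nu>' (\<phi>0 x)" 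
    by auto
  define w where "w c = (c - lo) / (hi - lo)" for c
  have w: "0 \<le> w c" "w c \<le> 1" if "c \<in> {lo..hi}" for c
    using that F.lo_hi by (auto simp: w_def)
  have w01: "w lo = 0" "w hi = 1" using F.lo_hi by (auto simp: w_def)
  define H where "H c s = (1 - w c) * h0 s + w c * h1 s" for c s
  have H01: "H c 0 = 0" "H c 1 = 1" for c using h0 h1 by (auto simp: H_def)
  have Hless: "H c s < H c t" if "c \<in> {lo..hi}" "s \<in> {0..1}" "t \<in> {0..1}" "s < t" for c s t
  proof -
    have l: "h0 s < h0 t" "h1 s < h1 t"
      using monotone_onD[OF h0(4) that(2-4)] monotone_onD[OF h1(4) that(2-4)] by auto
    then have m: "(1 - w c) * h0 s \<le> (1 - w c) * h0 t" "w c * h1 s \<le> w c * h1 t"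
      using w[OF that(1)] by (auto intro!: mult_left_mono)
    show ?thesis
    proof (cases "w c = 0")
      case True then show ?thesis using l by (simp add: H_def)
    next
      case False
      then have "w c * h1 s < w c * h1 t" using l w[OF that(1)] by auto
      then show ?thesis using m by (simp add: H_def)
    qed
  qed
  have Hcont: "continuous_on {0..1} (H c)" for c
    unfolding H_def by (intro continuous_intros h0 h1)
  have Hinj: "s = t" if "c \<in> {lo..hi}" "s \<in> {0..1}" "t \<in> {0..1}" "H c s = H c t" for c s t
    using Hless[OF that(1-3)] Hless[OF that(1) that(3) that(2)] that(4) by (metis less_irrefl linorder_less_linear)
  have Hran: "H c s \<in> {0..1}" if "c \<in> {lo..hi}" "s \<in> {0..1}" for c s
    using Hless[OF that(1), of 0 s] Hless[OF that(1), of s 1] that(2) H01[of c] by (cases "s = 0"; cases "s = 1") auto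
  have Hsurj: "\<exists>s\<in>{0..1}. H c s = t" if "t \<in> {0..1}" for c t
    using IVT'[OF _ _ _ Hcont, of c t] H01[of c] that by auto
  define P where "P x y \<longleftrightarrow> y \<in> D \<and> g y = f x \<and> \<nu>' y = H (f x) (\<nu> x)" for x y
  have Pex: "\<exists>y. P x y" if x: "x \<in> D" for x
  proof (cases "F.degenerate (f x)")
    case True
    have r: "f x \<in> {lo..hi}" by (rule F.range_f[OF x])
    have "\<nu> x = 0" using F.degenerate_fibre[OF x True] \<nu>(2)[OF r] by metis
    then show ?thesis using ga[OF r] \<nu>'(2)[OF r] H01 by (intro exI[of _ "a' (f x)"]) (auto simp: P_def)
  next
    case False
    have r: "f x \<in> {lo..hi}" by (rule F.range_f[OF x])
    show ?thesis using \<nu>'(6)[OF r _ Hran[OF r \<nu>(4)[OF x]]] False deg[OF r] by (auto simp: P_def)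
  qed
  have Pun: "y = z" if "P x y" "P x z" for x y z
    using that \<nu>'(5)[of y z] by (auto simp: P_def)
  define \<phi> where "\<phi> x = (THE y. P x y)" for x
  have P: "P x (\<phi> x)" if "x \<in> D" for x
    unfolding \<phi>_def using Pex[OF that] Pun by (metis theI)
  have \<phi>eq: "\<phi> x = y" if "x \<in> D" "P x y" for x y using P that Pun by blast
  have \<phi>D: "\<phi> x \<in> D" "g (\<phi> x) = f x" "\<nu>' (\<phi> x) = H (f x) (\<nu> x)" if "x \<in> D" for x
    using P[OF that] by (auto simp: P_def)
  have inj\<phi>: "inj_on \<phi> D"
  proof (rule inj_onI)
    fix x y assume xy: "x \<in> D" "y \<in> D" "\<phi> x = \<phi> y"
    have "f x = f y" using \<phi>D(2)[OF xy(1)] \<phi>D(2)[OF xy(2)] xy(3) by simp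
    moreover have "\<nu> x = \<nu> y"
      using \<phi>D(3)[OF xy(1)] \<phi>D(3)[OF xy(2)] xy(3) calculation Hinj[OF F.range_f[OF xy(1)] \<nu>(4)[OF xy(1)] \<nu>(4)[OF xy(2)]] by simp
    ultimately show "x = y" using \<nu>(5) xy by blast
  qed
  have surj: "\<phi> ` D = D"
  proof
    show "\<phi> ` D \<subseteq> D" using \<phi>D by blast
    show "D \<subseteq> \<phi> ` D"
    proof
      fix y assume y: "y \<in> D"
      define c where "c = g y"
      have c: "c \<in> {lo..hi}" unfolding c_def by (rule G.range_f[OF y])
      have "\<exists>x\<in>D. f x = c \<and> \<nu>' y = H c (\<nu> x)"
      proof (cases "G.degenerate c")
        case True
        have "\<nu>' y = 0" using G.degenerate_fibre[OF y] True \<nu>'(2)[OF c] unfolding c_def by metis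
        then show ?thesis using fa[OF c] \<nu>(2)[OF c] H01 by (intro bexI[of _ "a c"]) auto
      next
        case False
        obtain s where "s \<in> {0..1}" "H c s = \<nu>' y" using Hsurj[OF \<nu>'(4)[OF y]] by blast
        then show ?thesis using \<nu>(6)[OF c _ \<open>s \<in> {0..1}\<close>] False deg[OF c] by metis
      qed
      then obtain x where "x \<in> D" "f x = c" "\<nu>' y = H c (\<nu> x)" by blast
      then have "\<phi> x = y" using y by (intro \<phi>eq) (auto simp: P_def c_def)
      then show "y \<in> \<phi> ` D" using \<open>x \<in> D\<close> by blast
    qed
  qed
  \<comment> \<open>With compact codomain a closed graph suffices for continuity. At a degenerate
    limit level both coordinates are 0 and the relation holds without any convergence of
    \<open>\<nu> (X n)\<close>; elsewhere it passes to the limit.\<close>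
  have "closed ((\<lambda>x. (x, \<phi> x)) ` D)"
    unfolding closed_sequential_limits
  proof (intro allI impI, elim conjE)
    fix Z z assume Z: "\<forall>n. Z n \<in> (\<lambda>x. (x, \<phi> x)) ` D" "Z \<longlonglongrightarrow> z"
    define X where "X n = fst (Z n)" for n
    obtain x y where z: "z = (x, y)" by (cases z)
    have XD: "X n \<in> D" and ZX: "Z n = (X n, \<phi> (X n))" for n
      using Z(1)[rule_format, of n] by (auto simp: X_def)
    have X: "X \<longlonglongrightarrow> x" using tendsto_fst[OF Z(2)] z by (simp add: ZX)
    have Y: "(\<lambda>n. \<phi> (X n)) \<longlonglongrightarrow> y" using tendsto_snd[OF Z(2)] z by (simp add: ZX)
    have x: "x \<in> D" "(\<lambda>n. f (X n)) \<longlonglongrightarrow> f x" using F.fibre_limit[OF XD X] by auto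
    have y: "y \<in> D" "(\<lambda>n. f (X n)) \<longlonglongrightarrow> g y" using G.fibre_limit[OF _ Y] \<phi>D XD by auto
    have gy: "g y = f x" using LIMSEQ_unique[OF y(2) x(2)] .
    have r: "f x \<in> {lo..hi}" by (rule F.range_f[OF x(1)])
    have "\<nu>' y = H (f x) (\<nu> x)"
    proof (cases "F.degenerate (f x)")
      case True
      then have "\<nu> x = 0" "\<nu>' y = 0"
        using F.degenerate_fibre[OF x(1)] G.degenerate_fibre[OF y(1)] deg[OF r] gy \<nu>(2)[OF r] \<nu>'(2)[OF r] by metis+
      then show ?thesis using H01 by simp
    next
      case False
      have nx: "(\<lambda>n. \<nu> (X n)) \<longlonglongrightarrow> \<nu> x" by (rule \<nu>(1)[OF XD X False])
      have "(\<lambda>n. \<nu>' (\<phi> (X n))) \<longlonglongrightarrow> \<nu>' y"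
        using \<nu>'(1)[OF \<phi>D(1)[OF XD] Y] False deg[OF r] unfolding gy by blast
      then have 1: "(\<lambda>n. H (f (X n)) (\<nu> (X n))) \<longlonglongrightarrow> \<nu>' y" using \<phi>D(3)[OF XD] by simp
      have ev: "\<forall>\<^sub>F n in sequentially. \<nu> (X n) \<in> {0..1}"
        by (rule always_eventually, rule allI, rule \<nu>(4)[OF XD])
      have "(\<lambda>n. h0 (\<nu> (X n))) \<longlonglongrightarrow> h0 (\<nu> x)" "(\<lambda>n. h1 (\<nu> (X n))) \<longlonglongrightarrow> h1 (\<nu> x)"
        by (rule continuous_on_tendsto_compose[OF h0(1) nx \<nu>(4)[OF x(1)] ev]
            continuous_on_tendsto_compose[OF h1(1) nx \<nu>(4)[OF x(1)] ev])+
      then have "(\<lambda>n. H (f (X n)) (\<nu> (X n))) \<longlonglongrightarrow> H (f x) (\<nu> x)"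
        unfolding H_def w_def using F.lo_hi x(2) by (intro tendsto_intros) auto
      then show ?thesis using 1 LIMSEQ_unique by blast
    qed
    then have "\<phi> x = y" using x y gy by (intro \<phi>eq) (auto simp: P_def)
    then show "z \<in> (\<lambda>x. (x, \<phi> x)) ` D" using z x by blast
  qed
  then have "continuous_on D \<phi>"
    using continuous_from_closed_graph[OF F.compact_D, of \<phi> D] surj by blast
  then obtain \<phi>' where "homeomorphism D D \<phi> \<phi>'"
    using homeomorphism_compact[OF F.compact_D _ surj inj\<phi>] by blast
  moreover have "\<phi> x = \<phi>0 x" if x: "x \<in> S" for x
  proof (rule \<phi>eq[OF SD[OF x]])
    \<comment> \<open>On the lateral ends both sides are 0 or both are 1; on the extreme fibres the
      weight \<open>w\<close> leaves only \<open>h0\<close> or \<open>h1\<close>, which were read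
      off from \<open>\<phi>0\<close>.\<close>
    have "\<nu>' (\<phi>0 x) = H (f x) (\<nu> x)"
    proof -
      consider c where "c \<in> {lo..hi}" "x = a c" | c where "c \<in> {lo..hi}" "\<not> F.degenerate c" "x = b c"
        | "x \<in> D" "f x = lo" | "x \<in> D" "f x = hi"
        using x unfolding S F.degenerate_def by auto metis
      then show ?thesis
      proof cases
        case 1
        then show ?thesis using \<nu>(2) \<nu>'(2) a' H01 by simp
      next
        case 2
        then show ?thesis using \<nu>(3) \<nu>'(3) b' H01 deg fa by simp
      qed (simp_all add: h0(5) h1(5) H_def w01)
    qed
    then show "P x (\<phi>0 x)" using im[OF x] gf[OF x] by (simp add: P_def)
  qed
  ultimately show ?thesis using \<phi>D(2) by blast
qed

section \<open>Topology of disks and arcs\<close>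

text \<open>Invariance of domain in both directions: \<open>h\<close> maps the open disk to an open
  set, and \<open>h'\<close> maps the interior of \<open>D\<close> to an open subset of the closed
  disk.\<close>

lemma homeomorphic_disk_interior_frontier:
  fixes D :: "complex set" and h h' :: "complex \<Rightarrow> complex"
  assumes h: "homeomorphism (cball 0 1) D h h'"
  shows "interior D = h ` ball 0 1" "frontier D = h ` sphere 0 1"
proof -
  have bs: "ball 0 1 \<subseteq> (cball 0 1 :: complex set)" by auto
  have inj: "inj_on h (cball 0 1)" "inj_on h' D"
    using homeomorphism_apply1[OF h] homeomorphism_apply2[OF h] by (metis inj_onI)+
  have hD: "h ` cball 0 1 = D" "h' ` D = cball 0 1"
    using h by (auto simp: homeomorphism_def)
  have cont: "continuous_on (cball 0 1) h" "continuous_on D h'"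
    using h by (auto simp: homeomorphism_def)
  have "open (h ` ball 0 1)"
    by (rule invariance_of_domain[OF continuous_on_subset[OF cont(1) bs] open_ball inj_on_subset[OF inj(1) bs]])
  then have 1: "h ` ball 0 1 \<subseteq> interior D"
    using hD(1) bs by (intro interior_maximal) auto
  have "open (h' ` interior D)"
    using invariance_of_domain[OF continuous_on_subset[OF cont(2) interior_subset] open_interior
        inj_on_subset[OF inj(2) interior_subset]] .
  moreover have "h' ` interior D \<subseteq> cball 0 1" using interior_subset[of D] hD(2) by blast
  ultimately have 2: "h' ` interior D \<subseteq> ball 0 1"
    by (metis interior_cball interior_maximal)
  have 3: "interior D \<subseteq> h ` ball 0 1"
  proof
    fix x assume x: "x \<in> interior D"
    then have "h (h' x) = x" using homeomorphism_apply2[OF h] interior_subset by blast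
    then show "x \<in> h ` ball 0 1" using 2 x by (metis image_subset_iff imageI)
  qed
  show *: "interior D = h ` ball 0 1" using 1 3 by (rule subset_antisym[rotated])
  have "closed D"
    using compact_continuous_image[OF cont(1) compact_cball] hD(1) compact_imp_closed by metis
  then have "frontier D = h ` cball 0 1 - h ` ball 0 1"
    using * hD by (simp add: frontier_def)
  also have "\<dots> = h ` (cball 0 1 - ball 0 1)"
    using inj(1) bs by (metis inj_on_image_set_diff order_refl subset_refl Diff_subset)
  also have "cball 0 1 - ball 0 1 = (sphere 0 1 :: complex set)" by auto
  finally show "frontier D = h ` sphere 0 1" .
qed

text \<open>In the model, a small ball meets the open disk in a convex set, and adding any points of
  the bounding circle inside the ball stays within its closure. Hence one neighbourhood
  \<open>V\<close> serves all \<open>E\<close> at once.\<close>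

lemma disk_locally_connected_off_frontier:
  fixes D :: "complex set" and h h' :: "complex \<Rightarrow> complex"
  assumes h: "homeomorphism (cball 0 1) D h h'"
    and x: "x \<in> D" "open N" "x \<in> N"
  shows "\<exists>V. open V \<and> x \<in> V \<and> V \<subseteq> N \<and> (\<forall>E. E \<subseteq> frontier D \<longrightarrow> connected (D \<inter> V - E))"
proof -
  have hD: "h ` cball 0 1 = D" "h' ` D = cball 0 1"
    and cont: "continuous_on (cball 0 1) h" "continuous_on D h'"
    using h by (auto simp: homeomorphism_def)
  define y where "y = h' x"
  have y: "y \<in> cball 0 1" "h y = x"
    using hD x(1) homeomorphism_apply2[OF h x(1)] by (auto simp: y_def)
  have "openin (top_of_set (cball 0 1)) (cball 0 1 \<inter> h -` N)"
    using continuous_openin_preimage_gen[OF cont(1) x(2)] .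
  then obtain d where d: "d > 0" "ball y d \<inter> cball 0 1 \<subseteq> cball 0 1 \<inter> h -` N"
    unfolding openin_contains_ball using y x(3) by (metis IntI vimageI)
  have "openin (top_of_set D) (D \<inter> h' -` ball y d)"
    using continuous_openin_preimage_gen[OF cont(2) open_ball] .
  then obtain V1 where V1: "open V1" "D \<inter> h' -` ball y d = D \<inter> V1" unfolding openin_open by blast
  define V where "V = V1 \<inter> N"
  have DV: "D \<inter> V = h ` (ball y d \<inter> cball 0 1)"
  proof
    show "D \<inter> V \<subseteq> h ` (ball y d \<inter> cball 0 1)"
    proof
      fix z assume "z \<in> D \<inter> V"
      then have "z \<in> D" "h' z \<in> ball y d" using V1(2) by (auto simp: V_def)
      moreover have "h (h' z) = z" using homeomorphism_apply2[OF h \<open>z \<in> D\<close>] .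
      moreover have "h' z \<in> cball 0 1" using hD(2) \<open>z \<in> D\<close> by blast
      ultimately show "z \<in> h ` (ball y d \<inter> cball 0 1)" by (metis IntI imageI)
    qed
    show "h ` (ball y d \<inter> cball 0 1) \<subseteq> D \<inter> V"
    proof (rule image_subsetI)
      fix u assume u: "u \<in> ball y d \<inter> cball 0 1"
      then have "h u \<in> D" using hD(1) by blast
      moreover have "h' (h u) \<in> ball y d" using homeomorphism_apply1[OF h] u by auto
      moreover have "h u \<in> N" using d(2) u by blast
      ultimately show "h u \<in> D \<inter> V" using V1(2) by (auto simp: V_def)
    qed
  qed
  have "connected (D \<inter> V - E)" if E: "E \<subseteq> frontier D" for E
  proof -
    define S where "S = ball y d \<inter> ball 0 1"
    define T where "T = {u \<in> ball y d \<inter> cball 0 1. h u \<notin> E}"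
    have "connected S" unfolding S_def by (intro convex_connected convex_Int convex_ball)
    moreover have "S \<subseteq> T"
    proof
      fix u assume u: "u \<in> S"
      then have "h u \<in> interior D" using homeomorphic_disk_interior_frontier(1)[OF h] by (auto simp: S_def)
      then have "h u \<notin> E" using E by (auto simp: frontier_def)
      then show "u \<in> T" using u by (auto simp: S_def T_def)
    qed
    moreover have "T \<subseteq> closure S"
    proof -
      have "T \<subseteq> ball y d \<inter> closure (ball 0 1)" by (auto simp: T_def)
      also have "\<dots> \<subseteq> closure S" unfolding S_def by (rule open_Int_closure_subset) simp
      finally show ?thesis .
    qed
    ultimately have "connected T" by (rule connected_intermediate_closure)
    then have "connected (h ` T)"
      by (rule connected_continuous_image[rotated]) (rule continuous_on_subset[OF cont(1)], auto simp: T_def)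
    moreover have "h ` T = D \<inter> V - E" unfolding DV T_def by auto
    ultimately show ?thesis by simp
  qed
  moreover have "x \<in> V"
  proof -
    have "x \<in> D \<inter> h' -` ball y d" using x d(1) by (simp add: y_def)
    then show ?thesis using V1(2) x(3) by (auto simp: V_def)
  qed
  moreover have "open V" "V \<subseteq> N" using V1(1) x(2) by (auto simp: V_def)
  ultimately show ?thesis by blast
qed

section \<open>Recognising an arc among connected one-manifolds with two ends\<close>

text \<open>In the local coordinate the arc is a continuous injection of an open interval into the
  line, so its image is open by invariance of domain.\<close>

lemma arc_covers_nbhd_interior:
  fixes L :: "complex set" and r :: real
  assumes g: "arc g" "path_image g \<subseteq> L" and t: "0 < t" "t < 1"
    and T: "openin (top_of_set L) T" "g t \<in> T" and \<eta>: "homeomorphism T {-r<..<r} \<eta> \<eta>'" 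
  shows "\<exists>V. openin (top_of_set L) V \<and> g t \<in> V \<and> V \<subseteq> path_image g"
proof -
  have cg: "continuous_on {0..1} g" and ig: "inj_on g {0..1}" using g(1) by (auto simp: arc_def path_def)
  have gL: "g ` {0..1} \<subseteq> L" using g(2) by (simp add: path_image_def)
  have c\<eta>: "continuous_on T \<eta>" using \<eta> by (simp add: homeomorphism_def)
  have "openin (top_of_set {0..1}) ({0..1} \<inter> g -` T)"
    using continuous_openin_preimage[OF cg _ T(1)] gL by blast
  then obtain O1 where "open O1 \<and> {0..1} \<inter> g -` T = {0..1} \<inter> O1" unfolding openin_open ..
  then have O1: "open O1" "{0..1} \<inter> g -` T = {0..1} \<inter> O1" by simp_all
  define I where "I = {0<..<1} \<inter> O1"
  have I: "open I" "t \<in> I" "I \<subseteq> {0..1}" "g ` I \<subseteq> T"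
  proof -
    show "open I" "I \<subseteq> {0..1}" using O1(1) by (auto simp: I_def)
    have "t \<in> {0..1} \<inter> g -` T" using t T(2) by simp
    then show "t \<in> I" using O1(2) t by (simp add: I_def)
    have "I \<subseteq> {0..1} \<inter> O1" by (auto simp: I_def)
    then show "g ` I \<subseteq> T" unfolding O1(2)[symmetric] by blast
  qed
  have "continuous_on I (\<eta> \<circ> g)"
    using continuous_on_compose[OF continuous_on_subset[OF cg I(3)] continuous_on_subset[OF c\<eta> I(4)]] .
  moreover have "inj_on (\<eta> \<circ> g) I"
  proof (rule comp_inj_on)
    show "inj_on g I" using ig I(3) by (rule inj_on_subset)
    show "inj_on \<eta> (g ` I)" by (rule inj_onI) (metis I(4) \<eta> homeomorphism_apply1 subsetD)
  qed
  ultimately have J: "open ((\<eta> \<circ> g) ` I)" using I(1) invariance_of_domain by blast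
  define V where "V = T \<inter> \<eta> -` ((\<eta> \<circ> g) ` I)"
  have "openin (top_of_set T) V" unfolding V_def by (rule continuous_openin_preimage_gen[OF c\<eta> J])
  then have "openin (top_of_set L) V" using T(1) by (rule openin_trans)
  moreover have "g t \<in> V" using T(2) I(2) by (auto simp: V_def)
  moreover have "V \<subseteq> path_image g"
  proof
    fix v assume "v \<in> V"
    then obtain s where s: "v \<in> T" "s \<in> I" "\<eta> v = \<eta> (g s)" by (auto simp: V_def)
    then have "v = g s" using homeomorphism_apply1[OF \<eta>] I(4) by (metis image_subset_iff)
    then show "v \<in> path_image g" using s I(3) by (auto simp: path_image_def)
  qed
  ultimately show ?thesis by blast
qed

text \<open>At an end the coordinate interval is half-open, so invariance of domain does not apply.
  Instead, the arc starts at coordinate 0 and reaches some \<open>m > 0\<close>, so by intermediate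
  values it covers all coordinates below \<open>m\<close>.\<close>

lemma arc_covers_nbhd_start:
  fixes L :: "complex set" and r :: real
  assumes g: "arc g" "path_image g \<subseteq> L"
    and T: "openin (top_of_set L) T" "pathstart g \<in> T"
    and \<eta>: "homeomorphism T {0..<r} \<eta> \<eta>'" and \<eta>0: "\<eta> (pathstart g) = 0"
  shows "\<exists>V. openin (top_of_set L) V \<and> pathstart g \<in> V \<and> V \<subseteq> path_image g"
proof -
  have cg: "continuous_on {0..1} g" and ig: "inj_on g {0..1}" using g(1) by (auto simp: arc_def path_def)
  have gL: "g ` {0..1} \<subseteq> L" using g(2) by (simp add: path_image_def)
  have c\<eta>: "continuous_on T \<eta>" using \<eta> by (simp add: homeomorphism_def)
  have g0: "g 0 \<in> T" "\<eta> (g 0) = 0" using T(2) \<eta>0 by (auto simp: pathstart_def)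
  have "openin (top_of_set {0..1}) ({0..1} \<inter> g -` T)"
    using continuous_openin_preimage[OF cg _ T(1)] gL by blast
  then obtain d where d: "d > 0" "ball 0 d \<inter> {0..1} \<subseteq> {0..1} \<inter> g -` T"
    unfolding openin_contains_ball using g0(1) by force
  define e where "e = min (d/2) 1"
  have e: "e > 0" "e \<le> 1" "e < d" using d(1) by (auto simp: e_def)
  have sub: "{0..e} \<subseteq> {0..1}" using e by auto
  have gT: "g ` {0..e} \<subseteq> T"
  proof (rule image_subsetI)
    fix s assume "s \<in> {0..e}"
    then have "s \<in> ball 0 d \<inter> {0..1}" using e by (auto simp: dist_real_def)
    then show "g s \<in> T" using d(2) by blast
  qed
  define m where "m = \<eta> (g e)"
  have "g e \<in> T" using gT e by auto
  then have "m \<in> {0..<r}" using homeomorphism_image1[OF \<eta>] unfolding m_def by blast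
  then have m0: "m \<ge> 0" by simp
  have "m \<noteq> 0"
  proof
    assume "m = 0"
    then have "g e = g 0"
      using homeomorphism_apply1[OF \<eta> g0(1)] homeomorphism_apply1[OF \<eta> \<open>g e \<in> T\<close>] g0(2) unfolding m_def by simp
    then have "e = 0" using inj_onD[OF ig, of e 0] e by simp
    then show False using e by simp
  qed
  then have m: "m > 0" using m0 by simp
  have con: "connected (\<eta> ` g ` {0..e})"
    by (intro connected_continuous_image continuous_on_subset[OF c\<eta> gT] continuous_on_subset[OF cg sub]) simp
  define V where "V = T \<inter> \<eta> -` {..<m}"
  have "openin (top_of_set T) V" unfolding V_def by (rule continuous_openin_preimage_gen[OF c\<eta>]) simp
  then have "openin (top_of_set L) V" using T(1) by (rule openin_trans)
  moreover have "pathstart g \<in> V" using T(2) \<eta>0 m by (auto simp: V_def)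
  moreover have "V \<subseteq> path_image g"
  proof
    fix v assume "v \<in> V"
    then have v: "v \<in> T" "\<eta> v < m" by (auto simp: V_def)
    have "\<eta> v \<in> {0..<r}" using homeomorphism_image1[OF \<eta>] v(1) by blast
    then have 1: "0 \<le> \<eta> v" by simp
    have 2: "0 \<in> \<eta> ` g ` {0..e}" using g0(2) e by (metis atLeastAtMost_iff imageI less_imp_le order_refl)
    have 3: "m \<in> \<eta> ` g ` {0..e}" unfolding m_def using e by auto
    have "\<eta> v \<in> \<eta> ` g ` {0..e}" by (rule connectedD_interval[OF con 2 3 1 less_imp_le[OF v(2)]])
    then obtain s where s: "s \<in> {0..e}" "\<eta> v = \<eta> (g s)" by auto
    then have "v = g s" using homeomorphism_apply1[OF \<eta>] gT v(1) by (metis image_subset_iff)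
    then show "v \<in> path_image g" using s sub by (auto simp: path_image_def)
  qed
  ultimately show ?thesis by blast
qed

text \<open>The charts make \<open>L\<close> locally path connected, so some arc in \<open>L\<close>
  joins \<open>p\<close> to \<open>q\<close>. Its image is compact, and it is open in
  \<open>L\<close> by the two preceding lemmas; connectedness of \<open>L\<close> leaves no room for
  anything else.\<close>

lemma connected_one_manifold_with_ends_is_arc:
  fixes L :: "complex set"
  assumes L: "connected L" and pq: "p \<in> L" "q \<in> L" "p \<noteq> q"
    and int: "\<And>x. \<lbrakk>x \<in> L; x \<noteq> p; x \<noteq> q\<rbrakk> \<Longrightarrow> \<exists>T r \<eta> \<eta>'. openin (top_of_set L) T \<and> x \<in> T \<and>
       homeomorphism T {-r<..<r::real} \<eta> \<eta>'"
    and ends: "\<And>x. \<lbrakk>x = p \<or> x = q\<rbrakk> \<Longrightarrow> \<exists>T r \<eta> \<eta>'. openin (top_of_set L) T \<and> x \<in> T \<and>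
       homeomorphism T {0..<r::real} \<eta> \<eta>' \<and> \<eta> x = 0"
  shows "\<exists>g. arc g \<and> pathstart g = p \<and> pathfinish g = q \<and> path_image g = L"
proof -
  have loc: "\<exists>T. openin (top_of_set L) T \<and> x \<in> T \<and> path_connected T" if x: "x \<in> L" for x
  proof -
    have "\<exists>T I \<eta> \<eta>'. openin (top_of_set L) T \<and> x \<in> T \<and> homeomorphism T (I::real set) \<eta> \<eta>' \<and> convex I"
    proof (cases "x = p \<or> x = q")
      case True
      then show ?thesis using ends[OF True] convex_real_interval by metis
    next
      case False
      then show ?thesis using int[OF x] convex_real_interval by metis
    qed
    then obtain T I \<eta> \<eta>' where T: "openin (top_of_set L) T" "x \<in> T" "homeomorphism T (I::real set) \<eta> \<eta>'" "convex I"
      by blast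
    have "path_connected (\<eta>' ` I)"
      using T(3,4) by (intro path_connected_continuous_image convex_imp_path_connected) (auto simp: homeomorphism_def)
    then show ?thesis using T homeomorphism_image2[OF T(3)] by metis
  qed
  have "path_component L p q"
  proof (rule connected_equivalence_relation[OF L pq(1,2), of "path_component L"])
    show "\<exists>T. openin (top_of_set L) T \<and> a \<in> T \<and> (\<forall>x\<in>T. path_component L a x)" if a: "a \<in> L" for a
    proof -
      obtain T where T: "openin (top_of_set L) T" "a \<in> T" "path_connected T" using loc[OF a] by blast
      have "path_component L a x" if "x \<in> T" for x
        using path_component_of_subset[OF openin_imp_subset[OF T(1)]] T that
        unfolding path_connected_component by blast
      then show ?thesis using T by blast
    qed
  qed (auto intro: path_component_sym path_component_trans)
  then obtain p0 where p0: "path p0" "path_image p0 \<subseteq> L" "pathstart p0 = p" "pathfinish p0 = q"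
    unfolding path_component_def by blast
  then obtain g where g0: "arc g" "path_image g \<subseteq> path_image p0" and g1: "pathstart g = p" "pathfinish g = q"
    using path_contains_arc[OF p0(1,3,4) pq(3)] by metis
  have g: "arc g" "path_image g \<subseteq> L" using g0 p0 by auto
  have "\<exists>V. openin (top_of_set L) V \<and> x \<in> V \<and> V \<subseteq> path_image g" if x: "x \<in> path_image g" for x
  proof -
    consider "x = p" | "x = q" | "x \<noteq> p" "x \<noteq> q" by blast
    then show ?thesis
    proof cases
      case 1
      then show ?thesis using ends[of p] arc_covers_nbhd_start[OF g] g1(1) by metis
    next
      case 2
      have r: "arc (reversepath g)" "path_image (reversepath g) \<subseteq> L" "pathstart (reversepath g) = q"
        using g g1 by (auto simp: arc_reversepath)
      show ?thesis using 2 ends[of q] arc_covers_nbhd_start[OF r(1,2)] r(3) by (metis path_image_reversepath)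
    next
      case 3
      obtain t where t: "t \<in> {0..1}" "x = g t" using x by (auto simp: path_image_def)
      then have "0 < t" "t < 1" using 3 g1 by (auto simp: pathstart_def pathfinish_def less_eq_real_def)
      obtain T r \<eta> \<eta>' where "openin (top_of_set L) T" "x \<in> T" "homeomorphism T {-r<..<r::real} \<eta> \<eta>'"
        using int[OF _ 3] x g(2) by blast
      then show ?thesis using arc_covers_nbhd_interior[OF g \<open>0 < t\<close> \<open>t < 1\<close>] t(2) by blast
    qed
  qed
  then have "openin (top_of_set L) (path_image g)"
    by (subst openin_subopen) blast
  moreover have "closedin (top_of_set L) (path_image g)"
    using closed_path_image[OF arc_imp_path[OF g(1)]] g(2) by (rule closed_subset[rotated])
  ultimately have "path_image g = {} \<or> path_image g = L"
    using L unfolding connected_clopen by blast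
  then show ?thesis using g(1) g1 by auto
qed

text \<open>The chart in the definition may be large; restricting it to the preimage of a smaller
  ball brings it inside any given neighbourhood.\<close>

lemma regular_point_chart:
  assumes p: "regular_point W f p" and N: "open N" "p \<in> N"
  shows "\<exists>U r \<phi> \<phi>'. open U \<and> p \<in> U \<and> U \<subseteq> W \<inter> N \<and> r > 0 \<and> homeomorphism U (ball 0 r) \<phi> \<phi>' \<and> \<phi> p = 0 \<and>
     (\<forall>w\<in>ball 0 r. f (\<phi>' w) = Re w + f p)"
proof -
  obtain U r \<phi> \<phi>' where U: "open U" "p \<in> U" "U \<subseteq> W" "r > 0" "homeomorphism U (ball 0 r) \<phi> \<phi>'" "\<phi> p = 0"
    "\<And>z. z\<in>ball 0 r \<Longrightarrow> f (\<phi>' z) = Re z + f p"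
    using p unfolding regular_point_def by blast
  have c: "continuous_on U \<phi>" "continuous_on (ball 0 r) \<phi>'" "\<phi>' ` ball 0 r = U"
    using U(5) by (auto simp: homeomorphism_def)
  have p0: "\<phi>' 0 = p" using homeomorphism_apply1[OF U(5,2)] U(6) by simp
  have "open (ball 0 r \<inter> \<phi>' -` N)" using continuous_open_preimage[OF c(2) open_ball N(1)] .
  moreover have "0 \<in> ball 0 r \<inter> \<phi>' -` N" using p0 N U(4) by simp
  ultimately obtain s where s: "s > 0" "ball 0 s \<subseteq> ball 0 r \<inter> \<phi>' -` N" by (meson openE)
  define U' where "U' = U \<inter> \<phi> -` ball 0 s"
  have "open U'" unfolding U'_def using continuous_open_preimage[OF c(1) U(1) open_ball] .
  have e: "\<phi>' ` ball 0 s = U'"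
  proof
    show "\<phi>' ` ball 0 s \<subseteq> U'"
      using s(2) c(3) homeomorphism_apply2[OF U(5)] by (fastforce simp: U'_def)
    show "U' \<subseteq> \<phi>' ` ball 0 s"
      using homeomorphism_apply1[OF U(5)] by (force simp: U'_def image_iff)
  qed
  have "homeomorphism U' (ball 0 s) \<phi> \<phi>'"
  proof (rule homeomorphism_of_subsets[OF U(5)])
    show "U' \<subseteq> U" by (auto simp: U'_def)
    have "ball 0 s \<subseteq> (ball 0 r :: complex set)" using s(2) by blast
    then have "\<phi> ` \<phi>' ` ball 0 s = ball 0 s"
      unfolding image_image using homeomorphism_apply2[OF U(5)] by (simp add: subset_iff)
    then show "\<phi> ` U' = ball 0 s" using e by simp
  qed (use s(2) in auto)
  moreover have "p \<in> U'" using U s(1) by (simp add: U'_def)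
  moreover have "U' \<subseteq> W \<inter> N"
  proof -
    have "\<phi>' ` ball 0 s \<subseteq> N" using s(2) by blast
    then show ?thesis using e U(3) by (auto simp: U'_def)
  qed
  moreover have "\<forall>w\<in>ball 0 s. f (\<phi>' w) = Re w + f p" using U(7) s(2) by blast
  ultimately show ?thesis using \<open>open U'\<close> s(1) U(6) by blast
qed

section \<open>The boundary circle\<close>

locale disk_boundary =
  fixes D :: "complex set" and h h' \<omega> \<omega>' :: "complex \<Rightarrow> complex"
  assumes disk: "homeomorphism (cball 0 1) D h h'"
    and circle: "homeomorphism (sphere 0 1) (frontier D) \<omega> \<omega>'"
begin

text \<open>Parametrising the circle by all real angles turns every positive arc into the image of
  an interval, also when it crosses the starting point of the turn.\<close>

definition bdry :: "real \<Rightarrow> complex" where "bdry t = \<omega> (cis t)"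

lemma compact_disk: "compact D"
  using compact_continuous_image[OF _ compact_cball, of 0 1 h] disk by (metis homeomorphism_def)

lemma closed_disk: "closed D"
  using compact_disk by (rule compact_imp_closed)

lemma frontier_subset_disk: "frontier D \<subseteq> D"
  using closed_disk by (rule frontier_subset_closed)

lemma disk_cases: "x \<in> D \<Longrightarrow> x \<in> interior D \<or> x \<in> frontier D"
  using closed_disk by (simp add: frontier_def)

lemma closure_interior_disk: "closure (interior D) = D"
proof -
  note hi = homeomorphic_disk_interior_frontier[OF disk]
  have hD: "h ` cball 0 1 = D" and c: "continuous_on (cball 0 1) h"
    using disk by (auto simp: homeomorphism_def)
  have "h ` closure (ball 0 1) \<subseteq> closure (h ` ball 0 1)"
    using c by (intro image_closure_subset) (auto simp: closure_subset)
  then have "D \<subseteq> closure (interior D)" using hi(1) hD by simp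
  moreover have "closure (interior D) \<subseteq> D"
    using closed_disk interior_subset by (rule closure_minimal[rotated])
  ultimately show ?thesis by blast
qed

lemma frontier_interior_disk: "frontier (interior D) = frontier D"
  using closure_interior_disk closed_disk by (simp add: frontier_def)

lemma unicoherent_disk: "unicoherent D"
  using disk convex_imp_unicoherent[OF convex_cball[of "0::complex" 1]] homeomorphic_unicoherent
  unfolding homeomorphic_def by blast

lemma bdry_frontier: "bdry t \<in> frontier D"
  using homeomorphism_image1[OF circle] by (auto simp: bdry_def)

lemma continuous_bdry: "continuous_on S bdry"
proof -
  have "continuous_on UNIV (\<omega> \<circ> cis)"
  proof (rule continuous_on_compose)
    show "continuous_on (range cis) \<omega>"
      using homeomorphism_cont1[OF circle] by (rule continuous_on_subset) auto
  qed (intro continuous_intros)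
  moreover have "bdry = \<omega> \<circ> cis" by (auto simp: bdry_def)
  ultimately show ?thesis using continuous_on_subset by (metis subset_UNIV)
qed

lemma bdry_eq_iff: "bdry s = bdry t \<longleftrightarrow> (\<exists>n::int. s = t + 2 * pi * n)"
proof -
  have "bdry s = bdry t \<longleftrightarrow> cis s = cis t"
  proof
    assume "bdry s = bdry t"
    then have "\<omega>' (\<omega> (cis s)) = \<omega>' (\<omega> (cis t))" by (simp add: bdry_def)
    then show "cis s = cis t" using homeomorphism_apply1[OF circle] by simp
  qed (simp add: bdry_def)
  also have "\<dots> \<longleftrightarrow> sin s = sin t \<and> cos s = cos t" by (auto simp: complex_eq_iff)
  finally show ?thesis by (simp add: sin_cos_eq_iff)
qed

lemma bdry_shift: "bdry (t + 2 * pi * of_int n) = bdry t"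
  unfolding bdry_eq_iff by blast

lemma bdry_periodic: "bdry (t + 2 * pi) = bdry t"
  using bdry_shift[of t 1] by simp

lemma bdry_surj:
  assumes "x \<in> frontier D" shows "\<exists>t\<in>{\<alpha>..<\<alpha> + 2 * pi}. bdry t = x"
proof -
  have "\<omega>' x \<in> sphere 0 1" using homeomorphism_image2[OF circle] assms by blast
  then have "cmod (\<omega>' x) = 1" by simp
  then have "cis (Arg (\<omega>' x)) = \<omega>' x" using rcis_cmod_Arg[of "\<omega>' x"] by (simp add: rcis_def)
  then have s: "bdry (Arg (\<omega>' x)) = x" using homeomorphism_apply2[OF circle assms] by (simp add: bdry_def)
  define s where "s = Arg (\<omega>' x)"
  define n where "n = \<lfloor>(s - \<alpha>) / (2 * pi)\<rfloor>"
  define t where "t = s + 2 * pi * of_int (- n)"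
  have "of_int n \<le> (s - \<alpha>) / (2 * pi)" "(s - \<alpha>) / (2 * pi) < of_int n + 1"
    unfolding n_def by linarith+
  then have "of_int n * (2 * pi) \<le> s - \<alpha>" "s - \<alpha> < (of_int n + 1) * (2 * pi)"
    by (simp_all add: pos_le_divide_eq pos_divide_less_eq)
  then have "t \<in> {\<alpha>..<\<alpha> + 2 * pi}" unfolding t_def by (simp add: algebra_simps)
  moreover have "bdry t = x" using s bdry_shift[of s "- n"] unfolding t_def s_def by simp
  ultimately show ?thesis by blast
qed

lemma bdry_eqD: assumes "bdry s = bdry t" "\<bar>s - t\<bar> < 2 * pi" shows "s = t"
proof -
  obtain n :: int where n: "s = t + 2 * pi * n" using assms(1) bdry_eq_iff by blast
  then have "\<bar>real_of_int n\<bar> < 1" using assms(2) by (simp add: abs_mult)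
  then have "n = 0" by linarith
  then show ?thesis using n by simp
qed

lemma inj_on_bdry: "v < u + 2 * pi \<Longrightarrow> inj_on bdry {u..v}"
  by (intro inj_onI bdry_eqD) auto

text \<open>Other admissible representatives of the two end angles differ from \<open>s\<close> and
  \<open>t\<close> by one common multiple of \<open>2 * pi\<close>, because both gaps are less than
  a full turn.\<close>

lemma positive_arc_bdry:
  assumes "s \<le> t" "t < s + 2 * pi"
  shows "positive_arc \<omega> (bdry s) (bdry t) = bdry ` {s..t}"
proof
  show "bdry ` {s..t} \<subseteq> positive_arc \<omega> (bdry s) (bdry t)"
  proof (rule image_subsetI)
    fix u assume "u \<in> {s..t}"
    then show "bdry u \<in> positive_arc \<omega> (bdry s) (bdry t)"
      unfolding positive_arc_def bdry_def using assms
      by (intro CollectI exI[of _ u] exI[of _ s] exI[of _ t]) auto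
  qed
  show "positive_arc \<omega> (bdry s) (bdry t) \<subseteq> bdry ` {s..t}"
  proof
    fix x assume "x \<in> positive_arc \<omega> (bdry s) (bdry t)"
    then obtain u s' t' where x: "x = bdry u" "bdry s' = bdry s" "bdry t' = bdry t"
      "s' \<le> u" "u \<le> t'" "t' < s' + 2 * pi"
      unfolding positive_arc_def bdry_def by blast
    obtain n :: int where n: "s' = s + 2 * pi * n" using x(2) bdry_eq_iff by blast
    have "bdry (t' - 2 * pi * n) = bdry t"
      using x(3) bdry_shift[of t' "- n"] by simp
    then have "t' - 2 * pi * n = t"
      by (rule bdry_eqD) (use x n assms in \<open>simp add: abs_less_iff\<close>)
    then have "u - 2 * pi * n \<in> {s..t}" using x n by auto
    moreover have "bdry (u - 2 * pi * n) = x"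
      using x(1) bdry_shift[of u "- n"] by simp
    ultimately show "x \<in> bdry ` {s..t}" by blast
  qed
qed

lemma open_positive_arc_bdry:
  assumes "s \<le> t" "t < s + 2 * pi"
  shows "open_positive_arc \<omega> (bdry s) (bdry t) = bdry ` {s<..<t}"
proof -
  have "x \<in> bdry ` {s..t} \<Longrightarrow> x \<noteq> bdry s \<Longrightarrow> x \<noteq> bdry t \<Longrightarrow> x \<in> bdry ` {s<..<t}" for x
    by (auto simp: less_eq_real_def)
  moreover have "bdry u \<noteq> bdry s" "bdry u \<noteq> bdry t" if "u \<in> {s<..<t}" for u
    using bdry_eqD[of u s] bdry_eqD[of u t] that assms by auto
  ultimately show ?thesis
    unfolding open_positive_arc_def positive_arc_bdry[OF assms] by fastforce
qed

text \<open>\<open>bdry\<close> is not injective on the line, so closeness of points is turned into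
  closeness of suitable angles by deleting the compact complementary arc.\<close>

lemma bdry_local:
  assumes "\<delta> > 0"
  shows "\<exists>N. open N \<and> bdry t0 \<in> N \<and> (\<forall>y\<in>frontier D \<inter> N. \<exists>t. \<bar>t - t0\<bar> < \<delta> \<and> bdry t = y)"
proof -
  \<comment> \<open>\<open>d \<le> pi\<close> makes the interval defining \<open>K\<close> nonempty,
    so that its upper end, the other representative of \<open>t0 - d\<close>, belongs to it.\<close>
  define d where "d = min \<delta> pi"
  have d: "d > 0" "d \<le> \<delta>" "d \<le> pi" using assms pi_gt_zero by (auto simp: d_def)
  define K where "K = bdry ` {t0 + d..t0 + 2 * pi - d}"
  have "compact K" unfolding K_def by (intro compact_continuous_image continuous_bdry compact_Icc)
  then have "open (- K)" using compact_imp_closed by blast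
  moreover have "bdry t0 \<in> - K"
  proof -
    have "bdry t \<noteq> bdry t0" if "t \<in> {t0 + d..t0 + 2 * pi - d}" for t
      using bdry_eqD[of t t0] that d by auto
    then have "bdry t0 \<notin> K" unfolding K_def by (metis imageE)
    then show ?thesis by simp
  qed
  moreover have "\<exists>t. \<bar>t - t0\<bar> < \<delta> \<and> bdry t = y" if y: "y \<in> frontier D \<inter> - K" for y
  proof -
    obtain t where t: "t \<in> {t0 - d..<t0 - d + 2 * pi}" "bdry t = y" using bdry_surj y by blast
    have "t \<notin> {t0 + d..t0 + 2 * pi - d}" using t y by (auto simp: K_def)
    then have "t < t0 + d" using t by auto
    moreover have "t \<noteq> t0 - d"
    proof
      assume "t = t0 - d"
      then have "y = bdry (t0 - d)" using t(2) by simp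
      also have "\<dots> = bdry (t0 + 2 * pi - d)" using bdry_periodic[of "t0 - d"] by (simp add: algebra_simps)
      finally show False using y d by (auto simp: K_def)
    qed
    ultimately show ?thesis using t d by (intro exI[of _ t]) auto
  qed
  ultimately show ?thesis by blast
qed

end

section \<open>Criteria for connected sublevel sets and for injectivity on an interval\<close>

text \<open>Each component of the sublevel set is compact, so \<open>f\<close> has a minimum
  \<open>p\<close> on it. By \<open>desc\<close> a connected set through \<open>p\<close> either
  goes lower, which is impossible inside the component, or reaches \<open>E\<close>. Thus every
  component meets the connected set \<open>E\<close>.\<close>

lemma sublevel_connected:
  fixes f :: "complex \<Rightarrow> real"
  assumes D: "compact D" "continuous_on D f"
    and E: "connected E" "E \<subseteq> {x \<in> D. f x \<le> c}" "e0 \<in> E"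
    and desc: "\<And>p. \<lbrakk>p \<in> D; f p \<le> c\<rbrakk> \<Longrightarrow>
      \<exists>K. connected K \<and> p \<in> K \<and> K \<subseteq> {x \<in> D. f x \<le> f p} \<and> (K \<inter> E \<noteq> {} \<or> (\<exists>u\<in>K. f u < f p))"
  shows "connected {x \<in> D. f x \<le> c}"
proof -
  define A where "A = {x \<in> D. f x \<le> c}"
  have "closed A" unfolding A_def
    using continuous_closed_preimage[OF D(2) compact_imp_closed[OF D(1)], of "{..c}"]
    by (simp add: vimage_def Int_def)
  then have cA: "compact A" using D(1) compact_Int_closed[of D A] by (metis A_def Int_absorb1 inf_commute mem_Collect_eq subsetI)
  have "connected_component A x e0" if x: "x \<in> A" for x
  proof -
    define C where "C = connected_component_set A x"
    have "x \<in> C" using x by (simp add: C_def connected_component_refl)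
    have CA: "C \<subseteq> A" unfolding C_def by (rule connected_component_subset)
    have "closed C" unfolding C_def using \<open>closed A\<close> by (rule closed_connected_component)
    then have "compact C" using cA CA by (metis compact_Int_closed inf.absorb_iff2)
    moreover have "continuous_on C f" using D(2) CA by (auto intro: continuous_on_subset simp: A_def)
    ultimately obtain p where p: "p \<in> C" "\<And>y. y \<in> C \<Longrightarrow> f p \<le> f y"
      using continuous_attains_inf[of C f] \<open>x \<in> C\<close> by blast
    have pA: "p \<in> D" "f p \<le> c" using p(1) CA by (auto simp: A_def)
    obtain K where K: "connected K" "p \<in> K" "K \<subseteq> {x \<in> D. f x \<le> f p}" "K \<inter> E \<noteq> {} \<or> (\<exists>u\<in>K. f u < f p)"
      using desc[OF pA] by blast
    have KA: "K \<subseteq> A" using K(3) pA(2) by (auto simp: A_def)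
    have xp: "connected_component A x p" using p(1) by (simp add: C_def)
    have *: "connected_component A x u" if "u \<in> K" for u
      using connected_component_trans[OF xp] connected_component_of_subset K(1,2) KA that
      unfolding connected_component_def by blast
    have "\<not> (\<exists>u\<in>K. f u < f p)"
      using * p(2) unfolding C_def by fastforce
    then obtain u where u: "u \<in> K" "u \<in> E" using K(4) by blast
    have "connected_component A u e0" unfolding connected_component_def
      using E u(2) by (intro exI[of _ E]) (auto simp: A_def)
    then show ?thesis using *[OF u(1)] connected_component_trans by blast
  qed
  then have "connected A" unfolding connected_iff_connected_component
    by (meson connected_component_sym connected_component_trans)
  then show ?thesis by (simp add: A_def)
qed

text \<open>As in Rolle's theorem: with equal values at two points, the extrema between them can
  only sit at the ends, so the function is constant there, and then the midpoint is an
  extremum.\<close>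

lemma inj_on_if_no_local_extremum:
  fixes F :: "real \<Rightarrow> real"
  assumes cont: "continuous_on {u..v} F"
    and ext: "\<And>t \<delta>. \<lbrakk>u < t; t < v; \<delta> > 0\<rbrakk> \<Longrightarrow> (\<exists>s. \<bar>s - t\<bar> < \<delta> \<and> F s < F t) \<and> (\<exists>s. \<bar>s - t\<bar> < \<delta> \<and> F t < F s)"
  shows "inj_on F {u..v}"
proof -
  have "F s \<noteq> F t" if st: "s \<in> {u..v}" "t \<in> {u..v}" "s < t" for s t
  proof
    assume eq: "F s = F t"
    have c: "continuous_on {s..t} F" using st by (intro continuous_on_subset[OF cont]) auto
    have ne: "{s..t} \<noteq> {}" using st by simp
    obtain m where m: "m \<in> {s..t}" "\<And>y. y \<in> {s..t} \<Longrightarrow> F m \<le> F y"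
      using continuous_attains_inf[OF compact_Icc ne c] by blast
    obtain M where M: "M \<in> {s..t}" "\<And>y. y \<in> {s..t} \<Longrightarrow> F y \<le> F M"
      using continuous_attains_sup[OF compact_Icc ne c] by blast
    have noint: "\<exists>y\<in>{s..t}. F y < F x" "\<exists>y\<in>{s..t}. F x < F y" if x: "s < x" "x < t" for x
    proof -
      define \<delta> where "\<delta> = min (x - s) (t - x)"
      have \<delta>: "\<delta> > 0" "u < x" "x < v" using x st by (auto simp: \<delta>_def)
      have *: "y \<in> {s..t}" if "\<bar>y - x\<bar> < \<delta>" for y using that x by (auto simp: \<delta>_def)
      show "\<exists>y\<in>{s..t}. F y < F x" "\<exists>y\<in>{s..t}. F x < F y"
        using ext[OF \<delta>(2,3,1)] * by blast+
    qed
    have "m = s \<or> m = t" using noint(1)[of m] m by (metis atLeastAtMost_iff leD less_eq_real_def)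
    moreover have "M = s \<or> M = t" using noint(2)[of M] M by (metis atLeastAtMost_iff leD less_eq_real_def)
    ultimately have "F m = F s" "F M = F s" using eq by auto
    then have "F y = F s" if "y \<in> {s..t}" for y using m(2)[OF that] M(2)[OF that] by simp
    moreover obtain y where "y \<in> {s..t}" "F y < F ((s + t) / 2)" using noint(1)[of "(s+t)/2"] st by auto
    moreover have "(s + t) / 2 \<in> {s..t}" using st by auto
    ultimately show False by (metis less_irrefl)
  qed
  then show ?thesis by (metis inj_onI linorder_less_linear)
qed

section \<open>Level sets of regular functions\<close>

text \<open>The marked points are replaced by angles within one turn. Density of the points with
  trajectories is expressed by parameter intervals, the form in which a trajectory can be found
  between two given points of an even arc.\<close>

locale regular_disk = disk_boundary +
  fixes f :: "complex \<Rightarrow> real" and t1 t2 t3 t4 :: real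
  assumes cont: "continuous_on D f"
    and order: "t1 < t2" "t2 \<le> t3" "t3 < t4" "t4 \<le> t1 + 2 * pi"
    and interior_regular: "w \<in> interior D \<Longrightarrow> regular_point (interior D) f w"
    and boundary_regular: "t \<in> {t1<..<t2} \<union> {t3<..<t4} \<Longrightarrow> regular_boundary_point (interior D) f (bdry t)"
    and const_ends: "t \<in> {t2..t3} \<Longrightarrow> f (bdry t) = f (bdry t2)"
      "t \<in> {t4..t1 + 2 * pi} \<Longrightarrow> f (bdry t) = f (bdry t1)"
    and trajectories: "\<lbrakk>t2 \<le> u \<and> v \<le> t3 \<or> t4 \<le> u \<and> v \<le> t1 + 2 * pi; u < v\<rbrakk> \<Longrightarrow>
      \<exists>t\<in>{u<..<v}. \<exists>\<gamma>. U_trajectory D f \<gamma> \<and> bdry t \<in> path_image \<gamma>"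
begin

text \<open>Renumbering the arcs by two steps exchanges the two odd arcs; this later allows the
  assumption that \<open>f\<close> increases along the first one.\<close>

lemma rotate: "regular_disk D h h' \<omega> \<omega>' f t3 t4 (t1 + 2 * pi) (t2 + 2 * pi)"
proof
  show "t3 < t4" "t4 \<le> t1 + 2 * pi" "t1 + 2 * pi < t2 + 2 * pi" "t2 + 2 * pi \<le> t3 + 2 * pi"
    using order by simp_all
  show "regular_boundary_point (interior D) f (bdry t)"
    if t: "t \<in> {t3<..<t4} \<union> {t1 + 2 * pi<..<t2 + 2 * pi}" for t
  proof (cases "t \<in> {t3<..<t4}")
    case True
    then show ?thesis using boundary_regular by blast
  next
    case False
    then have "t - 2 * pi \<in> {t1<..<t2}" using t by auto
    then show ?thesis using boundary_regular[of "t - 2 * pi"] bdry_periodic[of "t - 2 * pi"] by simp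
  qed
  have c1: "f (bdry t4) = f (bdry t1)" using const_ends(2)[of t4] order by simp
  have c2: "f (bdry t3) = f (bdry t2)" using const_ends(1)[of t3] order by simp
  show "f (bdry t) = f (bdry t4)" if "t \<in> {t4..t1 + 2 * pi}" for t
    using const_ends(2)[OF that] c1 by simp
  show "f (bdry t) = f (bdry t3)" if "t \<in> {t2 + 2 * pi..t3 + 2 * pi}" for t
    using const_ends(1)[of "t - 2 * pi"] that c2 bdry_periodic[of "t - 2 * pi"] by simp
  show "\<exists>t\<in>{u<..<v}. \<exists>\<gamma>. U_trajectory D f \<gamma> \<and> bdry t \<in> path_image \<gamma>"
    if uv: "t4 \<le> u \<and> v \<le> t1 + 2 * pi \<or> t2 + 2 * pi \<le> u \<and> v \<le> t3 + 2 * pi" "u < v" for u v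
  proof (cases "t4 \<le> u \<and> v \<le> t1 + 2 * pi")
    case True
    then show ?thesis using trajectories uv(2) by blast
  next
    case False
    then obtain t \<gamma> where "t \<in> {u - 2 * pi<..<v - 2 * pi}" "U_trajectory D f \<gamma>" "bdry t \<in> path_image \<gamma>"
      using trajectories[of "u - 2 * pi" "v - 2 * pi"] uv by auto
    then show ?thesis using bdry_periodic[of t] by (intro bexI[of _ "t + 2 * pi"]) auto
  qed
  show "regular_point (interior D) f w" if "w \<in> interior D" for w
    using interior_regular[OF that] .
  show "continuous_on D f" by (rule cont)
qed

abbreviation F :: "real \<Rightarrow> real" where "F t \<equiv> f (bdry t)"

lemma F4: "F t4 = F t1" and F3: "F t3 = F t2"
  using const_ends(2)[of t4] const_ends(1)[of t3] order by simp_all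

lemma continuous_F: "continuous_on S F"
  using continuous_on_compose[OF continuous_bdry, of S f] continuous_on_subset[OF cont, of "bdry ` S"]
    bdry_frontier frontier_subset_disk by (auto simp: o_def)

lemma boundary_chart:
  assumes t: "t \<in> {t1<..<t2} \<union> {t3<..<t4}"
  shows "\<exists>U \<psi> \<psi>'. openin (top_of_set D) U \<and> bdry t \<in> U \<and>
        homeomorphism U upper_half_disk \<psi> \<psi>' \<and> \<psi> (bdry t) = 0 \<and>
        \<psi> ` {z \<in> U. f z = F t} = {z. Re z = 0 \<and> Im z \<in> {0..<1}} \<and>
        \<psi> ` (U \<inter> frontier D) = {z. Re z \<in> {-1<..<1} \<and> Im z = 0} \<and>
        (strict_mono_on {-1<..<1} (\<lambda>t. f (\<psi>' (complex_of_real t))) \<or>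
         strict_antimono_on {-1<..<1} (\<lambda>t. f (\<psi>' (complex_of_real t))))"
  using boundary_regular[OF t] unfolding regular_boundary_point_def closure_interior_disk frontier_interior_disk
  by (rule conjunct2)

text \<open>In a boundary chart \<open>f\<close> is strictly monotone along the real axis. Its
  values at \<open>u\<close> and \<open>- u\<close> lie on opposite sides of the value at 0, and
  \<open>bdry_local\<close> converts these points into angles near \<open>t\<close>.\<close>

lemma no_boundary_extremum:
  assumes t: "t \<in> {t1<..<t2} \<union> {t3<..<t4}" and "\<delta> > 0"
  shows "(\<exists>s. \<bar>s - t\<bar> < \<delta> \<and> F s < F t) \<and> (\<exists>s. \<bar>s - t\<bar> < \<delta> \<and> F t < F s)"
proof -
  obtain N where N: "open N" "bdry t \<in> N" "\<forall>y\<in>frontier D \<inter> N. \<exists>s. \<bar>s - t\<bar> < \<delta> \<and> bdry s = y"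
    using bdry_local[OF \<open>\<delta> > 0\<close>, of t] by (elim exE conjE) (rule that)
  obtain U \<psi> \<psi>' where U: "openin (top_of_set D) U" "bdry t \<in> U" "homeomorphism U upper_half_disk \<psi> \<psi>'"
    "\<psi> (bdry t) = 0" "\<psi> ` {z \<in> U. f z = F t} = {z. Re z = 0 \<and> Im z \<in> {0..<1}}"
    "\<psi> ` (U \<inter> frontier D) = {z. Re z \<in> {-1<..<1} \<and> Im z = 0}"
    and mono: "strict_mono_on {-1<..<1} (\<lambda>t. f (\<psi>' (complex_of_real t))) \<or>
         strict_antimono_on {-1<..<1} (\<lambda>t. f (\<psi>' (complex_of_real t)))"
    using boundary_chart[OF t] by (elim exE conjE) (rule that)
  have c\<psi>': "continuous_on upper_half_disk \<psi>'" using U(3) by (simp add: homeomorphism_def)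
  have p0: "\<psi>' 0 = bdry t" using homeomorphism_apply1[OF U(3,2)] U(4) by simp
  have uhd: "complex_of_real u \<in> upper_half_disk" if "u \<in> {-1<..<1}" for u
    using that by (auto simp: upper_half_disk_def)
  have fr: "\<psi>' (complex_of_real u) \<in> frontier D" if u: "u \<in> {-1<..<1}" for u
  proof -
    have "complex_of_real u \<in> \<psi> ` (U \<inter> frontier D)" unfolding U(6) using u by simp
    then obtain x where "x \<in> U \<inter> frontier D" "complex_of_real u = \<psi> x" by blast
    then show ?thesis using homeomorphism_apply1[OF U(3)] by simp
  qed
  have "continuous_on {-1<..<1} (\<lambda>u. \<psi>' (complex_of_real u))"
    by (rule continuous_on_compose2[OF c\<psi>']) (use uhd in \<open>auto intro!: continuous_intros\<close>)
  then have "open ({-1<..<1} \<inter> (\<lambda>u. \<psi>' (complex_of_real u)) -` N)"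
    by (rule continuous_open_preimage) (use N in auto)
  moreover have "0 \<in> {-1<..<1::real} \<inter> (\<lambda>u. \<psi>' (complex_of_real u)) -` N" using p0 N by simp
  ultimately obtain d where d: "d > 0" "ball 0 d \<subseteq> {-1<..<1} \<inter> (\<lambda>u. \<psi>' (complex_of_real u)) -` N"
    by (meson openE)
  define u where "u = d / 2"
  have u: "u > 0" "u \<in> ball 0 d" "- u \<in> ball 0 d" using d(1) by (auto simp: u_def)
  have um: "u \<in> {-1<..<1}" "- u \<in> {-1<..<1}" using u d(2) by blast+
  have uN: "\<psi>' (complex_of_real u) \<in> frontier D \<inter> N" "\<psi>' (complex_of_real (- u)) \<in> frontier D \<inter> N"
    using u d(2) fr um by blast+
  obtain s1 where s1: "\<bar>s1 - t\<bar> < \<delta>" "bdry s1 = \<psi>' (complex_of_real u)" using bspec[OF N(3) uN(1)] by (elim exE conjE) (rule that)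
  obtain s2 where s2: "\<bar>s2 - t\<bar> < \<delta>" "bdry s2 = \<psi>' (complex_of_real (- u))" using bspec[OF N(3) uN(2)] by (elim exE conjE) (rule that)
  have "F s1 > F t \<and> F s2 < F t \<or> F s1 < F t \<and> F s2 > F t"
    using mono
  proof
    assume m: "strict_mono_on {-1<..<1} (\<lambda>t. f (\<psi>' (complex_of_real t)))"
    show ?thesis using monotone_onD[OF m, of 0 u] monotone_onD[OF m, of "-u" 0] um u(1) s1(2) s2(2) p0 by simp
  next
    assume m: "strict_antimono_on {-1<..<1} (\<lambda>t. f (\<psi>' (complex_of_real t)))"
    show ?thesis using monotone_onD[OF m, of 0 u] monotone_onD[OF m, of "-u" 0] um u(1) s1(2) s2(2) p0 by simp
  qed
  then show ?thesis using s1(1) s2(1) by blast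
qed

lemma inj_on_F: "inj_on F {t1..t2}" "inj_on F {t3..t4}"
  by (rule inj_on_if_no_local_extremum[OF continuous_F], rule no_boundary_extremum; simp)+

lemma mono_F: "strict_mono_on {t1..t2} F \<or> strict_antimono_on {t1..t2} F"
  "strict_mono_on {t3..t4} F \<or> strict_antimono_on {t3..t4} F"
  using injective_eq_monotone_map[OF is_interval_cc continuous_F] inj_on_F by blast+

lemma interior_chart:
  assumes "p \<in> interior D" "open N" "p \<in> N"
  shows "\<exists>U r \<phi> \<phi>'. open U \<and> p \<in> U \<and> U \<subseteq> interior D \<inter> N \<and> r > 0 \<and> homeomorphism U (ball 0 r) \<phi> \<phi>' \<and> \<phi> p = 0 \<and>
     (\<forall>w\<in>ball 0 r. f (\<phi>' w) = Re w + f p)"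
  by (rule regular_point_chart[OF interior_regular[OF assms(1)] assms(2,3)])

text \<open>In a chart at \<open>p\<close> every level set is a vertical chord of a disk, hence
  convex.\<close>

lemma interior_box:
  assumes "p \<in> interior D" "open N" "p \<in> N"
  shows "\<exists>U. open U \<and> p \<in> U \<and> U \<subseteq> N \<and> (\<forall>c. connected (U \<inter> {x \<in> D. f x = c}))"
proof -
  obtain U r \<phi> \<phi>' where U: "open U" "p \<in> U" "U \<subseteq> interior D \<inter> N" "r > 0" "homeomorphism U (ball 0 r) \<phi> \<phi>'"
    "\<And>w. w\<in>ball 0 r \<Longrightarrow> f (\<phi>' w) = Re w + f p"
    using interior_chart[OF assms] by blast
  have "connected (U \<inter> {x \<in> D. f x = c})" for c
  proof -
    define B where "B = ball 0 r \<inter> {w. Re w = c - f p}"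
    have "convex (Re -` {c - f p})"
      by (intro convex_linear_vimage bounded_linear.linear bounded_linear_Re convex_singleton)
    then have "convex B" unfolding B_def by (intro convex_Int convex_ball) (simp add: vimage_def)
    then have "connected (\<phi>' ` B)"
      using homeomorphism_cont2[OF U(5)]
      by (intro connected_continuous_image convex_connected) (auto simp: B_def intro: continuous_on_subset)
    moreover have "\<phi>' ` B = U \<inter> {x \<in> D. f x = c}"
    proof
      show "\<phi>' ` B \<subseteq> U \<inter> {x \<in> D. f x = c}"
      proof (rule image_subsetI)
        fix w assume "w \<in> B"
        then have w: "w \<in> ball 0 r" "Re w = c - f p" by (auto simp: B_def)
        then have "\<phi>' w \<in> U" using homeomorphism_image2[OF U(5)] by blast
        moreover have "f (\<phi>' w) = c" using U(6)[OF w(1)] w(2) by simp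
        ultimately show "\<phi>' w \<in> U \<inter> {x \<in> D. f x = c}" using U(3) interior_subset by blast
      qed
      show "U \<inter> {x \<in> D. f x = c} \<subseteq> \<phi>' ` B"
      proof
        fix x assume "x \<in> U \<inter> {x \<in> D. f x = c}"
        then have x: "x \<in> U" "f x = c" by auto
        then have "\<phi> x \<in> ball 0 r" "\<phi>' (\<phi> x) = x"
          using homeomorphism_image1[OF U(5)] homeomorphism_apply1[OF U(5)] by blast+
        moreover have "Re (\<phi> x) = c - f p" using U(6)[OF calculation(1)] calculation(2) x by simp
        ultimately show "x \<in> \<phi>' ` B" unfolding B_def by (metis (mono_tags, lifting) IntI imageI mem_Collect_eq)
      qed
    qed
    ultimately show ?thesis by simp
  qed
  then show ?thesis using U(1-3) by blast
qed

text \<open>The half of a chart disk on which \<open>s * Re\<close> is nonnegative is convex,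
  contains the centre and has points of larger \<open>s * f\<close>. The sign \<open>s\<close>
  treats climbing and descending together.\<close>

lemma interior_half_chart:
  fixes s :: real
  assumes p: "p \<in> interior D" and s: "s = 1 \<or> s = -1"
  shows "\<exists>K. connected K \<and> p \<in> K \<and> K \<subseteq> {x \<in> D. s * f p \<le> s * f x} \<and> (\<exists>u\<in>K. s * f p < s * f u)"
proof -
  obtain U r \<phi> \<phi>' where U: "open U" "p \<in> U" "U \<subseteq> interior D \<inter> UNIV" "r > 0" "homeomorphism U (ball 0 r) \<phi> \<phi>'"
    "\<phi> p = 0" "\<And>w. w\<in>ball 0 r \<Longrightarrow> f (\<phi>' w) = Re w + f p"
    using interior_chart[OF p open_UNIV UNIV_I] by blast
  define B where "B = ball 0 r \<inter> {w. 0 \<le> s * Re w}"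
  have "convex {w. 0 \<le> s * Re w}"
    using s convex_halfspace_Re_ge[of 0] convex_halfspace_Re_le[of 0] by auto
  then have "convex B" unfolding B_def by (intro convex_Int convex_ball)
  then have "connected (\<phi>' ` B)"
    using homeomorphism_cont2[OF U(5)]
    by (intro connected_continuous_image convex_connected) (auto simp: B_def intro: continuous_on_subset)
  moreover have "p \<in> \<phi>' ` B"
    using homeomorphism_apply1[OF U(5,2)] U(6,4) by (intro image_eqI[of _ _ 0]) (auto simp: B_def)
  moreover have "\<phi>' ` B \<subseteq> {x \<in> D. s * f p \<le> s * f x}"
  proof (rule image_subsetI)
    fix w assume "w \<in> B"
    then have w: "w \<in> ball 0 r" "0 \<le> s * Re w" by (auto simp: B_def)
    then have "\<phi>' w \<in> U" using homeomorphism_image2[OF U(5)] by blast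
    then have "\<phi>' w \<in> D" using U(3) interior_subset by blast
    then show "\<phi>' w \<in> {x \<in> D. s * f p \<le> s * f x}" using U(7)[OF w(1)] w(2) by (simp add: algebra_simps)
  qed
  moreover have "\<exists>u\<in>\<phi>' ` B. s * f p < s * f u"
  proof (rule bexI[of _ "\<phi>' (complex_of_real (s * (r / 2)))"])
    have b: "complex_of_real (s * (r / 2)) \<in> ball 0 r" using U(4) s by (auto simp: norm_mult)
    have ss: "s * s = 1" using s by auto
    then show "s * f p < s * f (\<phi>' (complex_of_real (s * (r / 2))))"
      using U(7)[OF b] U(4) by (simp add: algebra_simps mult.assoc[symmetric])
    have "0 \<le> s * (s * (r / 2))" using ss U(4) by (simp add: mult.assoc[symmetric])
    then show "\<phi>' (complex_of_real (s * (r / 2))) \<in> \<phi>' ` B" using b by (auto simp: B_def)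
  qed
  ultimately show ?thesis by blast
qed

end

section \<open>Reparametrising arcs and trajectories\<close>

lemma arc_coordinate:
  fixes g :: "real \<Rightarrow> complex"
  assumes "continuous_on {u..v} g" "inj_on g {u..v}"
  shows "\<exists>p. continuous_on (g ` {u..v}) p \<and> inj_on p (g ` {u..v}) \<and> (\<forall>s\<in>{u..v}. p (g s) = s)"
proof -
  obtain p where p: "homeomorphism {u..v} (g ` {u..v}) g p"
    using homeomorphism_compact[OF compact_Icc assms(1) refl assms(2)] by blast
  have "inj_on p (g ` {u..v})" by (rule inj_onI) (metis homeomorphism_apply2[OF p])
  then show ?thesis using homeomorphism_cont2[OF p] homeomorphism_apply1[OF p] by blast
qed

text \<open>Along a trajectory \<open>f\<close> is continuous and injective, so the value of
  \<open>f\<close> can serve as its parameter, giving a section over a segment of levels that starts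
  at the extreme value.\<close>

lemma trajectory_section:
  assumes \<gamma>: "U_trajectory D f \<gamma>" "w \<in> path_image \<gamma>"
    and f: "continuous_on D f" "\<And>x. x \<in> D \<Longrightarrow> f x \<in> {lo..hi}" and w: "f w = lo \<or> f w = hi"
  shows "\<exists>c' \<tau>. c' \<in> {lo<..<hi} \<and> continuous_on (closed_segment (f w) c') \<tau> \<and>
     (\<forall>c\<in>closed_segment (f w) c'. \<tau> c \<in> D \<and> f (\<tau> c) = c) \<and> \<tau> (f w) = w"
proof -
  define G where "G = f \<circ> \<gamma>"
  have arc: "continuous_on {0..1} \<gamma>" "\<gamma> ` {0..1} \<subseteq> D"
    and mono: "strict_mono_on {0..1} G \<or> strict_antimono_on {0..1} G"
    using \<gamma>(1) by (auto simp: U_trajectory_def arc_def path_def path_image_def G_def)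
  have cG: "continuous_on {0..1} G"
    unfolding G_def using arc f(1) by (metis continuous_on_compose continuous_on_subset)
  have iG: "inj_on G {0..1}"
    using injective_eq_monotone_map[OF is_interval_cc cG] mono by blast
  obtain k where k: "homeomorphism {0..1} (G ` {0..1}) G k"
    using homeomorphism_compact[OF compact_Icc cG refl iG] by blast
  have con: "connected (G ` {0..1})" using cG by (intro connected_continuous_image) auto
  obtain s where s: "s \<in> {0..1}" "w = \<gamma> s" using \<gamma>(2) by (auto simp: path_image_def)
  define s' :: real where "s' = (if s = 0 then 1 else 0)"
  have s': "s' \<in> {0..1}" "s' \<noteq> s" by (auto simp: s'_def)
  have Gs: "G s = f w" using s by (simp add: G_def)
  have ne: "G s' \<noteq> f w" using inj_onD[OF iG _ s'(1) s(1)] s'(2) Gs by auto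
  have "\<gamma> s' \<in> D" using arc(2) s'(1) by blast
  then have rs': "G s' \<in> {lo..hi}" using f(2) by (simp add: G_def)
  \<comment> \<open>The trajectory may reach the opposite extreme value at \<open>s'\<close>; the
    midpoint is strictly between \<open>lo\<close> and \<open>hi\<close> in any case.\<close>
  define c' where "c' = (f w + G s') / 2"
  have c': "c' \<in> {lo<..<hi}" using w ne rs' by (auto simp: c'_def)
  have seg: "closed_segment (f w) c' \<subseteq> G ` {0..1}"
  proof
    fix c assume c: "c \<in> closed_segment (f w) c'"
    have in1: "G s' \<in> G ` {0..1}" "f w \<in> G ` {0..1}"
      using s'(1) imageI[OF s(1), of G] unfolding Gs by blast+
    have "f w \<le> c \<and> c \<le> G s' \<or> G s' \<le> c \<and> c \<le> f w"
      using c by (auto simp: closed_segment_eq_real_ivl c'_def split: if_splits)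
    then show "c \<in> G ` {0..1}" using connectedD_interval[OF con] in1 by blast
  qed
  define \<tau> where "\<tau> = \<gamma> \<circ> k"
  have kim: "k c \<in> {0..1}" "G (k c) = c" if "c \<in> closed_segment (f w) c'" for c
    using homeomorphism_image2[OF k] homeomorphism_apply2[OF k] seg that by blast+
  have "continuous_on (closed_segment (f w) c') \<tau>" unfolding \<tau>_def
  proof (rule continuous_on_compose)
    show "continuous_on (closed_segment (f w) c') k"
      using homeomorphism_cont2[OF k] seg by (rule continuous_on_subset)
    show "continuous_on (k ` closed_segment (f w) c') \<gamma>"
      using arc(1) by (rule continuous_on_subset) (use kim in blast)
  qed
  moreover have "\<tau> c \<in> D" "f (\<tau> c) = c" if "c \<in> closed_segment (f w) c'" for c
    using kim[OF that] arc(2) by (auto simp: \<tau>_def G_def)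
  moreover have "\<tau> (f w) = w"
    using homeomorphism_apply1[OF k s(1)] Gs s(2) by (simp add: \<tau>_def)
  ultimately show ?thesis using c' by blast
qed

section \<open>Range, fibre ends and connected fibres when \<open>f\<close> increases along the
  first odd arc\<close>

locale increasing_disk = regular_disk +
  assumes increasing: "f (bdry t1) < f (bdry t2)"
begin

definition lo :: real where "lo = F t1"
definition hi :: real where "hi = F t2"

lemma ends: "F t1 = lo" "F t2 = hi" "F t3 = hi" "F t4 = lo" "lo < hi"
  using F3 F4 increasing by (simp_all add: lo_def hi_def)

lemma mono12: "strict_mono_on {t1..t2} F"
proof -
  have "\<not> strict_antimono_on {t1..t2} F"
    using monotone_onD[of "{t1..t2}" "(<)" "(>)" F t1 t2] order increasing by auto
  then show ?thesis using mono_F(1) by blast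
qed

lemma anti34: "strict_antimono_on {t3..t4} F"
proof -
  have "\<not> strict_mono_on {t3..t4} F"
    using monotone_onD[of "{t3..t4}" "(<)" "(<)" F t3 t4] order ends by auto
  then show ?thesis using mono_F(2) by blast
qed

lemma mono12_le: "\<lbrakk>s \<in> {t1..t2}; t \<in> {t1..t2}; s \<le> t\<rbrakk> \<Longrightarrow> F s \<le> F t"
  using monotone_onD[OF mono12, of s t] by (cases "s = t") auto

lemma anti34_le: "\<lbrakk>s \<in> {t3..t4}; t \<in> {t3..t4}; s \<le> t\<rbrakk> \<Longrightarrow> F t \<le> F s"
  using monotone_onD[OF anti34, of s t] by (cases "s = t") auto

lemma boundary_cases:
  assumes "x \<in> frontier D"
  obtains (up) t where "t \<in> {t1..t2}" "x = bdry t"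
    | (top) t where "t \<in> {t2..t3}" "x = bdry t"
    | (down) t where "t \<in> {t3..t4}" "x = bdry t"
    | (bottom) t where "t \<in> {t4..t1 + 2 * pi}" "x = bdry t"
proof -
  obtain t where t: "t \<in> {t1..<t1 + 2 * pi}" "bdry t = x" using bdry_surj[OF assms] by blast
  have "t \<in> {t1..t2} \<or> t \<in> {t2..t3} \<or> t \<in> {t3..t4} \<or> t \<in> {t4..t1 + 2 * pi}" using t(1) by auto
  then show thesis using that t(2) by blast
qed

lemma F_up: "F ` {t1..t2} = {lo..hi}"
proof
  show "F ` {t1..t2} \<subseteq> {lo..hi}" using mono12_le[of t1] mono12_le[of _ t2] ends order by fastforce
  show "{lo..hi} \<subseteq> F ` {t1..t2}"
    using IVT'[of F t1 _ t2] continuous_F ends order by fastforce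
qed

lemma F_down: "F ` {t3..t4} = {lo..hi}"
proof
  show "F ` {t3..t4} \<subseteq> {lo..hi}" using anti34_le[of t3] anti34_le[of _ t4] ends order by fastforce
  show "{lo..hi} \<subseteq> F ` {t3..t4}"
    using IVT2'[of F t4 _ t3] continuous_F ends order by fastforce
qed

definition ka :: "real \<Rightarrow> real" where "ka = (SOME k. homeomorphism {t1..t2} {lo..hi} F k)"
definition kb :: "real \<Rightarrow> real" where "kb = (SOME k. homeomorphism {t3..t4} {lo..hi} F k)"

lemma ka: "homeomorphism {t1..t2} {lo..hi} F ka"
  unfolding ka_def by (rule someI_ex[OF homeomorphism_compact[OF compact_Icc continuous_F F_up inj_on_F(1)]])

lemma kb: "homeomorphism {t3..t4} {lo..hi} F kb"
  unfolding kb_def by (rule someI_ex[OF homeomorphism_compact[OF compact_Icc continuous_F F_down inj_on_F(2)]])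

definition a :: "real \<Rightarrow> complex" where "a c = bdry (ka c)"
definition b :: "real \<Rightarrow> complex" where "b c = bdry (kb c)"

lemma a_F: "t \<in> {t1..t2} \<Longrightarrow> a (F t) = bdry t" and b_F: "t \<in> {t3..t4} \<Longrightarrow> b (F t) = bdry t"
  using homeomorphism_apply1[OF ka] homeomorphism_apply1[OF kb] by (simp_all add: a_def b_def)

lemma ab_ends: "a lo = bdry t1" "a hi = bdry t2" "b hi = bdry t3" "b lo = bdry t4"
  using a_F[of t1] a_F[of t2] b_F[of t3] b_F[of t4] order ends by auto

lemma k_image: assumes "c \<in> {lo..hi}" shows "ka c \<in> {t1..t2}" "F (ka c) = c" "kb c \<in> {t3..t4}" "F (kb c) = c"
  using homeomorphism_image2[OF ka] homeomorphism_image2[OF kb] homeomorphism_apply2[OF ka assms] 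
    homeomorphism_apply2[OF kb assms] assms by blast+

lemma a_fibre: "c \<in> {lo..hi} \<Longrightarrow> a c \<in> D \<and> f (a c) = c" and b_fibre: "c \<in> {lo..hi} \<Longrightarrow> b c \<in> D \<and> f (b c) = c"
  using k_image(2,4) bdry_frontier frontier_subset_disk by (auto simp: a_def b_def)

lemma continuous_ab: "continuous_on {lo..hi} a" "continuous_on {lo..hi} b"
proof -
  have "continuous_on {lo..hi} (bdry \<circ> ka)" "continuous_on {lo..hi} (bdry \<circ> kb)"
    by (intro continuous_on_compose homeomorphism_cont2[OF ka] homeomorphism_cont2[OF kb] continuous_bdry)+
  then show "continuous_on {lo..hi} a" "continuous_on {lo..hi} b" by (simp_all add: a_def[abs_def] b_def[abs_def] o_def)
qed

lemma frontier_range: assumes "x \<in> frontier D" shows "f x \<in> {lo..hi}"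
  using assms
proof (cases rule: boundary_cases)
  case (up t) then show ?thesis using F_up by blast
next
  case (top t) then show ?thesis using const_ends(1)[of t] ends by simp
next
  case (down t) then show ?thesis using F_down by blast
next
  case (bottom t) then show ?thesis using const_ends(2)[of t] ends by simp
qed

text \<open>From an interior point one can both climb and descend, so the extreme values over the
  compact set \<open>D\<close> are taken on the frontier.\<close>

lemma f_range: assumes "x \<in> D" shows "f x \<in> {lo..hi}"
proof -
  have ne: "D \<noteq> {}" using assms by blast
  obtain p where p: "p \<in> D" "\<And>y. y \<in> D \<Longrightarrow> f y \<le> f p"
    using continuous_attains_sup[OF compact_disk ne cont] by blast
  obtain q where q: "q \<in> D" "\<And>y. y \<in> D \<Longrightarrow> f q \<le> f y"
    using continuous_attains_inf[OF compact_disk ne cont] by blast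
  have "p \<notin> interior D"
  proof
    assume "p \<in> interior D"
    then obtain K where K: "K \<subseteq> {x \<in> D. 1 * f p \<le> 1 * f x}" "\<exists>u\<in>K. 1 * f p < 1 * f u"
      using interior_half_chart[of p 1] by auto
    then obtain u where "u \<in> D" "f p < f u" by auto
    then show False using p(2) by fastforce
  qed
  then have "f p \<in> {lo..hi}" using disk_cases[OF p(1)] frontier_range by blast
  moreover have "q \<notin> interior D"
  proof
    assume "q \<in> interior D"
    then obtain K where K: "K \<subseteq> {x \<in> D. -1 * f q \<le> -1 * f x}" "\<exists>u\<in>K. -1 * f q < -1 * f u"
      using interior_half_chart[of q "-1"] by auto
    then obtain u where "u \<in> D" "f u < f q" by auto
    then show False using q(2) by fastforce
  qed
  then have "f q \<in> {lo..hi}" using disk_cases[OF q(1)] frontier_range by blast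
  ultimately show ?thesis using p(2)[OF assms] q(2)[OF assms] by auto
qed

lemma interior_range: assumes p: "p \<in> interior D" shows "f p \<in> {lo<..<hi}"
proof -
  obtain K u where K: "K \<subseteq> {x \<in> D. 1 * f p \<le> 1 * f x}" "u \<in> K" "1 * f p < 1 * f u"
    using interior_half_chart[OF p, of 1] by auto
  have "u \<in> D" using K by blast
  then have "f p < hi" using f_range[of u] K(3) by simp
  obtain K v where K: "K \<subseteq> {x \<in> D. -1 * f p \<le> -1 * f x}" "v \<in> K" "-1 * f p < -1 * f v"
    using interior_half_chart[OF p, of "-1"] by auto
  have "v \<in> D" using K by blast
  then have "lo < f p" using f_range[of v] K(3) by simp
  then show ?thesis using \<open>f p < hi\<close> by simp
qed

lemma fibre_hi: "{x \<in> D. f x = hi} = bdry ` {t2..t3}"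
proof
  show "bdry ` {t2..t3} \<subseteq> {x \<in> D. f x = hi}"
    using bdry_frontier frontier_subset_disk const_ends(1) ends(2) by fastforce
  show "{x \<in> D. f x = hi} \<subseteq> bdry ` {t2..t3}"
  proof
    fix x assume "x \<in> {x \<in> D. f x = hi}"
    then have x: "x \<in> D" "f x = hi" by auto
    then have "x \<in> frontier D" using interior_range[of x] disk_cases[of x] by auto
    then show "x \<in> bdry ` {t2..t3}"
    proof (cases rule: boundary_cases)
      case (up t)
      then have "x = a hi" using a_F[of t] x by simp
      then show ?thesis using ab_ends(2) order by simp
    next
      case (down t)
      then have "x = b hi" using b_F[of t] x by simp
      then show ?thesis using ab_ends(3) order by simp
    next
      case (bottom t)
      then show ?thesis using const_ends(2)[of t] x ends by simp
    qed blast
  qed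
qed

lemma fibre_lo: "{x \<in> D. f x = lo} = bdry ` {t4..t1 + 2 * pi}"
proof
  show "bdry ` {t4..t1 + 2 * pi} \<subseteq> {x \<in> D. f x = lo}"
    using bdry_frontier frontier_subset_disk const_ends(2) ends(1) by fastforce
  show "{x \<in> D. f x = lo} \<subseteq> bdry ` {t4..t1 + 2 * pi}"
  proof
    fix x assume "x \<in> {x \<in> D. f x = lo}"
    then have x: "x \<in> D" "f x = lo" by auto
    then have "x \<in> frontier D" using interior_range[of x] disk_cases[of x] by auto
    then show "x \<in> bdry ` {t4..t1 + 2 * pi}"
    proof (cases rule: boundary_cases)
      case (up t)
      then have "x = bdry (t1 + 2 * pi)" using a_F[of t] x ab_ends(1) bdry_periodic by simp
      then show ?thesis using order by simp
    next
      case (down t)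
      then have "x = b lo" using b_F[of t] x by simp
      then show ?thesis using ab_ends(4) order by simp
    next
      case (top t)
      then show ?thesis using const_ends(1)[of t] x ends by simp
    qed blast
  qed
qed

lemma frontier_fibre:
  assumes "x \<in> frontier D" "f x \<in> {lo<..<hi}" shows "x = a (f x) \<or> x = b (f x)"
  using assms(1)
proof (cases rule: boundary_cases)
  case (up t) then show ?thesis using a_F by simp
next
  case (top t) then show ?thesis using const_ends(1)[of t] ends assms(2) by simp
next
  case (down t) then show ?thesis using b_F by simp
next
  case (bottom t) then show ?thesis using const_ends(2)[of t] ends assms(2) by simp
qed

lemma frontier_decomposition:
  "frontier D = {x \<in> D. f x \<in> {lo, hi}} \<union> a ` {lo..hi} \<union> b ` {lo..hi}"
proof
  show "frontier D \<subseteq> {x \<in> D. f x \<in> {lo, hi}} \<union> a ` {lo..hi} \<union> b ` {lo..hi}"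
  proof
    fix x assume x: "x \<in> frontier D"
    then have "x \<in> D" "f x \<in> {lo..hi}" using frontier_subset_disk frontier_range by blast+
    then show "x \<in> {x \<in> D. f x \<in> {lo, hi}} \<union> a ` {lo..hi} \<union> b ` {lo..hi}"
      using frontier_fibre[OF x] by (cases "f x \<in> {lo, hi}") (auto simp: less_le)
  qed
  have "x \<in> frontier D" if "x \<in> D" "f x \<in> {lo, hi}" for x
    using disk_cases[OF that(1)] interior_range[of x] that(2) by auto
  then show "{x \<in> D. f x \<in> {lo, hi}} \<union> a ` {lo..hi} \<union> b ` {lo..hi} \<subseteq> frontier D"
    using bdry_frontier by (auto simp: a_def b_def)
qed

lemma a_neq_b: assumes "c \<in> {lo<..<hi}" shows "a c \<noteq> b c"
proof
  assume eq: "a c = b c"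
  have c: "c \<in> {lo..hi}" using assms by auto
  note k = k_image[OF c]
  \<comment> \<open>\<open>ka c > t1\<close> keeps the two angles less than a full turn apart even
    if \<open>t4 = t1 + 2 * pi\<close>; \<open>ka c < t2\<close> excludes equality even if
    \<open>t2 = t3\<close>.\<close>
  have "ka c \<noteq> t2" "ka c \<noteq> t1" using k ends assms by auto
  then have "\<bar>ka c - kb c\<bar> < 2 * pi" using k order by auto
  then have "ka c = kb c" using bdry_eqD eq unfolding a_def b_def by blast
  then show False using k(1,3) order \<open>ka c \<noteq> t2\<close> by auto
qed

lemma connected_bdry: "connected (bdry ` {u..v})"
  by (intro connected_continuous_image continuous_bdry) simp

text \<open>The bottom arc serves as \<open>E\<close>. Interior points descend within a chart,
  points of an odd arc slide down that arc to the bottom, and points of the top arc lie above level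
  \<open>c\<close>.\<close>

lemma connected_sublevel:
  assumes c: "c \<in> {lo<..<hi}" shows "connected {x \<in> D. f x \<le> c}"
proof (rule sublevel_connected[OF compact_disk cont connected_bdry[of t4 "t1 + 2 * pi"]])
  show "bdry ` {t4..t1 + 2 * pi} \<subseteq> {x \<in> D. f x \<le> c}" unfolding fibre_lo[symmetric] using c by auto
  show "bdry t4 \<in> bdry ` {t4..t1 + 2 * pi}" using order by simp
  fix p assume p: "p \<in> D" "f p \<le> c"
  let ?E = "bdry ` {t4..t1 + 2 * pi}"
  show "\<exists>K. connected K \<and> p \<in> K \<and> K \<subseteq> {x \<in> D. f x \<le> f p} \<and> (K \<inter> ?E \<noteq> {} \<or> (\<exists>u\<in>K. f u < f p))"
  proof (cases "p \<in> interior D")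
    case True
    then show ?thesis using interior_half_chart[OF True, of "-1"] by simp blast
  next
    case False
    then have "p \<in> frontier D" using disk_cases[OF p(1)] by blast
    have sub: "bdry ` {u..v} \<subseteq> {x \<in> D. f x \<le> f p}" if "\<And>s. s \<in> {u..v} \<Longrightarrow> F s \<le> f p" for u v
      using that bdry_frontier frontier_subset_disk by auto
    from \<open>p \<in> frontier D\<close> show ?thesis
    proof (cases rule: boundary_cases)
      case (up t)
      have "bdry t1 \<in> ?E" using order bdry_periodic[of t1] by (metis atLeastAtMost_iff imageI order_refl)
      moreover have "bdry t1 \<in> bdry ` {t1..t}" "p \<in> bdry ` {t1..t}" using up by auto
      moreover have "bdry ` {t1..t} \<subseteq> {x \<in> D. f x \<le> f p}"
        using up by (intro sub) (auto intro!: mono12_le)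
      ultimately show ?thesis using connected_bdry by blast
    next
      case (top t)
      then show ?thesis using const_ends(1)[of t] ends p(2) c by simp
    next
      case (down t)
      have "bdry t4 \<in> ?E" using order by simp
      moreover have "bdry t4 \<in> bdry ` {t..t4}" "p \<in> bdry ` {t..t4}" using down by auto
      moreover have "bdry ` {t..t4} \<subseteq> {x \<in> D. f x \<le> f p}"
        using down by (intro sub) (auto intro!: anti34_le)
      ultimately show ?thesis using connected_bdry by blast
    next
      case (bottom t)
      then show ?thesis using p by (intro exI[of _ "{p}"]) auto
    qed
  qed
qed

text \<open>The sublevel argument for the negative of \<open>f\<close>, with the top arc as
  target.\<close>

lemma connected_superlevel:
  assumes c: "c \<in> {lo<..<hi}" shows "connected {x \<in> D. c \<le> f x}"
proof -
  have "connected {x \<in> D. - f x \<le> - c}"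
  proof (rule sublevel_connected[OF compact_disk continuous_on_minus[OF cont] connected_bdry[of t2 t3]])
    show "bdry ` {t2..t3} \<subseteq> {x \<in> D. - f x \<le> - c}" unfolding fibre_hi[symmetric] using c by auto
    show "bdry t2 \<in> bdry ` {t2..t3}" using order by simp
    fix p assume p: "p \<in> D" "- f p \<le> - c"
    let ?E = "bdry ` {t2..t3}"
    show "\<exists>K. connected K \<and> p \<in> K \<and> K \<subseteq> {x \<in> D. - f x \<le> - f p} \<and> (K \<inter> ?E \<noteq> {} \<or> (\<exists>u\<in>K. - f u < - f p))"
    proof (cases "p \<in> interior D")
      case True
      then show ?thesis using interior_half_chart[OF True, of 1] by simp blast
    next
      case False
      then have "p \<in> frontier D" using disk_cases[OF p(1)] by blast
      have sub: "bdry ` {u..v} \<subseteq> {x \<in> D. - f x \<le> - f p}" if "\<And>s. s \<in> {u..v} \<Longrightarrow> f p \<le> F s" for u v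
        using that bdry_frontier frontier_subset_disk by auto
      from \<open>p \<in> frontier D\<close> show ?thesis
      proof (cases rule: boundary_cases)
        case (up t)
        have "bdry t2 \<in> ?E" using order by simp
        moreover have "bdry t2 \<in> bdry ` {t..t2}" "p \<in> bdry ` {t..t2}" using up by auto
        moreover have "bdry ` {t..t2} \<subseteq> {x \<in> D. - f x \<le> - f p}"
          using up by (intro sub) (auto intro!: mono12_le)
        ultimately show ?thesis using connected_bdry by blast
      next
        case (top t)
        then show ?thesis using p by (intro exI[of _ "{p}"]) auto
      next
        case (down t)
        have "bdry t3 \<in> ?E" using order by simp
        moreover have "bdry t3 \<in> bdry ` {t3..t}" "p \<in> bdry ` {t3..t}" using down by auto
        moreover have "bdry ` {t3..t} \<subseteq> {x \<in> D. - f x \<le> - f p}"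
          using down by (intro sub) (auto intro!: anti34_le)
        ultimately show ?thesis using connected_bdry by blast
      next
        case (bottom t)
        then show ?thesis using const_ends(2)[of t] ends p(2) c by simp
      qed
    qed
  qed
  then show ?thesis by simp
qed

lemma connected_fibre:
  assumes "c \<in> {lo..hi}" shows "connected {x \<in> D. f x = c}"
proof -
  consider "c = lo" | "c = hi" | "c \<in> {lo<..<hi}" using assms by fastforce
  then show ?thesis
  proof cases
    case 3
    have "closedin (top_of_set D) {x \<in> D. f x \<le> c}" "closedin (top_of_set D) {x \<in> D. c \<le> f x}"
      using continuous_closedin_preimage[OF cont, of "{..c}"] continuous_closedin_preimage[OF cont, of "{c..}"]
      by (simp_all add: vimage_def Int_def)
    moreover have "D = {x \<in> D. f x \<le> c} \<union> {x \<in> D. c \<le> f x}" by auto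
    ultimately have "connected ({x \<in> D. f x \<le> c} \<inter> {x \<in> D. c \<le> f x})"
      using unicoherentD[OF unicoherent_disk connected_sublevel[OF 3] connected_superlevel[OF 3]] by blast
    moreover have "{x \<in> D. f x \<le> c} \<inter> {x \<in> D. c \<le> f x} = {x \<in> D. f x = c}" by auto
    ultimately show ?thesis by simp
  qed (simp_all add: fibre_lo fibre_hi connected_bdry)
qed

end

section \<open>Intermediate level sets as arcs, and the resulting strip\<close>

context increasing_disk begin

text \<open>In the chart the level of \<open>x\<close> is the vertical diameter, so the imaginary
  part is a coordinate on it.\<close>

lemma level_chart_interior:
  assumes x: "x \<in> interior D"
  shows "\<exists>T r \<eta> \<eta>'. openin (top_of_set {y \<in> D. f y = f x}) T \<and> x \<in> T \<and> homeomorphism T {-r<..<r::real} \<eta> \<eta>'"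
proof -
  obtain U r \<phi> \<phi>' where U: "open U" "x \<in> U" "U \<subseteq> interior D \<inter> UNIV" "r > 0" "homeomorphism U (ball 0 r) \<phi> \<phi>'"
    "\<phi> x = 0" "\<forall>w\<in>ball 0 r. f (\<phi>' w) = Re w + f x"
    using interior_chart[OF x open_UNIV UNIV_I] by (elim exE conjE) (rule that)
  define L where "L = {y \<in> D. f y = f x}"
  define T where "T = L \<inter> U"
  have \<phi>T: "\<phi> y \<in> ball 0 r" "\<phi> y = Complex 0 (Im (\<phi> y))" "\<phi>' (\<phi> y) = y" if "y \<in> T" for y
  proof -
    have y: "y \<in> U" "f y = f x" using that by (auto simp: T_def L_def)
    show b: "\<phi> y \<in> ball 0 r" and i: "\<phi>' (\<phi> y) = y"
      using homeomorphism_image1[OF U(5)] homeomorphism_apply1[OF U(5)] y(1) by blast+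
    have "Re (\<phi> y) = 0" using bspec[OF U(7) b] i y(2) by simp
    then show "\<phi> y = Complex 0 (Im (\<phi> y))" by (simp add: complex_eq_iff)
  qed
  have bl: "Complex 0 s \<in> ball 0 r" if "s \<in> {-r<..<r}" for s
    using that by (auto simp: complex_norm)
  have \<phi>'T: "\<phi>' (Complex 0 s) \<in> T" "\<phi> (\<phi>' (Complex 0 s)) = Complex 0 s" if "s \<in> {-r<..<r}" for s
  proof -
    note b = bl[OF that]
    show "\<phi> (\<phi>' (Complex 0 s)) = Complex 0 s" by (rule homeomorphism_apply2[OF U(5) b])
    have "\<phi>' (Complex 0 s) \<in> U" using homeomorphism_image2[OF U(5)] b by blast
    moreover have "f (\<phi>' (Complex 0 s)) = f x" using bspec[OF U(7) b] by simp
    moreover have "\<phi>' (Complex 0 s) \<in> D" using calculation(1) U(3) interior_subset by blast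
    ultimately show "\<phi>' (Complex 0 s) \<in> T" by (simp add: T_def L_def)
  qed
  have "homeomorphism T {-r<..<r} (\<lambda>y. Im (\<phi> y)) (\<lambda>s. \<phi>' (Complex 0 s))"
  proof (rule homeomorphismI)
    have "continuous_on T \<phi>" using homeomorphism_cont1[OF U(5)] by (rule continuous_on_subset) (auto simp: T_def)
    then show "continuous_on T (\<lambda>y. Im (\<phi> y))" by (rule continuous_on_Im)
    show "continuous_on {-r<..<r} (\<lambda>s. \<phi>' (Complex 0 s))"
      by (rule continuous_on_compose2[OF homeomorphism_cont2[OF U(5)]])
         (use bl in \<open>auto intro!: continuous_intros simp: Complex_eq\<close>)
    show "(\<lambda>y. Im (\<phi> y)) ` T \<subseteq> {-r<..<r}"
    proof (rule image_subsetI)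
      fix y assume "y \<in> T"
      then have "\<bar>Im (\<phi> y)\<bar> < r" using \<phi>T(1)[of y] abs_Im_le_cmod[of "\<phi> y"] by simp
      then show "Im (\<phi> y) \<in> {-r<..<r}" by auto
    qed
    show "(\<lambda>s. \<phi>' (Complex 0 s)) ` {-r<..<r} \<subseteq> T" using \<phi>'T(1) by blast
    show "\<phi>' (Complex 0 (Im (\<phi> y))) = y" if "y \<in> T" for y
      using \<phi>T[OF that] by simp
    show "Im (\<phi> (\<phi>' (Complex 0 s))) = s" if "s \<in> {-r<..<r}" for s
      using \<phi>'T(2)[OF that] by simp
  qed
  moreover have "openin (top_of_set L) T" unfolding T_def using U(1) by (rule openin_open_Int)
  moreover have "x \<in> T" using U(2) x interior_subset by (auto simp: T_def L_def)
  ultimately show ?thesis unfolding L_def by blast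
qed

text \<open>A regular boundary chart carries the level set to the half-open segment from 0 on the
  imaginary axis; again the imaginary part is the coordinate, now with an end at
  \<open>bdry t\<close>.\<close>

lemma level_chart_boundary:
  assumes t: "t \<in> {t1<..<t2} \<union> {t3<..<t4}"
  shows "\<exists>T r \<eta> \<eta>'. openin (top_of_set {y \<in> D. f y = F t}) T \<and> bdry t \<in> T \<and>
    homeomorphism T {0..<r::real} \<eta> \<eta>' \<and> \<eta> (bdry t) = 0"
proof -
  obtain U \<psi> \<psi>' where U: "openin (top_of_set D) U" "bdry t \<in> U" "homeomorphism U upper_half_disk \<psi> \<psi>'"
    "\<psi> (bdry t) = 0" "\<psi> ` {z \<in> U. f z = F t} = {z. Re z = 0 \<and> Im z \<in> {0..<1}}"
    using boundary_chart[OF t] by (elim exE conjE) (rule that)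
  define L where "L = {y \<in> D. f y = F t}"
  define T where "T = {z \<in> U. f z = F t}"
  have UD: "U \<subseteq> D" using U(1) by (rule openin_imp_subset)
  have TU: "T \<subseteq> U" by (auto simp: T_def)
  have \<psi>T: "Im (\<psi> y) \<in> {0..<1}" "\<psi> y = Complex 0 (Im (\<psi> y))" "\<psi>' (\<psi> y) = y" if "y \<in> T" for y
  proof -
    have "\<psi> y \<in> {z. Re z = 0 \<and> Im z \<in> {0..<1}}" unfolding U(5)[symmetric] T_def[symmetric] using that by (rule imageI)
    then show "Im (\<psi> y) \<in> {0..<1}" "\<psi> y = Complex 0 (Im (\<psi> y))" by (auto simp: complex_eq_iff)
    show "\<psi>' (\<psi> y) = y" using homeomorphism_apply1[OF U(3)] that TU by blast
  qed
  have \<psi>'T: "\<psi>' (Complex 0 s) \<in> T" "\<psi> (\<psi>' (Complex 0 s)) = Complex 0 s" "Complex 0 s \<in> upper_half_disk"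
    if s: "s \<in> {0..<1}" for s
  proof -
    show "Complex 0 s \<in> upper_half_disk" using s by (auto simp: upper_half_disk_def complex_norm)
    then show "\<psi> (\<psi>' (Complex 0 s)) = Complex 0 s" by (rule homeomorphism_apply2[OF U(3)])
    have "Complex 0 s \<in> \<psi> ` T" unfolding T_def U(5) using s by simp
    then obtain y where "y \<in> T" "Complex 0 s = \<psi> y" by blast
    then show "\<psi>' (Complex 0 s) \<in> T" using \<psi>T(3) by simp
  qed
  have "homeomorphism T {0..<1} (\<lambda>y. Im (\<psi> y)) (\<lambda>s. \<psi>' (Complex 0 s))"
  proof (rule homeomorphismI)
    have "continuous_on T \<psi>" using homeomorphism_cont1[OF U(3)] TU by (rule continuous_on_subset)
    then show "continuous_on T (\<lambda>y. Im (\<psi> y))" by (rule continuous_on_Im)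
    show "continuous_on {0..<1} (\<lambda>s. \<psi>' (Complex 0 s))"
      by (rule continuous_on_compose2[OF homeomorphism_cont2[OF U(3)]])
         (use \<psi>'T(3) in \<open>auto intro!: continuous_intros simp: Complex_eq\<close>)
    show "(\<lambda>y. Im (\<psi> y)) ` T \<subseteq> {0..<1}" using \<psi>T(1) by blast
    show "(\<lambda>s. \<psi>' (Complex 0 s)) ` {0..<1} \<subseteq> T" using \<psi>'T(1) by blast
    show "\<psi>' (Complex 0 (Im (\<psi> y))) = y" if "y \<in> T" for y
      using \<psi>T[OF that] by simp
    show "Im (\<psi> (\<psi>' (Complex 0 s))) = s" if "s \<in> {0..<1}" for s
      using \<psi>'T(2)[OF that] by simp
  qed
  moreover have "openin (top_of_set L) T"
  proof -
    obtain O1 where O1: "open O1 \<and> U = D \<inter> O1" using U(1) unfolding openin_open ..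
    then have "T = L \<inter> O1" by (auto simp: T_def L_def)
    then show ?thesis using O1 openin_open_Int by blast
  qed
  moreover have "bdry t \<in> T" using U(2) by (simp add: T_def)
  moreover have "Im (\<psi> (bdry t)) = 0" using U(4) by simp
  ultimately show ?thesis unfolding L_def by blast
qed

lemma level_arc:
  assumes c: "c \<in> {lo<..<hi}"
  shows "\<exists>g. arc g \<and> pathstart g = a c \<and> pathfinish g = b c \<and> path_image g = {x \<in> D. f x = c}"
proof (rule connected_one_manifold_with_ends_is_arc)
  have cc: "c \<in> {lo..hi}" using c by auto
  show "connected {x \<in> D. f x = c}" by (rule connected_fibre[OF cc])
  show "a c \<in> {x \<in> D. f x = c}" "b c \<in> {x \<in> D. f x = c}" using a_fibre[OF cc] b_fibre[OF cc] by simp_all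
  show "a c \<noteq> b c" by (rule a_neq_b[OF c])
  show "\<exists>T r \<eta> \<eta>'. openin (top_of_set {x \<in> D. f x = c}) T \<and> x \<in> T \<and> homeomorphism T {-r<..<r::real} \<eta> \<eta>'"
    if x: "x \<in> {x \<in> D. f x = c}" "x \<noteq> a c" "x \<noteq> b c" for x
  proof -
    have "x \<in> interior D" using frontier_fibre[of x] disk_cases[of x] x c by auto
    moreover have "f x = c" using x(1) by simp
    ultimately show ?thesis using level_chart_interior by blast
  qed
  note k = k_image[OF cc]
  \<comment> \<open>At an intermediate level both ends lie strictly inside the odd arcs, where
    boundary charts are available.\<close>
  have "ka c \<noteq> t1" "ka c \<noteq> t2" "kb c \<noteq> t3" "kb c \<noteq> t4" using k ends c by auto
  then have k': "ka c \<in> {t1<..<t2} \<union> {t3<..<t4}" "kb c \<in> {t1<..<t2} \<union> {t3<..<t4}" using k(1,3) by auto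
  show "\<exists>T r \<eta> \<eta>'. openin (top_of_set {x \<in> D. f x = c}) T \<and> x \<in> T \<and> homeomorphism T {0..<r::real} \<eta> \<eta>' \<and> \<eta> x = 0"
    if x: "x = a c \<or> x = b c" for x
    using x level_chart_boundary[OF k'(1)] level_chart_boundary[OF k'(2)] unfolding k(2,4) a_def b_def by metis
qed

text \<open>On extreme levels the position is tied to the angle, so that a trajectory found between
  two angles lies between the corresponding positions. The sign differs because the positive
  direction leads from \<open>a\<close> to \<open>b\<close> on the top arc and from \<open>b\<close>
  to \<open>a\<close> on the bottom arc.\<close>

lemma fibre_position_exists:
  assumes c: "c \<in> {lo..hi}"
  shows "\<exists>p. continuous_on {x \<in> D. f x = c} p \<and> inj_on p {x \<in> D. f x = c} \<and>
    (\<forall>x\<in>{x \<in> D. f x = c}. p (a c) \<le> p x \<and> p x \<le> p (b c)) \<and>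
    (c = hi \<longrightarrow> (\<forall>t\<in>{t2..t3}. p (bdry t) = t)) \<and> (c = lo \<longrightarrow> (\<forall>t\<in>{t4..t1 + 2 * pi}. p (bdry t) = - t))"
proof -
  consider "c = lo" | "c = hi" | "c \<in> {lo<..<hi}" using c by fastforce
  then show ?thesis
  proof cases
    case 1
    obtain p where p: "continuous_on (bdry ` {t4..t1 + 2 * pi}) p" "inj_on p (bdry ` {t4..t1 + 2 * pi})"
      "\<forall>s\<in>{t4..t1 + 2 * pi}. p (bdry s) = s"
      using arc_coordinate[OF continuous_bdry inj_on_bdry[of "t1 + 2 * pi" t4]] order by auto
    have "p (a lo) = t1 + 2 * pi" "p (b lo) = t4"
      using bspec[OF p(3), of "t1 + 2 * pi"] bspec[OF p(3), of t4] ab_ends(1,4) bdry_periodic[of t1] order by auto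
    moreover have "inj_on (\<lambda>x. - p x) (bdry ` {t4..t1 + 2 * pi})" using p(2) by (simp add: inj_on_def)
    ultimately show ?thesis
      unfolding 1 fibre_lo using p(1,3) ends(5) by (intro exI[of _ "\<lambda>x. - p x"]) (auto intro: continuous_on_minus)
  next
    case 2
    obtain p where p: "continuous_on (bdry ` {t2..t3}) p" "inj_on p (bdry ` {t2..t3})"
      "\<forall>s\<in>{t2..t3}. p (bdry s) = s"
      using arc_coordinate[OF continuous_bdry inj_on_bdry[of t3 t2]] order by auto
    have "p (a hi) = t2" "p (b hi) = t3"
      using bspec[OF p(3), of t2] bspec[OF p(3), of t3] ab_ends(2,3) order by auto
    then show ?thesis
      unfolding 2 fibre_hi using p ends(5) by (intro exI[of _ p]) auto
  next
    case 3
    obtain g where g: "arc g" "pathstart g = a c" "pathfinish g = b c" "path_image g = {x \<in> D. f x = c}"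
      using level_arc[OF 3] by blast
    have "continuous_on {0..1} g" "inj_on g {0..1}" using g(1) by (auto simp: arc_def path_def)
    from arc_coordinate[OF this] obtain p where p: "continuous_on (g ` {0..1}) p" "inj_on p (g ` {0..1})"
      "\<forall>s\<in>{0..1}. p (g s) = s" by blast
    have "p (a c) = 0" "p (b c) = 1"
      using bspec[OF p(3), of 0] bspec[OF p(3), of 1] g(2,3) by (auto simp: pathstart_def pathfinish_def)
    then show ?thesis
      unfolding g(4)[symmetric] path_image_def using p 3 by (intro exI[of _ p]) auto
  qed
qed

lemma strip_exists: "\<exists>pos. strip D f lo hi a b pos"
proof -
  obtain P where "\<forall>c\<in>{lo..hi}. continuous_on {x \<in> D. f x = c} (P c) \<and> inj_on (P c) {x \<in> D. f x = c} \<and>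
    (\<forall>x\<in>{x \<in> D. f x = c}. P c (a c) \<le> P c x \<and> P c x \<le> P c (b c)) \<and>
    (c = hi \<longrightarrow> (\<forall>t\<in>{t2..t3}. P c (bdry t) = t)) \<and> (c = lo \<longrightarrow> (\<forall>t\<in>{t4..t1 + 2 * pi}. P c (bdry t) = - t))"
  proof -
    have "\<forall>c\<in>{lo..hi}. \<exists>p. continuous_on {x \<in> D. f x = c} p \<and> inj_on p {x \<in> D. f x = c} \<and>
      (\<forall>x\<in>{x \<in> D. f x = c}. p (a c) \<le> p x \<and> p x \<le> p (b c)) \<and>
      (c = hi \<longrightarrow> (\<forall>t\<in>{t2..t3}. p (bdry t) = t)) \<and> (c = lo \<longrightarrow> (\<forall>t\<in>{t4..t1 + 2 * pi}. p (bdry t) = - t))"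
      by (rule ballI) (rule fibre_position_exists)
    from bchoice[OF this] show thesis by (elim exE) (rule that)
  qed
  note P = bspec[OF this]
  define pos where "pos x = P (f x) x" for x
  have pos_hi: "pos (bdry t) = t" if "t \<in> {t2..t3}" for t
    using P[of hi] ends that const_ends(1)[OF that] by (simp add: pos_def)
  have pos_lo: "pos (bdry t) = - t" if "t \<in> {t4..t1 + 2 * pi}" for t
    using P[of lo] ends that const_ends(2)[OF that] by (simp add: pos_def)
  have "strip D f lo hi a b pos"
  proof
    fix c assume c: "c \<in> {lo..hi}"
    show "continuous_on {x \<in> D. f x = c} pos"
      using P[OF c] by (subst continuous_on_cong[OF refl, of _ _ "P c"]) (auto simp: pos_def)
    show "inj_on pos {x \<in> D. f x = c}"
      using P[OF c] by (subst inj_on_cong[of _ _ "P c"]) (auto simp: pos_def)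
    show "connected {x \<in> D. f x = c}" by (rule connected_fibre[OF c])
    show "a c \<in> D \<and> f (a c) = c" "b c \<in> D \<and> f (b c) = c" by (fact a_fibre[OF c] b_fibre[OF c])+
  next
    fix x assume x: "x \<in> D"
    have c: "f x \<in> {lo..hi}" by (rule f_range[OF x])
    have "f (a (f x)) = f x" "f (b (f x)) = f x" using a_fibre[OF c] b_fibre[OF c] by blast+
    then show "pos (a (f x)) \<le> pos x \<and> pos x \<le> pos (b (f x))"
      using P[OF c] x by (simp add: pos_def)
  next
    fix x N assume x: "x \<in> D" "f x \<in> {lo<..<hi}" "x \<noteq> a (f x)" "x \<noteq> b (f x)" "open N" "x \<in> N"
    have "x \<in> interior D" using frontier_fibre[of x] disk_cases[OF x(1)] x(2-4) by blast
    then show "\<exists>U. open U \<and> x \<in> U \<and> U \<subseteq> N \<and> (\<forall>c. connected (U \<inter> {x \<in> D. f x = c}))"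
      using x(5,6) by (rule interior_box)
  next
    fix x y assume xy: "x \<in> D" "y \<in> D" "f x \<in> {lo, hi}" "f y = f x" "pos x < pos y"
    have "\<exists>t \<gamma>. U_trajectory D f \<gamma> \<and> bdry t \<in> path_image \<gamma> \<and> F t = f x \<and>
        pos x < pos (bdry t) \<and> pos (bdry t) < pos y"
    proof (cases "f x = hi")
      case True
      then have "x \<in> bdry ` {t2..t3}" "y \<in> bdry ` {t2..t3}" using xy(1,2,4) fibre_hi by auto
      then obtain u v where uv: "u \<in> {t2..t3}" "v \<in> {t2..t3}" "x = bdry u" "y = bdry v" by blast
      then have "u < v" using xy(5) pos_hi by simp
      then obtain t \<gamma> where t: "t \<in> {u<..<v}" "U_trajectory D f \<gamma>" "bdry t \<in> path_image \<gamma>"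
        using trajectories[of u v] uv by auto
      have tt: "t \<in> {t2..t3}" using t(1) uv by auto
      show ?thesis
        using t pos_hi[OF tt] pos_hi uv const_ends(1)[OF tt] ends True
        by (intro exI[of _ t] exI[of _ \<gamma>]) auto
    next
      case False
      then have fl: "f x = lo" using xy(3) by blast
      then have "x \<in> bdry ` {t4..t1 + 2 * pi}" "y \<in> bdry ` {t4..t1 + 2 * pi}" using xy(1,2,4) fibre_lo by auto
      then obtain u v where uv: "u \<in> {t4..t1 + 2 * pi}" "v \<in> {t4..t1 + 2 * pi}" "x = bdry u" "y = bdry v" by blast
      then have "v < u" using xy(5) pos_lo by simp
      then obtain t \<gamma> where t: "t \<in> {v<..<u}" "U_trajectory D f \<gamma>" "bdry t \<in> path_image \<gamma>"
        using trajectories[of v u] uv by auto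
      have tt: "t \<in> {t4..t1 + 2 * pi}" using t(1) uv by auto
      show ?thesis
        using t pos_lo[OF tt] pos_lo uv const_ends(2)[OF tt] ends fl
        by (intro exI[of _ t] exI[of _ \<gamma>]) auto
    qed
    then obtain t \<gamma> where t: "U_trajectory D f \<gamma>" "bdry t \<in> path_image \<gamma>" "F t = f x"
        "pos x < pos (bdry t)" "pos (bdry t) < pos y" by blast
    obtain c' \<tau> where "c' \<in> {lo<..<hi}" "continuous_on (closed_segment (F t) c') \<tau>"
      "\<forall>c\<in>closed_segment (F t) c'. \<tau> c \<in> D \<and> f (\<tau> c) = c" and w: "\<tau> (F t) = bdry t"
      using trajectory_section[OF t(1,2) cont f_range] t(3) xy(3) by auto
    then show "\<exists>c' \<tau>. c' \<in> {lo<..<hi} \<and> continuous_on (closed_segment (f x) c') \<tau> \<and>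
             (\<forall>c\<in>closed_segment (f x) c'. \<tau> c \<in> D \<and> f (\<tau> c) = c) \<and>
             pos x < pos (\<tau> (f x)) \<and> pos (\<tau> (f x)) < pos y"
      using t(4,5) w unfolding t(3) by (intro exI[of _ c'] exI[of _ \<tau>]) simp
  next
    fix x N assume x: "x \<in> D" "f x \<in> {lo, hi}" "open N" "x \<in> N"
    obtain V where V: "open V" "x \<in> V" "V \<subseteq> N" "\<forall>E. E \<subseteq> frontier D \<longrightarrow> connected (D \<inter> V - E)"
      using disk_locally_connected_off_frontier[OF disk x(1,3,4)] by blast
    have "{y \<in> D. f y = f x} \<subseteq> frontier D" using frontier_decomposition x(2) by auto
    then have "connected (D \<inter> V - {y \<in> D. f y = f x})" using V(4) by blast
    moreover have "D \<inter> V - {y \<in> D. f y = f x} = {y \<in> D \<inter> V. f y \<noteq> f x}" by auto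
    ultimately show "\<exists>V. open V \<and> x \<in> V \<and> V \<subseteq> N \<and> connected {y \<in> D \<inter> V. f y \<noteq> f x}"
      using V(1-3) by auto
  next
    show "f x \<in> {lo..hi}" if "x \<in> D" for x by (rule f_range[OF that])
    show "a c \<noteq> b c" if "c \<in> {lo<..<hi}" for c by (rule a_neq_b[OF that])
    show "continuous_on {lo..hi} a" "continuous_on {lo..hi} b" by (fact continuous_ab)+
    show "lo < hi" by (rule ends(5))
    show "compact D" by (rule compact_disk)
    show "continuous_on D f" by (rule cont)
  qed
  then show ?thesis by blast
qed

end

section \<open>The extension theorem\<close>

text \<open>Translates marked points into angles; the component condition on an even arc enters
  through constancy of \<open>f\<close> on it.\<close>

lemma (in disk_boundary) regular_on_imp_regular_disk:
  assumes reg: "regular_on \<omega> D f"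
  shows "\<exists>t1 t2 t3 t4. regular_disk D h h' \<omega> \<omega>' f t1 t2 t3 t4"
proof -
  obtain z \<Gamma> where w: "weakly_regular_with \<omega> D f 2 z"
    and \<Gamma>: "\<Gamma> \<subseteq> open_positive_arc \<omega> (z 2) (z 3) \<union> open_positive_arc \<omega> (z 4) (z 5)"
      "open_positive_arc \<omega> (z 2) (z 3) \<union> open_positive_arc \<omega> (z 4) (z 5) \<subseteq> closure \<Gamma>"
      "\<forall>w\<in>\<Gamma>. \<exists>\<gamma>. U_trajectory D f \<gamma> \<and> w \<in> path_image \<gamma>"
    using reg unfolding regular_on_def Let_def by (elim exE conjE) (rule that)
  have cont: "continuous_on D f" and po: "positively_ordered \<omega> (2 * 2) z" and z5: "z (2 * 2 + 1) = z 1"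
    and int: "\<forall>w\<in>interior D. regular_point (interior D) f w"
    and odd: "\<forall>k\<in>{1..2}. open_positive_arc \<omega> (z (2 * k - 1)) (z (2 * k)) \<noteq> {} \<and>
        (\<forall>w\<in>open_positive_arc \<omega> (z (2 * k - 1)) (z (2 * k)). regular_boundary_point (interior D) f w)"
    and even: "\<forall>k\<in>{1..2}. \<exists>c. positive_arc \<omega> (z (2 * k)) (z (2 * k + 1)) \<in> components {w \<in> D. f w = c}"
    using w unfolding weakly_regular_with_def by blast+
  obtain \<theta> :: "nat \<Rightarrow> real" where \<theta>: "\<forall>k\<in>{1..2*2}. z k = \<omega> (cis (\<theta> k))"
    "\<forall>k\<in>{1..<2*2}. \<theta> k \<le> \<theta> (k + 1)" "\<theta> (2 * 2) \<le> \<theta> 1 + 2 * pi"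
    using po unfolding positively_ordered_def by (elim exE conjE) (rule that)
  define t1 t2 t3 t4 where t: "t1 = \<theta> 1" "t2 = \<theta> 2" "t3 = \<theta> 3" "t4 = \<theta> 4"
  have z: "z 1 = bdry t1" "z 2 = bdry t2" "z 3 = bdry t3" "z 4 = bdry t4"
    using \<theta>(1) by (simp_all add: bdry_def t)
  have z5': "z 5 = bdry (t1 + 2 * pi)" using z5 z(1) bdry_periodic by simp
  have le: "t1 \<le> t2" "t2 \<le> t3" "t3 \<le> t4" "t4 \<le> t1 + 2 * pi"
    using bspec[OF \<theta>(2), of 1] bspec[OF \<theta>(2), of 2] bspec[OF \<theta>(2), of 3] \<theta>(3) by (simp_all add: t numeral_eq_Suc)
  have one: "open_positive_arc \<omega> (bdry s) (bdry s) = {}" for s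
    using open_positive_arc_bdry[of s s] by simp
  have odd1: "open_positive_arc \<omega> (bdry t1) (bdry t2) \<noteq> {}"
      "\<forall>w\<in>open_positive_arc \<omega> (bdry t1) (bdry t2). regular_boundary_point (interior D) f w"
    and odd2: "open_positive_arc \<omega> (bdry t3) (bdry t4) \<noteq> {}"
      "\<forall>w\<in>open_positive_arc \<omega> (bdry t3) (bdry t4). regular_boundary_point (interior D) f w"
    using bspec[OF odd, of 1] bspec[OF odd, of 2] z by simp_all
  have ne: "bdry t1 \<noteq> bdry t2" "bdry t3 \<noteq> bdry t4" using odd1(1) odd2(1) one by metis+
  \<comment> \<open>Nonempty open odd arcs force distinct end points, which excludes both a zero
    angle and a full turn.\<close>
  have "t1 \<noteq> t2" "t2 \<noteq> t1 + 2 * pi" "t3 \<noteq> t4" "t4 \<noteq> t3 + 2 * pi"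
    using ne bdry_periodic by metis+
  then have less: "t1 < t2" "t2 < t1 + 2 * pi" "t3 < t4" "t4 < t3 + 2 * pi" using le by linarith+
  have arcs: "open_positive_arc \<omega> (bdry t1) (bdry t2) = bdry ` {t1<..<t2}"
    "open_positive_arc \<omega> (bdry t3) (bdry t4) = bdry ` {t3<..<t4}"
    "open_positive_arc \<omega> (bdry t2) (bdry t3) = bdry ` {t2<..<t3}"
    "open_positive_arc \<omega> (bdry t4) (bdry (t1 + 2 * pi)) = bdry ` {t4<..<t1 + 2 * pi}"
    "positive_arc \<omega> (bdry t2) (bdry t3) = bdry ` {t2..t3}"
    "positive_arc \<omega> (bdry t4) (bdry (t1 + 2 * pi)) = bdry ` {t4..t1 + 2 * pi}"
    using less le by (intro open_positive_arc_bdry positive_arc_bdry; linarith)+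
  have e1: "\<exists>c. bdry ` {t2..t3} \<in> components {w \<in> D. f w = c}"
    using bspec[OF even, of 1] z arcs(5) by (simp add: numeral_eq_Suc)
  have e2: "\<exists>c. bdry ` {t4..t1 + 2 * pi} \<in> components {w \<in> D. f w = c}"
    using bspec[OF even, of 2] z z5' arcs(6) by simp
  have "regular_disk D h h' \<omega> \<omega>' f t1 t2 t3 t4"
  proof
    show "continuous_on D f" by (rule cont)
    show "t1 < t2" "t2 \<le> t3" "t3 < t4" "t4 \<le> t1 + 2 * pi" using less le by simp_all
    show "regular_point (interior D) f w" if "w \<in> interior D" for w using bspec[OF int that] .
    show "regular_boundary_point (interior D) f (bdry t)" if "t \<in> {t1<..<t2} \<union> {t3<..<t4}" for t
      using that odd1(2) odd2(2) unfolding arcs by blast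
    show "f (bdry t) = f (bdry t2)" if s: "t \<in> {t2..t3}" for t
    proof -
      obtain c where "bdry ` {t2..t3} \<subseteq> {w \<in> D. f w = c}" using e1 in_components_subset by blast
      then have "f (bdry s) = c" if "s \<in> {t2..t3}" for s using that by blast
      then show ?thesis using s le by simp
    qed
    show "f (bdry t) = f (bdry t1)" if s: "t \<in> {t4..t1 + 2 * pi}" for t
    proof -
      obtain c where "bdry ` {t4..t1 + 2 * pi} \<subseteq> {w \<in> D. f w = c}" using e2 in_components_subset by blast
      then have "f (bdry s) = c" if "s \<in> {t4..t1 + 2 * pi}" for s using that by blast
      from this[of "t1 + 2 * pi"] this[OF s] show ?thesis using le bdry_periodic by simp
    qed
    show "\<exists>t\<in>{u<..<v}. \<exists>\<gamma>. U_trajectory D f \<gamma> \<and> bdry t \<in> path_image \<gamma>"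
      if uv: "t2 \<le> u \<and> v \<le> t3 \<or> t4 \<le> u \<and> v \<le> t1 + 2 * pi" "u < v" for u v
    proof -
      \<comment> \<open>An angle closer to the midpoint than half the length lies between
        \<open>u\<close> and \<open>v\<close>; a point of \<open>\<Gamma>\<close> near
        \<open>bdry m\<close> has such an angle.\<close>
      define m where "m = (u + v) / 2"
      have "m \<in> {t2<..<t3} \<union> {t4<..<t1 + 2 * pi}" using uv by (auto simp: m_def)
      then have m: "bdry m \<in> closure \<Gamma>" using \<Gamma>(2) unfolding z z5' arcs by blast
      obtain N where N: "open N" "bdry m \<in> N" "\<forall>y\<in>frontier D \<inter> N. \<exists>t. \<bar>t - m\<bar> < (v - u) / 2 \<and> bdry t = y"
        using bdry_local[of "(v - u) / 2" m] uv(2) by auto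
      have "N \<inter> \<Gamma> \<noteq> {}" using m N(1,2) open_Int_closure_eq_empty[OF N(1), of \<Gamma>] by blast
      then obtain x where x: "x \<in> N" "x \<in> \<Gamma>" by blast
      have "x \<in> frontier D" using x(2) \<Gamma>(1) bdry_frontier unfolding z z5' arcs by blast
      then obtain t where t: "\<bar>t - m\<bar> < (v - u) / 2" "bdry t = x" using bspec[OF N(3), of x] x(1) by blast
      have "u < t \<and> t < v" using t(1) unfolding m_def abs_less_iff by argo
      then show ?thesis using bspec[OF \<Gamma>(3) x(2)] t(2) by auto
    qed
  qed
  then show ?thesis by blast
qed

text \<open>If \<open>f\<close> decreases along the first odd arc, then constancy on the even arcs
  makes it increase along the second, and the rotated numbering applies.\<close>

lemma (in regular_disk) strip_of_regular_disk:
  "\<exists>lo hi a b pos. strip D f lo hi a b pos \<and>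
     frontier D = {x \<in> D. f x \<in> {lo, hi}} \<union> a ` {lo..hi} \<union> b ` {lo..hi}"
proof (cases "F t1 < F t2")
  case True
  then interpret increasing_disk D h h' \<omega> \<omega>' f t1 t2 t3 t4 by unfold_locales
  show ?thesis using strip_exists frontier_decomposition by blast
next
  case False
  have "F t1 \<noteq> F t2" using inj_onD[OF inj_on_F(1), of t1 t2] order by auto
  then have less: "F t3 < F t4" using False F3 F4 by simp
  interpret R: regular_disk D h h' \<omega> \<omega>' f t3 t4 "t1 + 2 * pi" "t2 + 2 * pi" by (rule rotate)
  interpret R: increasing_disk D h h' \<omega> \<omega>' f t3 t4 "t1 + 2 * pi" "t2 + 2 * pi"
    using less by unfold_locales
  show ?thesis using R.strip_exists R.frontier_decomposition by blast
qed

lemma (in disk_boundary) regular_on_imp_strip: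
  assumes "regular_on \<omega> D f"
  shows "\<exists>lo hi a b pos. strip D f lo hi a b pos \<and>
     frontier D = {x \<in> D. f x \<in> {lo, hi}} \<union> a ` {lo..hi} \<union> b ` {lo..hi}"
proof -
  obtain t1 t2 t3 t4 where "regular_disk D h h' \<omega> \<omega>' f t1 t2 t3 t4"
    using regular_on_imp_regular_disk[OF assms] by (elim exE) (rule that)
  then show ?thesis by (rule regular_disk.strip_of_regular_disk)
qed

text \<open>Identifies \<open>lo\<close> and \<open>hi\<close> from the frontier values alone, which
  \<open>\<phi>0\<close> transports from \<open>f\<close> to \<open>g\<close>.\<close>

lemma strip_frontier_image:
  assumes "strip D f lo hi a b pos"
    and "frontier D = {x \<in> D. f x \<in> {lo, hi}} \<union> a ` {lo..hi} \<union> b ` {lo..hi}"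
  shows "f ` frontier D = {lo..hi}"
proof -
  interpret strip D f lo hi a b pos by (rule assms(1))
  show ?thesis
  proof
    have "frontier D \<subseteq> D" using closed_D by (rule frontier_subset_closed)
    then show "f ` frontier D \<subseteq> {lo..hi}" using range_f by blast
    show "{lo..hi} \<subseteq> f ` frontier D"
    proof
      fix c assume c: "c \<in> {lo..hi}"
      then have "a c \<in> frontier D" unfolding assms(2) by blast
      moreover have "f (a c) = c" using a_fibre[OF c] by blast
      ultimately show "c \<in> f ` frontier D" by (metis imageI)
    qed
  qed
qed

text \<open>Over an intermediate level the frontier contains exactly the two fibre ends, so
  \<open>\<phi>\<close> either keeps or exchanges them. Each alternative holds on a relatively
  closed set of levels, and they exclude each other; connectedness of the open interval makes the
  choice uniform, and continuity extends it to the extreme levels.\<close>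

lemma fibre_ends_matched:
  assumes f: "strip D f lo hi a b pos" and g: "strip D g lo hi a' b' pos'"
    and fr: "frontier D = {x \<in> D. f x \<in> {lo, hi}} \<union> a ` {lo..hi} \<union> b ` {lo..hi}"
      "frontier D = {x \<in> D. g x \<in> {lo, hi}} \<union> a' ` {lo..hi} \<union> b' ` {lo..hi}"
    and \<phi>: "continuous_on (frontier D) \<phi>" "inj_on \<phi> (frontier D)" "\<phi> ` frontier D \<subseteq> frontier D"
      "\<forall>x\<in>frontier D. g (\<phi> x) = f x"
  shows "(\<forall>c\<in>{lo..hi}. \<phi> (a c) = a' c \<and> \<phi> (b c) = b' c) \<or> (\<forall>c\<in>{lo..hi}. \<phi> (a c) = b' c \<and> \<phi> (b c) = a' c)"
proof -
  interpret F: strip D f lo hi a b pos by (rule f)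
  interpret G: strip D g lo hi a' b' pos' by (rule g)
  have aS: "a c \<in> frontier D" "b c \<in> frontier D" if "c \<in> {lo..hi}" for c using that fr(1) by blast+
  have fa: "f (a c) = c" "f (b c) = c" if "c \<in> {lo..hi}" for c
    using F.a_fibre[OF that] F.b_fibre[OF that] by auto
  have ga: "g (a' c) = c" "g (b' c) = c" if "c \<in> {lo..hi}" for c
    using G.a_fibre[OF that] G.b_fibre[OF that] by auto
  have only: "y = a' c \<or> y = b' c" if y: "y \<in> frontier D" "g y = c" "c \<in> {lo<..<hi}" for y c
  proof -
    have "y \<in> a' ` {lo..hi} \<union> b' ` {lo..hi}" using y unfolding fr(2) by auto
    then obtain d where "d \<in> {lo..hi}" "y = a' d \<or> y = b' d" by blast
    then show ?thesis using ga y(2) by auto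
  qed
  have two: "\<phi> (a c) = a' c \<and> \<phi> (b c) = b' c \<or> \<phi> (a c) = b' c \<and> \<phi> (b c) = a' c" if c: "c \<in> {lo<..<hi}" for c
  proof -
    have cc: "c \<in> {lo..hi}" using c by auto
    have in1: "\<phi> (a c) \<in> frontier D" "\<phi> (b c) \<in> frontier D" using \<phi>(3) aS[OF cc] by blast+
    have g1: "g (\<phi> (a c)) = c" "g (\<phi> (b c)) = c" using \<phi>(4) aS[OF cc] fa[OF cc] by simp_all
    have "\<phi> (a c) \<noteq> \<phi> (b c)" using inj_onD[OF \<phi>(2) _ aS[OF cc]] F.a_neq_b[OF c] by blast
    then show ?thesis using only[OF in1(1) g1(1) c] only[OF in1(2) g1(2) c] by metis
  qed
  have eq: "closed {c \<in> {lo..hi}. p c = q c}" if "continuous_on {lo..hi} p" "continuous_on {lo..hi} q"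
    for p q :: "real \<Rightarrow> complex"
  proof -
    have "closed {c \<in> {lo..hi}. p c - q c = 0}"
      using continuous_closed_preimage_constant[OF continuous_on_diff[OF that] closed_atLeastAtMost] .
    then show ?thesis by simp
  qed
  have c\<phi>: "continuous_on {lo..hi} (\<lambda>c. \<phi> (a c))" "continuous_on {lo..hi} (\<lambda>c. \<phi> (b c))"
    using continuous_on_compose2[OF \<phi>(1) F.cont_a] continuous_on_compose2[OF \<phi>(1) F.cont_b] aS by blast+
  have all: "\<forall>c\<in>{lo..hi}. p c = q c" if pq: "continuous_on {lo..hi} p" "continuous_on {lo..hi} q"
      "\<forall>c\<in>{lo<..<hi}. p c = q c" for p q :: "real \<Rightarrow> complex"
  proof -
    have "closure {lo<..<hi} \<subseteq> {c \<in> {lo..hi}. p c = q c}"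
      using pq(3) by (intro closure_minimal eq pq) auto
    then show ?thesis using closure_greaterThanLessThan[OF F.lo_hi] by auto
  qed
  have sub: "{lo<..<hi} \<subseteq> {lo..hi}" by auto
  define A B where "A = {c \<in> {lo..hi}. \<phi> (a c) = a' c}" and "B = {c \<in> {lo..hi}. \<phi> (a c) = b' c}"
  have "closed A" "closed B" unfolding A_def B_def by (intro eq c\<phi> G.cont_a G.cont_b)+
  moreover have "{lo<..<hi} \<subseteq> A \<union> B"
  proof
    fix c assume c: "c \<in> {lo<..<hi}"
    then have "c \<in> {lo..hi}" by auto
    then show "c \<in> A \<union> B" using two[OF c] unfolding A_def B_def by blast
  qed
  moreover have "A \<inter> B \<inter> {lo<..<hi} = {}"
  proof (rule equals0I)
    fix c assume "c \<in> A \<inter> B \<inter> {lo<..<hi}"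
    then have "\<phi> (a c) = a' c" "\<phi> (a c) = b' c" "c \<in> {lo<..<hi}" unfolding A_def B_def by blast+
    then have "a' c = b' c" "c \<in> {lo<..<hi}" by simp_all
    then show False using G.a_neq_b by blast
  qed
  ultimately have "A \<inter> {lo<..<hi} = {} \<or> B \<inter> {lo<..<hi} = {}"
    using connected_closedD[of "{lo<..<hi}" A B] by (simp add: connected_Ioo)
  then show ?thesis
  proof
    assume "A \<inter> {lo<..<hi} = {}"
    then have "\<forall>c\<in>{lo<..<hi}. \<phi> (a c) \<noteq> a' c" using sub unfolding A_def by blast
    then have "\<forall>c\<in>{lo<..<hi}. \<phi> (a c) = b' c" "\<forall>c\<in>{lo<..<hi}. \<phi> (b c) = a' c" using two by blast+
    then show ?thesis using all[OF c\<phi>(1) G.cont_b] all[OF c\<phi>(2) G.cont_a] by blast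
  next
    assume "B \<inter> {lo<..<hi} = {}"
    then have "\<forall>c\<in>{lo<..<hi}. \<phi> (a c) \<noteq> b' c" using sub unfolding B_def by blast
    then have "\<forall>c\<in>{lo<..<hi}. \<phi> (a c) = a' c" "\<forall>c\<in>{lo<..<hi}. \<phi> (b c) = b' c" using two by blast+
    then show ?thesis using all[OF c\<phi>(1) G.cont_a] all[OF c\<phi>(2) G.cont_b] by blast
  qed
qed

theorem theorem3p4:
  fixes D :: "complex set"
    and \<omega> \<phi>0 \<phi>0' :: "complex \<Rightarrow> complex"
    and f g :: "complex \<Rightarrow> real"
  assumes "closed D"
    and "D homeomorphic (cball 0 1 :: complex set)"
    and "boundary_orientation \<omega> D"
    and "regular_on \<omega> D f"
    and "regular_on \<omega> D g"
    and "homeomorphism (frontier D) (frontier D) \<phi>0 \<phi>0'"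
    and "\<forall>z\<in>frontier D. g (\<phi>0 z) = f z"
  shows "\<exists>\<phi> \<phi>'. homeomorphism D D \<phi> \<phi>' \<and>
           (\<forall>z\<in>frontier D. \<phi> z = \<phi>0 z) \<and>
           (\<forall>z\<in>D. g (\<phi> z) = f z)"
proof -
  obtain h h' where "homeomorphism (cball 0 1 :: complex set) D h h'"
    using assms(2) homeomorphism_symD unfolding homeomorphic_def by blast
  moreover obtain \<omega>' where "homeomorphism (sphere 0 1) (frontier D) \<omega> \<omega>'"
    using assms(3) unfolding boundary_orientation_def by blast
  ultimately interpret disk_boundary D h h' \<omega> \<omega>' by unfold_locales
  obtain lo hi a b pos where f: "strip D f lo hi a b pos"
    "frontier D = {x \<in> D. f x \<in> {lo, hi}} \<union> a ` {lo..hi} \<union> b ` {lo..hi}"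
    using regular_on_imp_strip[OF assms(4)] by (elim exE conjE) (rule that)
  obtain lo' hi' a' b' pos' where g': "strip D g lo' hi' a' b' pos'"
    "frontier D = {x \<in> D. g x \<in> {lo', hi'}} \<union> a' ` {lo'..hi'} \<union> b' ` {lo'..hi'}"
    using regular_on_imp_strip[OF assms(5)] by (elim exE conjE) (rule that)
  have im: "\<phi>0 ` frontier D = frontier D" and inj: "inj_on \<phi>0 (frontier D)"
    using homeomorphism_image1[OF assms(6)] homeomorphism_apply1[OF assms(6)] by (blast, metis inj_onI)
  have cont: "continuous_on (frontier D) \<phi>0" using homeomorphism_cont1[OF assms(6)] .
  have "{lo'..hi'} = g ` \<phi>0 ` frontier D" using strip_frontier_image[OF g'] im by simp
  also have "\<dots> = f ` frontier D" using assms(7) by (simp add: image_image)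
  also have "\<dots> = {lo..hi}" by (rule strip_frontier_image[OF f])
  finally have eq: "lo' = lo" "hi' = hi" using strip.lo_hi[OF g'(1)] by (simp_all add: Icc_eq_Icc)
  note g = g'[unfolded eq]
  have imD: "\<phi>0 x \<in> D" if "x \<in> frontier D" for x using im that frontier_subset_disk by blast
  have gf: "g (\<phi>0 x) = f x" if "x \<in> frontier D" for x using assms(7) that by blast
  note m = fibre_ends_matched[OF f(1) g(1) f(2) g(2) cont inj equalityD1[OF im] assms(7)]
  then show ?thesis
  proof
    assume "\<forall>c\<in>{lo..hi}. \<phi>0 (a c) = a' c \<and> \<phi>0 (b c) = b' c"
    then show ?thesis by (intro strip_extension[OF f(1) g(1) f(2) cont inj imD gf]) auto
  next
    \<comment> \<open>Reversing the strip of \<open>g\<close> exchanges the roles of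
      \<open>a'\<close> and \<open>b'\<close>, so the extension lemma applies with matching
      ends.\<close>
    assume "\<forall>c\<in>{lo..hi}. \<phi>0 (a c) = b' c \<and> \<phi>0 (b c) = a' c"
    then show ?thesis by (intro strip_extension[OF f(1) strip.strip_reverse[OF g(1)] f(2) cont inj imD gf]) auto
  qed
qed

end
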